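(* The image $\operatorname{Im}(\Phi)$ of the map $\Phi:M_D\to\mathcal{M}_6^b$, which sends the class of a Desargues configuration $D_\pi$ to the class of its Jacobian sextic $J_\pi$, satisfies $$\mathcal{M}_6^b\setminus\mathcal{H}\ \subseteq\ \operatorname{Im}(\Phi)\ \subseteq\ \mathcal{M}_6^b ,$$ where $\mathcal{H}=\rho(Jac(\mathcal{D})\cap U_{st})\subset \mathcal{M}_6^b$ is the hypersurface defined in the context.
   Context: Everything is over $\mathbb{C}$. In $\mathbb{P}^3$ fix $e_1=(1:0:0:0),\dots,e_4=(0:0:0:1),\ e_5=(1:1:1:1)$. A plane $\pi:\sum_{i=1}^4\alpha_iz_i=0$ is nondegenerate if it contains none of the $e_i$. For such $\pi$, the Desargues configuration $D_\pi$ in $\pi$ consists of the 10 points $p_{ij}=\overline{e_ie_j}\cap\pi$ and the 10 lines $\ell_{ijk}=\overline{e_ie_je_k}\cap\pi$. Every Desargues configuration is, up to projective isomorphism of planes, of this form. Let $M_D$ be the quotient of the open set of nondegenerate planes in $(\mathbb{P}^3)^*$ by the group $\mathcal{S}_5$ of projective automorphisms of $\mathbb{P}^3$ permuting $e_1,\dots,e_5$; its points correspond to isomorphism classes of Desargues configurations. The von Staudt conic $s_\pi\subset\pi$ is the unique smooth conic such that the polar line of $p_{ij}$ is $\ell_{klm}$ whenever $\{i,j,k,l,m\}=\{1,\dots,5\}$. For fixed $i$, the pencil of conics in $\pi$ through the four points $p_{ij}$, $j\neq i$, restricts on $s_\pi\cong\mathbb{P}^1$ to a pencil of binary quartics spanned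 by $f_1,f_2$; the Jacobian sextic is $J_\pi=\det(\partial f_i/\partial x_j)$, well defined up to a nonzero constant and an automorphism of $\mathbb{P}^1$, independent of $i$, and stable (no root of multiplicity $\ge3$). $\mathcal{M}_6^b$ is the moduli space of stable binary sextics: let $U_{st}\subset\mathbb{P}^6$ be the open set of stable sextics in the projective space of binary sextics and $\rho:U_{st}\to\mathcal{M}_6^b$ the natural quotient map by $PGL_2(\mathbb{C})$. Definition of $\mathcal{H}$: identify a binary quartic $f=a_0t_0^4+4a_1t_0^3t_1+6a_2t_0^2t_1^2+4a_3t_0t_1^3+a_4t_1^4$ with the point $(a_0:\dots:a_4)\in\mathbb{P}^4$ and associate to it the conic with matrix $$q_f=\begin{pmatrix} a_0 & a_1 & a_2 \\ a_1 & a_2 & a_3 \\ a_2 & a_3 & a_4 \end{pmatrix}.$$ Let $Gr(1,4)$ be the Grassmannian of lines in $\mathbb{P}^4$, i.e. of pencils of binary quartics, and let $Jac:Gr(1,4)\to\mathbb{P}^6$ send the pencil spanned by $f_1,f_2$ to the sextic $\det(\partial f_i/\partial t_j)$ (up to scalar). Let $\mathcal{D}\subset Gr(1,4)$ be the hypersurface of pencils spanned by $f_1,f_2$ such that the discriminant of the binary cubic $\det(\lambda q_{f_1}+\mu q_{f_2})$ in $(\lambda,\mu)$ is zero. Put $\mathcal{H}:=\rho(Jac(\mathcal{D})\cap U_{st})$. *)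

theory Defs
  imports "HOL-Analysis.Analysis" "HOL-Computational_Algebra.Polynomial"
begin

text \<open>
  Points, lines and planes of a complex projective space are represented by linear
  subspaces of the underlying vector space.  The coordinates of a vector of type
  complex^n are numbered from 1 to n; only for complex^5 do we number them
  from 0 to 4 (in the index type 5 one has 5 = 0).
\<close>

definition proj_points :: "(complex^'n) set \<Rightarrow> (complex^'n) set set" where
  "proj_points V = {vec.span {v} | v. v \<in> V \<and> v \<noteq> 0}"


section \<open>Nondegenerate planes and Desargues configurations\<close>

definition ref_pt :: "nat \<Rightarrow> complex^4" where
  "ref_pt i = (if i = 1 then vector [1,0,0,0]
          else if i = 2 then vector [0,1,0,0]
          else if i = 3 then vector [0,0,1,0]
          else if i = 4 then vector [0,0,0,1]
          else vector [1,1,1,1])"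

definition plane :: "complex^4 \<Rightarrow> (complex^4) set" where
  "plane \<alpha> = {z. (\<Sum>i\<in>UNIV. \<alpha> $ i * z $ i) = 0}"

definition nondegenerate_planes :: "(complex^4) set set" where
  "nondegenerate_planes = {plane \<alpha> | \<alpha>. \<alpha> \<noteq> 0 \<and> (\<forall>i\<in>{1..5}. ref_pt i \<notin> plane \<alpha>)}"

definition desargues_point :: "(complex^4) set \<Rightarrow> nat \<Rightarrow> nat \<Rightarrow> (complex^4) set" where
  "desargues_point \<pi> i j = vec.span {ref_pt i, ref_pt j} \<inter> \<pi>"

definition desargues_line :: "(complex^4) set \<Rightarrow> nat \<Rightarrow> nat \<Rightarrow> nat \<Rightarrow> (complex^4) set" where
  "desargues_line \<pi> i j k = vec.span {ref_pt i, ref_pt j, ref_pt k} \<inter> \<pi>"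

text \<open>Matrices of the projective automorphisms permuting the five reference points.\<close>

definition S5_matrices :: "(complex^4^4) set" where
  "S5_matrices = {A. invertible A \<and>
     (\<exists>\<sigma>. \<sigma> permutes {1..5} \<and>
       (\<forall>i\<in>{1..5}. vec.span {A *v ref_pt i} = vec.span {ref_pt (\<sigma> i)}))}"

definition S5_rel :: "((complex^4) set \<times> (complex^4) set) set" where
  "S5_rel = {(\<pi>, \<pi>'). \<exists>A\<in>S5_matrices. \<pi>' = (\<lambda>z. A *v z) ` \<pi>}"

definition M_D :: "(complex^4) set set set" where
  "M_D = nondegenerate_planes // S5_rel"


section \<open>Conics in a plane and the von Staudt conic\<close>

text \<open>
  A conic in a plane is given by a symmetric bilinear form on the ambient four-dimensional
  space; only its restriction to the plane is ever used.
\<close>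

definition bform :: "complex^4^4 \<Rightarrow> complex^4 \<Rightarrow> complex^4 \<Rightarrow> complex" where
  "bform B u v = (\<Sum>i\<in>UNIV. \<Sum>j\<in>UNIV. B $ i $ j * u $ i * v $ j)"

definition conic_points :: "(complex^4) set \<Rightarrow> complex^4^4 \<Rightarrow> (complex^4) set set" where
  "conic_points \<pi> B = {P \<in> proj_points \<pi>. \<forall>v\<in>P. bform B v v = 0}"

definition smooth_conic :: "(complex^4) set \<Rightarrow> complex^4^4 \<Rightarrow> bool" where
  "smooth_conic \<pi> B \<longleftrightarrow> transpose B = B \<and>
     (\<forall>u\<in>\<pi>. (\<forall>v\<in>\<pi>. bform B u v = 0) \<longrightarrow> u = 0)"

definition polar_line :: "(complex^4) set \<Rightarrow> complex^4^4 \<Rightarrow> (complex^4) set \<Rightarrow> (complex^4) set" where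
  "polar_line \<pi> B P = {v \<in> \<pi>. \<forall>u\<in>P. bform B u v = 0}"

definition von_staudt_conic :: "(complex^4) set \<Rightarrow> complex^4^4 \<Rightarrow> bool" where
  "von_staudt_conic \<pi> B \<longleftrightarrow> smooth_conic \<pi> B \<and>
     (\<forall>i j k l m. {i, j, k, l, m} = {1..5} \<longrightarrow>
        polar_line \<pi> B (desargues_point \<pi> i j) = desargues_line \<pi> k l m)"


section \<open>Binary forms\<close>

text \<open>Binary forms are treated as polynomial functions of \<open>(t\<^sub>0, t\<^sub>1) = (t $ 1, t $ 2)\<close>.\<close>

definition binary_forms :: "nat \<Rightarrow> (complex^2 \<Rightarrow> complex) set" where
  "binary_forms d =
     {f. \<exists>a :: nat \<Rightarrow> complex. \<forall>t. f t = (\<Sum>k\<le>d. a k * t $ 1 ^ (d - k) * t $ 2 ^ k)}"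

definition partial :: "2 \<Rightarrow> (complex^2 \<Rightarrow> complex) \<Rightarrow> complex^2 \<Rightarrow> complex" where
  "partial j f t = deriv (\<lambda>x. f (t + axis j x)) 0"

definition jacobian_form ::
    "(complex^2 \<Rightarrow> complex) \<Rightarrow> (complex^2 \<Rightarrow> complex) \<Rightarrow> complex^2 \<Rightarrow> complex" where
  "jacobian_form f1 f2 t =
     det (vector [vector [partial 1 f1 t, partial 2 f1 t],
                  vector [partial 1 f2 t, partial 2 f2 t]] :: complex^2^2)"

definition form_pencil ::
    "(complex^2 \<Rightarrow> complex) \<Rightarrow> (complex^2 \<Rightarrow> complex) \<Rightarrow> (complex^2 \<Rightarrow> complex) set" where
  "form_pencil f1 f2 = {\<lambda>t. x * f1 t + y * f2 t | x y. True}"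

definition form_point :: "(complex^2 \<Rightarrow> complex) \<Rightarrow> (complex^2 \<Rightarrow> complex) set" where
  "form_point f = {\<lambda>t. c * f t | c. True}"

definition root_mult_ge :: "nat \<Rightarrow> (complex^2 \<Rightarrow> complex) \<Rightarrow> nat \<Rightarrow> complex^2 \<Rightarrow> bool" where
  "root_mult_ge d f m p \<longleftrightarrow>
     (\<exists>g\<in>binary_forms (d - m). \<forall>t. f t = (p $ 2 * t $ 1 - p $ 1 * t $ 2) ^ m * g t)"

definition stable_sextic :: "(complex^2 \<Rightarrow> complex) \<Rightarrow> bool" where
  "stable_sextic f \<longleftrightarrow> f \<in> binary_forms 6 \<and> f \<noteq> (\<lambda>t. 0) \<and>
     \<not> (\<exists>p. p \<noteq> 0 \<and> root_mult_ge 6 f 3 p)"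

definition U_st :: "(complex^2 \<Rightarrow> complex) set set" where
  "U_st = {form_point f | f. stable_sextic f}"

definition PGL2_rel ::
    "((complex^2 \<Rightarrow> complex) set \<times> (complex^2 \<Rightarrow> complex) set) set" where
  "PGL2_rel = {(P, Q). \<exists>A :: complex^2^2. invertible A \<and> Q = (\<lambda>f t. f (A *v t)) ` P}"

definition M6b :: "(complex^2 \<Rightarrow> complex) set set set" where
  "M6b = U_st // PGL2_rel"

definition rho :: "(complex^2 \<Rightarrow> complex) set \<Rightarrow> (complex^2 \<Rightarrow> complex) set set" where
  "rho P = PGL2_rel `` {P}"


section \<open>The Jacobian sextic of a Desargues configuration\<close>

text \<open>
  An isomorphism of the projective line onto a smooth conic is given by binary quadratic
  forms.  Conversely, in characteristic 0 every bijective morphism onto a smooth curve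
  is an isomorphism.
\<close>

definition conic_parametrization ::
    "(complex^4) set \<Rightarrow> complex^4^4 \<Rightarrow> (complex^2 \<Rightarrow> complex^4) \<Rightarrow> bool" where
  "conic_parametrization \<pi> B \<phi> \<longleftrightarrow>
     (\<forall>k. (\<lambda>t. \<phi> t $ k) \<in> binary_forms 2) \<and> (\<forall>t. t \<noteq> 0 \<longrightarrow> \<phi> t \<noteq> 0) \<and>
     bij_betw (\<lambda>L. vec.span (\<phi> ` L)) (proj_points UNIV) (conic_points \<pi> B)"

text \<open>
  The quartics obtained by pulling back along \<open>\<phi>\<close> the conics through the four points
  \<open>p\<^bsub>ij\<^esub>\<close>, \<open>j \<noteq> i\<close>.
\<close>

definition restricted_pencil ::
    "(complex^4) set \<Rightarrow> (complex^2 \<Rightarrow> complex^4) \<Rightarrow> nat \<Rightarrow> (complex^2 \<Rightarrow> complex) set" where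
  "restricted_pencil \<pi> \<phi> i =
     {\<lambda>t. bform C (\<phi> t) (\<phi> t) | C. transpose C = C \<and>
        (\<forall>j\<in>{1..5} - {i}. \<forall>v\<in>desargues_point \<pi> i j. bform C v v = 0)}"

definition jacobian_sextic :: "(complex^4) set \<Rightarrow> (complex^2 \<Rightarrow> complex) \<Rightarrow> bool" where
  "jacobian_sextic \<pi> J \<longleftrightarrow>
     (\<exists>B \<phi> i f1 f2. von_staudt_conic \<pi> B \<and> conic_parametrization \<pi> B \<phi> \<and> i \<in> {1..5} \<and>
        restricted_pencil \<pi> \<phi> i = form_pencil f1 f2 \<and> J = jacobian_form f1 f2)"

text \<open>
  The union of the orbits of all Jacobian sextics, over all representatives \<open>\<pi>\<close> of the
  class and all choices made in the construction of the sextic.  It is an element of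
  \<open>M6b\<close> exactly if such sextics exist, are all stable and lie in one orbit, i.e. if the
  class of the Jacobian sextic is well defined.
\<close>

definition Phi :: "(complex^4) set set \<Rightarrow> (complex^2 \<Rightarrow> complex) set set" where
  "Phi X = \<Union> {rho (form_point J) | \<pi> J. \<pi> \<in> X \<and> jacobian_sextic \<pi> J}"


section \<open>Pencils of binary quartics and the hypersurface\<close>

definition quartic :: "complex^5 \<Rightarrow> complex^2 \<Rightarrow> complex" where
  "quartic a t = a $ 0 * t $ 1 ^ 4 + 4 * a $ 1 * t $ 1 ^ 3 * t $ 2
     + 6 * a $ 2 * t $ 1 ^ 2 * t $ 2 ^ 2 + 4 * a $ 3 * t $ 1 * t $ 2 ^ 3 + a $ 4 * t $ 2 ^ 4"

definition q_matrix :: "complex^5 \<Rightarrow> complex^3^3" where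
  "q_matrix a = vector [vector [a $ 0, a $ 1, a $ 2],
                        vector [a $ 1, a $ 2, a $ 3],
                        vector [a $ 2, a $ 3, a $ 4]]"

definition Gr14 :: "(complex^5) set set" where
  "Gr14 = {W. vec.subspace W \<and> vec.dim W = 2}"

text \<open>
  For \<open>W\<close> in \<open>Gr14\<close> a change of basis multiplies the Jacobian by a nonzero constant,
  so the union is over copies of a single point of the space of sextics.
\<close>

definition Jac :: "(complex^5) set \<Rightarrow> (complex^2 \<Rightarrow> complex) set" where
  "Jac W = \<Union> {form_point (jacobian_form (quartic a) (quartic b)) | a b. W = vec.span {a, b}}"

text \<open>
  The binary cubic \<open>det (\<lambda> q\<^sub>a + \<mu> q\<^sub>b)\<close>, dehomogenized by \<open>\<mu> = 1\<close>: the coefficient of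
  \<open>\<lambda>\<^sup>k \<mu>\<^bsup>3-k\<^esup>\<close> is the \<open>k\<close>-th coefficient of this polynomial.
\<close>

definition det_cubic :: "complex^5 \<Rightarrow> complex^5 \<Rightarrow> complex poly" where
  "det_cubic a b = det (\<chi> i j. [:q_matrix b $ i $ j, q_matrix a $ i $ j:])"

text \<open>
  The discriminant of a binary cubic; as the cubic is treated as a form, a vanishing
  leading coefficient is allowed (a root at infinity).
\<close>

definition cubic_discriminant :: "complex poly \<Rightarrow> complex" where
  "cubic_discriminant p =
     (let a = coeff p 3; b = coeff p 2; c = coeff p 1; d = coeff p 0 in
      b^2 * c^2 - 4 * a * c^3 - 4 * b^3 * d - 27 * a^2 * d^2 + 18 * a * b * c * d)"

definition D_hyp :: "(complex^5) set set" where
  "D_hyp = {W \<in> Gr14. \<exists>a b. W = vec.span {a, b} \<and> cubic_discriminant (det_cubic a b) = 0}"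

definition H_hyp :: "(complex^2 \<Rightarrow> complex) set set set" where
  "H_hyp = rho ` (Jac ` D_hyp \<inter> U_st)"

end

theory Submission
  imports Defs "HOL-Computational_Algebra.Fundamental_Theorem_Algebra"
begin

text \<open>
  Write a plane as \<open>\<Sum> \<alpha>\<^sub>i z\<^sub>i = 0\<close>.  Its von Staudt conic is \<open>\<Sum> \<alpha>\<^sub>i z\<^sub>i\<^sup>2 = 0\<close>, and the Jacobian
  sextic turns out to be the restriction to this conic of the cubic \<open>\<Sum> \<alpha>\<^sub>i z\<^sub>i\<^sup>3\<close>.  With the
  fifth coordinate \<open>z\<^sub>5 = 0\<close> and \<open>\<alpha>\<^sub>5 = -(\<alpha>\<^sub>1 + \<dots> + \<alpha>\<^sub>4)\<close> this is symmetric in the five indices,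
  so it does not depend on the pencil used.  At a triple root with
  coordinate vector \<open>A\<close> the vector \<open>(A\<^sub>i\<^sup>2)\<close> would be a multiple of \<open>A\<close>, so \<open>A\<close> would be
  proportional to the indicator of a set of indices with \<open>\<Sum> \<alpha>\<^sub>i = 0\<close>; the vanishing
  of the next coefficient then contradicts the smoothness of the conic.

  Conversely, moving two roots of a stable sextic to \<open>0\<close> and \<open>\<infinity>\<close>, one writes down a pencil
  of quartics with this Jacobian by solving an equation of degree at most \<open>5\<close>.  If the
  discriminant does not vanish, the conics of the pencil have four base points in general
  position, and all of them are apolar to the conic of squares.  So in suitable linear forms
  \<open>z\<^sub>1, z\<^sub>2, z\<^sub>3\<close> the pencil is spanned by \<open>z\<^sub>3(z\<^sub>1 - z\<^sub>2)\<close> and \<open>z\<^sub>1(z\<^sub>2 - z\<^sub>3)\<close>, and the dual form of the conic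
  has the Gram matrix \<open>\<delta>\<^sub>i\<^sub>j / \<alpha>\<^sub>i + 1 / \<alpha>\<^sub>5\<close>, which is that of a Desargues configuration.  This
  fails only if three of the base points form a self-polar triangle; then the sextic is also the
  Jacobian of a pencil with a double base point, so its class lies in the hypersurface.
\<close>


section \<open>Binary forms and their Jacobians\<close>

text \<open>Apolarity enters because the Hankel matrix of a quartic has \<open>a\<^sub>2\<close> in
  two places: this one linear condition says that its conic is apolar to the conic of squares. A
  singular conic of the pencil is therefore a pair of conjugate lines, and conjugacy within two such
  pairs makes the three mutual products of \<open>z\<^sub>1\<close>, \<open>z\<^sub>2\<close>,
  \<open>z\<^sub>3\<close> equal. Their common value is \<open>1 / \<alpha>\<^sub>5\<close>; the
  diagonal then determines the other coefficients, unless a denominator vanishes, which happens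
  exactly for self-polar triangles of base points. The degree 5 is that of the Grassmannian in its
  Pluecker embedding, of which \<open>Jac\<close> is a linear projection. Lying outside the
  hypersurface is a condition on the class of the sextic, so it gives every pencil with this
  Jacobian a nonzero discriminant. This is why exhibiting one bad pencil excludes the self-polar
  case. Since \<open>Phi\<close> is a union over all representatives and all choices, the inclusion
  into \<open>M6b\<close> contains the well-definedness of the map.\<close>

lemma binary_forms_add:
  assumes "f \<in> binary_forms d" "g \<in> binary_forms d"
  shows "(\<lambda>t. f t + g t) \<in> binary_forms d"
proof -
  obtain a b where "\<forall>t. f t = (\<Sum>k\<le>d. a k * t $ 1 ^ (d - k) * t $ 2 ^ k)"
    "\<forall>t. g t = (\<Sum>k\<le>d. b k * t $ 1 ^ (d - k) * t $ 2 ^ k)"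
    using assms unfolding binary_forms_def by blast
  then have "\<forall>t. f t + g t = (\<Sum>k\<le>d. (a k + b k) * t $ 1 ^ (d - k) * t $ 2 ^ k)"
    by (simp add: sum.distrib algebra_simps)
  then show ?thesis unfolding binary_forms_def by (auto intro!: exI[of _ "\<lambda>k. a k + b k"])
qed

lemma binary_forms_scale:
  assumes "f \<in> binary_forms d"
  shows "(\<lambda>t. c * f t) \<in> binary_forms d"
proof -
  obtain a where "\<forall>t. f t = (\<Sum>k\<le>d. a k * t $ 1 ^ (d - k) * t $ 2 ^ k)"
    using assms unfolding binary_forms_def by blast
  then have "\<forall>t. c * f t = (\<Sum>k\<le>d. (c * a k) * t $ 1 ^ (d - k) * t $ 2 ^ k)"
    by (simp add: sum_distrib_left mult.assoc)
  then show ?thesis unfolding binary_forms_def by (auto intro!: exI[of _ "\<lambda>k. c * a k"])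
qed

lemma binary_forms_monomial: "(\<lambda>t. t $ 1 ^ p * t $ 2 ^ q) \<in> binary_forms (p + q)"
proof -
  have "(\<Sum>k\<le>p + q. (if k = q then 1 else 0) * t $ 1 ^ (p + q - k) * t $ 2 ^ k)
      = t $ 1 ^ p * t $ 2 ^ q" for t :: "complex^2"
    by (subst sum.remove[of _ q]) auto
  then show ?thesis unfolding binary_forms_def
    by (auto intro!: exI[of _ "\<lambda>k. if k = q then 1 else 0"])
qed

lemma binary_forms_sum:
  assumes "finite S" "\<And>k. k \<in> S \<Longrightarrow> f k \<in> binary_forms d"
  shows "(\<lambda>t. \<Sum>k\<in>S. f k t) \<in> binary_forms d"
  using assms
proof (induction S rule: finite_induct)
  case empty
  have "(\<lambda>t. 0 * (t $ 1 ^ d * t $ 2 ^ 0)) \<in> binary_forms d"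
    using binary_forms_scale[OF binary_forms_monomial[of d 0], of 0] by simp
  then show ?case by simp
next
  case (insert x S)
  then show ?case using binary_forms_add[of "f x" d "\<lambda>t. \<Sum>k\<in>S. f k t"] by simp
qed

lemma binary_forms_mult:
  assumes "f \<in> binary_forms d" "g \<in> binary_forms e"
  shows "(\<lambda>t. f t * g t) \<in> binary_forms (d + e)"
proof -
  obtain a b where a: "\<forall>t. f t = (\<Sum>k\<le>d. a k * t $ 1 ^ (d - k) * t $ 2 ^ k)"
    and b: "\<forall>t. g t = (\<Sum>k\<le>e. b k * t $ 1 ^ (e - k) * t $ 2 ^ k)"
    using assms unfolding binary_forms_def by blast
  have "(\<lambda>t. \<Sum>k\<le>d. \<Sum>j\<le>e. (a k * b j) * (t $ 1 ^ ((d - k) + (e - j)) * t $ 2 ^ (k + j)))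
      \<in> binary_forms (d + e)"
    apply (intro binary_forms_sum binary_forms_scale)
      apply simp
     apply simp
    subgoal for k j
      using binary_forms_monomial[of "(d - k) + (e - j)" "k + j"] by simp
    done
  moreover have "(\<lambda>t. f t * g t)
    = (\<lambda>t. \<Sum>k\<le>d. \<Sum>j\<le>e. (a k * b j) * (t $ 1 ^ ((d - k) + (e - j)) * t $ 2 ^ (k + j)))"
  proof
    fix t :: "complex^2"
    show "f t * g t = (\<Sum>k\<le>d. \<Sum>j\<le>e. (a k * b j) * (t $ 1 ^ ((d - k) + (e - j)) * t $ 2 ^ (k + j)))"
      unfolding a[rule_format] b[rule_format] sum_product power_add by (simp only: mult_ac)
  qed
  ultimately show ?thesis by simp
qed

lemma binary_forms_power:
  assumes "f \<in> binary_forms d"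
  shows "(\<lambda>t. f t ^ n) \<in> binary_forms (n * d)"
proof (induction n)
  case 0
  show ?case using binary_forms_monomial[of 0 0] by simp
next
  case (Suc n)
  then show ?case using binary_forms_mult[OF assms Suc] by simp
qed

lemma binary_forms_linear: "(\<lambda>t. a * t $ 1 + b * t $ 2) \<in> binary_forms 1"
proof -
  have "(\<lambda>t. t $ 1) \<in> binary_forms 1" "(\<lambda>t. t $ 2) \<in> binary_forms 1"
    using binary_forms_monomial[of 1 0] binary_forms_monomial[of 0 1] by auto
  then show ?thesis
    by (intro binary_forms_add binary_forms_scale)
qed

lemma mult_vec_2:
  fixes g :: "complex^2^2"
  shows "(g *v t) $ 1 = g $ 1 $ 1 * t $ 1 + g $ 1 $ 2 * t $ 2"
    "(g *v t) $ 2 = g $ 2 $ 1 * t $ 1 + g $ 2 $ 2 * t $ 2"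
  by (simp_all add: matrix_vector_mult_def sum_2)

lemma binary_forms_subst:
  fixes g :: "complex^2^2"
  assumes "f \<in> binary_forms d"
  shows "(\<lambda>t. f (g *v t)) \<in> binary_forms d"
proof -
  obtain a where a: "\<forall>t. f t = (\<Sum>k\<le>d. a k * t $ 1 ^ (d - k) * t $ 2 ^ k)"
    using assms unfolding binary_forms_def by blast
  have "(\<lambda>t. \<Sum>k\<le>d. a k * ((g *v t) $ 1 ^ (d - k) * (g *v t) $ 2 ^ k)) \<in> binary_forms d"
  proof (intro binary_forms_sum binary_forms_scale)
    fix k assume "k \<in> {..d}"
    then have d: "(d - k) * 1 + k * 1 = d" by simp
    have "(\<lambda>t. (g *v t) $ 1 ^ (d - k) * (g *v t) $ 2 ^ k) \<in> binary_forms ((d - k) * 1 + k * 1)"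
      unfolding mult_vec_2
      by (intro binary_forms_mult binary_forms_power binary_forms_linear)
    then show "(\<lambda>t. (g *v t) $ 1 ^ (d - k) * (g *v t) $ 2 ^ k) \<in> binary_forms d"
      unfolding d .
  qed simp
  then show ?thesis using a by (simp add: mult.assoc)
qed

definition qd :: "complex \<Rightarrow> complex \<Rightarrow> complex \<Rightarrow> complex^2 \<Rightarrow> complex" where
  "qd a b c t = a * t $ 1 ^ 2 + b * t $ 1 * t $ 2 + c * t $ 2 ^ 2"

lemma binary_forms_2_iff: "f \<in> binary_forms 2 \<longleftrightarrow> (\<exists>a b c. f = qd a b c)"
proof
  assume "f \<in> binary_forms 2"
  then obtain k where k: "\<forall>t. f t = (\<Sum>i\<le>2. k i * t $ 1 ^ (2 - i) * t $ 2 ^ i)"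
    unfolding binary_forms_def by blast
  have "f = qd (k 0) (k 1) (k 2)"
    by (rule ext) (simp add: k qd_def numeral_2_eq_2)
  then show "\<exists>a b c. f = qd a b c" by blast
next
  assume "\<exists>a b c. f = qd a b c"
  then obtain a b c where f: "f = qd a b c" by blast
  have "\<forall>t. f t = (\<Sum>i\<le>2. ([a,b,c] ! i) * t $ 1 ^ (2 - i) * t $ 2 ^ i)"
    by (simp add: f qd_def numeral_2_eq_2)
  then show "f \<in> binary_forms 2" unfolding binary_forms_def
    by (auto intro!: exI[of _ "\<lambda>i. [a,b,c] ! i"])
qed

lemma qd_in_forms: "qd a b c \<in> binary_forms 2"
  using binary_forms_2_iff by blast

lemma exists_vec2: "\<exists>t::complex^2. t $ 1 = x \<and> t $ 2 = y"
  by (rule exI[of _ "vector [x, y]"]) simp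

lemma vec2_eq: "(s::complex^2) = t \<longleftrightarrow> s $ 1 = t $ 1 \<and> s $ 2 = t $ 2"
  by (simp add: vec_eq_iff forall_2)

lemma qd_root: "\<exists>t. t \<noteq> 0 \<and> qd a b c t = 0"
proof (cases "a = 0")
  case True
  obtain t :: "complex^2" where "t $ 1 = 1" "t $ 2 = 0" using exists_vec2 by blast
  then show ?thesis using True by (intro exI[of _ t]) (auto simp: qd_def)
next
  case False
  define r where "r = (- b + csqrt (b^2 - 4 * a * c)) / (2 * a)"
  have s: "csqrt (b^2 - 4 * a * c) ^ 2 = b^2 - 4 * a * c" by simp
  have e: "2 * a * r + b = csqrt (b^2 - 4 * a * c)" using False by (simp add: r_def)
  have "4 * a * (a * r^2 + b * r + c) = (2 * a * r + b)^2 - (b^2 - 4 * a * c)"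
    by (simp add: power2_eq_square algebra_simps)
  also have "\<dots> = 0" using e s by simp
  finally have "a * r^2 + b * r + c = 0" using False by simp
  moreover obtain t :: "complex^2" where "t $ 1 = r" "t $ 2 = 1" using exists_vec2 by blast
  ultimately show ?thesis by (intro exI[of _ t]) (auto simp: qd_def)
qed

section \<open>Partial derivatives and Jacobian determinants\<close>

definition has_partial :: "2 \<Rightarrow> (complex^2 \<Rightarrow> complex) \<Rightarrow> (complex^2 \<Rightarrow> complex) \<Rightarrow> bool" where
  "has_partial j f f' \<longleftrightarrow> (\<forall>t. ((\<lambda>x. f (t + axis j x)) has_field_derivative f' t) (at 0))"

text \<open>\<open>deriv\<close> is total and says nothing about differentiability, which the sum
  and product rules require; \<open>has_partial\<close> carries it along and is turned into
  \<open>partial\<close> only at the end.\<close>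

lemma has_partial_imp: "has_partial j f f' \<Longrightarrow> partial j f = f'"
  by (auto simp: has_partial_def partial_def intro!: ext DERIV_imp_deriv)

lemma has_partial_add: "has_partial j f f' \<Longrightarrow> has_partial j g g' \<Longrightarrow>
    has_partial j (\<lambda>t. f t + g t) (\<lambda>t. f' t + g' t)"
  by (auto simp: has_partial_def intro!: derivative_intros)

lemma has_partial_diff: "has_partial j f f' \<Longrightarrow> has_partial j g g' \<Longrightarrow>
    has_partial j (\<lambda>t. f t - g t) (\<lambda>t. f' t - g' t)"
  by (auto simp: has_partial_def intro!: derivative_intros)

lemma has_partial_scale: "has_partial j f f' \<Longrightarrow> has_partial j (\<lambda>t. c * f t) (\<lambda>t. c * f' t)"
  by (auto simp: has_partial_def intro!: DERIV_cmult)

lemma has_partial_mult: "has_partial j f f' \<Longrightarrow> has_partial j g g' \<Longrightarrow>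
    has_partial j (\<lambda>t. f t * g t) (\<lambda>t. f' t * g t + f t * g' t)"
  unfolding has_partial_def
proof
  fix t
  assume "\<forall>t. ((\<lambda>x. f (t + axis j x)) has_field_derivative f' t) (at 0)"
    "\<forall>t. ((\<lambda>x. g (t + axis j x)) has_field_derivative g' t) (at 0)"
  then have "((\<lambda>x. f (t + axis j x) * g (t + axis j x)) has_field_derivative
      f' t * g (t + axis j 0) + g' t * f (t + axis j 0)) (at 0)"
    by (intro DERIV_mult) auto
  moreover have "axis j 0 = (0 :: complex^2)" by (simp add: axis_def vec_eq_iff)
  ultimately show "((\<lambda>x. f (t + axis j x) * g (t + axis j x)) has_field_derivative
      f' t * g t + f t * g' t) (at 0)" by (simp add: mult.commute)
qed

lemma has_partial_qd:
  "has_partial 1 (qd a b c) (\<lambda>t. 2 * a * t $ 1 + b * t $ 2)"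
  "has_partial 2 (qd a b c) (\<lambda>t. b * t $ 1 + 2 * c * t $ 2)"
  by (auto simp: has_partial_def qd_def axis_def intro!: derivative_eq_intros)

lemma jacobian_form_partials:
  assumes "has_partial 1 f f1" "has_partial 2 f f2" "has_partial 1 g g1" "has_partial 2 g g2"
  shows "jacobian_form f g = (\<lambda>t. f1 t * g2 t - f2 t * g1 t)"
  using assms[THEN has_partial_imp] by (auto simp: jacobian_form_def det_2)

lemma jacobian_form_quartic:
  "jacobian_form (quartic a) (quartic b) t =
    (let p = \<lambda>c. 4 * (c $ 0 * t $ 1 ^ 3 + 3 * c $ 1 * t $ 1 ^ 2 * t $ 2 + 3 * c $ 2 * t $ 1 * t $ 2 ^ 2 + c $ 3 * t $ 2 ^ 3);
         q = \<lambda>c. 4 * (c $ 1 * t $ 1 ^ 3 + 3 * c $ 2 * t $ 1 ^ 2 * t $ 2 + 3 * c $ 3 * t $ 1 * t $ 2 ^ 2 + c $ 4 * t $ 2 ^ 3)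
     in p a * q b - q a * p b)"
proof -
  have 1: "has_partial 1 (quartic c) (\<lambda>t. 4 * (c $ 0 * t $ 1 ^ 3 + 3 * c $ 1 * t $ 1 ^ 2 * t $ 2 + 3 * c $ 2 * t $ 1 * t $ 2 ^ 2 + c $ 3 * t $ 2 ^ 3))" for c
    by (auto simp: has_partial_def quartic_def axis_def algebra_simps intro!: derivative_eq_intros)
  have 2: "has_partial 2 (quartic c) (\<lambda>t. 4 * (c $ 1 * t $ 1 ^ 3 + 3 * c $ 2 * t $ 1 ^ 2 * t $ 2 + 3 * c $ 3 * t $ 1 * t $ 2 ^ 2 + c $ 4 * t $ 2 ^ 3))" for c
    by (auto simp: has_partial_def quartic_def axis_def algebra_simps intro!: derivative_eq_intros)
  show ?thesis
    unfolding jacobian_form_partials[OF 1 2 1 2] Let_def ..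
qed

definition has_partials :: "(complex^2 \<Rightarrow> complex) \<Rightarrow> bool" where
  "has_partials f \<longleftrightarrow> (\<exists>f1 f2. has_partial 1 f f1 \<and> has_partial 2 f f2)"

lemma has_partials_qd: "has_partials (qd a b c)"
  unfolding has_partials_def using has_partial_qd by blast

lemma has_partials_mult: "has_partials f \<Longrightarrow> has_partials g \<Longrightarrow> has_partials (\<lambda>t. f t * g t)"
  unfolding has_partials_def using has_partial_mult by blast

lemma has_partials_lincomb:
  "has_partials f \<Longrightarrow> has_partials g \<Longrightarrow> has_partials (\<lambda>t. x * f t + y * g t)"
  unfolding has_partials_def
  by (elim exE conjE, intro exI conjI; rule has_partial_add[OF has_partial_scale has_partial_scale]; assumption)

text \<open>A quartic is a quadratic times \<open>t\<^sub>0\<^sup>2\<close> plus a quadratic times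
  \<open>t\<^sub>1\<^sup>2\<close>, so the product rule for quadratics suffices.\<close>

lemma has_partials_quartic: "has_partials (quartic a)"
proof -
  have "(\<lambda>t. qd (a $ 0) (4 * a $ 1) (6 * a $ 2) t * qd 1 0 0 t
      + 1 * (qd 0 (4 * a $ 3) (a $ 4) t * qd 0 0 1 t)) = quartic a"
    by (rule ext) (simp add: qd_def quartic_def power2_eq_square power3_eq_cube power4_eq_xxxx algebra_simps)
  then show ?thesis
    using has_partials_lincomb[of "\<lambda>t. qd (a $ 0) (4 * a $ 1) (6 * a $ 2) t * qd 1 0 0 t"
        "\<lambda>t. qd 0 (4 * a $ 3) (a $ 4) t * qd 0 0 1 t" 1 1]
    by (simp add: has_partials_mult has_partials_qd)
qed

lemma jacobian_form_lincomb:
  assumes "has_partials f" "has_partials g"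
  shows "jacobian_form (\<lambda>t. x * f t + y * g t) (\<lambda>t. z * f t + w * g t)
       = (\<lambda>t. (x * w - y * z) * jacobian_form f g t)"
proof -
  obtain f1 f2 g1 g2 where h: "has_partial 1 f f1" "has_partial 2 f f2"
    "has_partial 1 g g1" "has_partial 2 g g2"
    using assms unfolding has_partials_def by blast
  have k: "has_partial 1 (\<lambda>t. x * f t + y * g t) (\<lambda>t. x * f1 t + y * g1 t)"
    "has_partial 2 (\<lambda>t. x * f t + y * g t) (\<lambda>t. x * f2 t + y * g2 t)" for x y
    using h by (auto intro!: has_partial_add has_partial_scale)
  show ?thesis
    unfolding jacobian_form_partials[OF h] jacobian_form_partials[OF k k]
    by (rule ext) (simp add: algebra_simps)
qed

lemma form_point_scale: "c \<noteq> 0 \<Longrightarrow> form_point (\<lambda>t. c * f t) = form_point f"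
proof -
  assume c: "c \<noteq> 0"
  have "\<exists>d'. (\<lambda>t. d * f t) = (\<lambda>t. d' * (c * f t))" for d
    using c by (intro exI[of _ "d / c"]) auto
  moreover have "\<exists>d'. (\<lambda>t. d * (c * f t)) = (\<lambda>t. d' * f t)" for d
    by (intro exI[of _ "d * c"]) (auto simp: mult.assoc)
  ultimately show ?thesis unfolding form_point_def by blast
qed

lemma form_pencil_mem: "f \<in> form_pencil f g" "g \<in> form_pencil f g"
proof -
  have "f = (\<lambda>t. 1 * f t + 0 * g t)" "g = (\<lambda>t. 0 * f t + 1 * g t)" by auto
  then show "f \<in> form_pencil f g" "g \<in> form_pencil f g"
    unfolding form_pencil_def by blast+
qed

text \<open>The two generating pairs are combinations of each other. The pencil may have dimension
  below 2: if a transition determinant vanishes, both Jacobians are zero and the constant 1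
  serves.\<close>

lemma jacobian_form_pencil:
  assumes "form_pencil f g = form_pencil F G" "has_partials F" "has_partials G"
  shows "\<exists>c. c \<noteq> 0 \<and> jacobian_form f g = (\<lambda>t. c * jacobian_form F G t)"
proof -
  have "f \<in> form_pencil f g" "g \<in> form_pencil f g" "F \<in> form_pencil F G" "G \<in> form_pencil F G"
    by (fact form_pencil_mem)+
  then have "f \<in> form_pencil F G" "g \<in> form_pencil F G" "F \<in> form_pencil f g" "G \<in> form_pencil f g"
    using assms(1) by auto
  then obtain x y z w x' y' z' w' where
    f: "f = (\<lambda>t. x * F t + y * G t)" and g: "g = (\<lambda>t. z * F t + w * G t)" and
    F: "F = (\<lambda>t. x' * f t + y' * g t)" and G: "G = (\<lambda>t. z' * f t + w' * g t)"
    unfolding form_pencil_def by blast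
  have p: "has_partials f" "has_partials g"
    using assms(2,3) unfolding f g by (auto intro: has_partials_lincomb)
  have 1: "jacobian_form f g = (\<lambda>t. (x * w - y * z) * jacobian_form F G t)"
    unfolding f g by (rule jacobian_form_lincomb[OF assms(2,3)])
  have 2: "jacobian_form F G = (\<lambda>t. (x' * w' - y' * z') * jacobian_form f g t)"
    by (subst F, subst G) (rule jacobian_form_lincomb[OF p])
  show ?thesis
  proof (cases "x * w - y * z = 0")
    case True
    then have "jacobian_form f g = (\<lambda>t. 0)" using 1 by simp
    moreover then have "jacobian_form F G = (\<lambda>t. 0)" using 2 by simp
    ultimately show ?thesis by (intro exI[of _ 1]) simp
  next
    case False
    then show ?thesis using 1 by blast
  qed
qed


section \<open>The action of the projective linear group\<close>

lemma form_point_subst: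
  "(\<lambda>f t. f (A *v t)) ` form_point f = form_point (\<lambda>t. f (A *v t))"
  unfolding form_point_def by auto

lemma rho_form_point:
  "rho (form_point f) = {form_point (\<lambda>t. f (A *v t)) | A. invertible A}"
  unfolding rho_def PGL2_rel_def using form_point_subst by auto

lemma rho_subst:
  fixes A :: "complex^2^2"
  assumes "invertible A"
  shows "rho (form_point (\<lambda>t. f (A *v t))) = rho (form_point f)"
proof
  have "form_point (\<lambda>t. f (A *v (B *v t))) \<in> rho (form_point f)" if "invertible B" for B
    unfolding rho_form_point matrix_vector_mul_assoc using invertible_mult[OF assms that] by blast
  then show "rho (form_point (\<lambda>t. f (A *v t))) \<subseteq> rho (form_point f)"
    unfolding rho_form_point[of "\<lambda>t. f (A *v t)"] by blast
  obtain A' where A': "A ** A' = mat 1" "A' ** A = mat 1"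
    using assms unfolding invertible_def by blast
  have "form_point (\<lambda>t. f (B *v t)) \<in> rho (form_point (\<lambda>t. f (A *v t)))" if "invertible B" for B
  proof -
    have "A *v ((A' ** B) *v t) = B *v t" for t
      using A' by (simp add: matrix_vector_mul_assoc matrix_mul_assoc)
    then have "form_point (\<lambda>t. f (B *v t)) = form_point (\<lambda>t. f (A *v ((A' ** B) *v t)))"
      by simp
    moreover have "invertible (A' ** B)"
      using that A' invertible_mult[of A' B] unfolding invertible_def by blast
    ultimately show ?thesis unfolding rho_form_point by blast
  qed
  then show "rho (form_point f) \<subseteq> rho (form_point (\<lambda>t. f (A *v t)))"
    unfolding rho_form_point[of f] by blast
qed

text \<open>The linear form vanishing at \<open>p\<close> is a 2 by 2 determinant, hence covariant
  under substitutions; this is what carries root multiplicities along.\<close>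

lemma bracket_subst:
  fixes g :: "complex^2^2"
  shows "(g *v p) $ 2 * (g *v t) $ 1 - (g *v p) $ 1 * (g *v t) $ 2
       = det g * (p $ 2 * t $ 1 - p $ 1 * t $ 2)"
  by (simp add: mult_vec_2 det_2 algebra_simps)

lemma root_mult_ge_subst:
  fixes g :: "complex^2^2"
  assumes g: "invertible g" and f: "root_mult_ge d f m p" and h: "g *v q = p"
  shows "root_mult_ge d (\<lambda>t. f (g *v t)) m q"
proof -
  obtain k where k: "k \<in> binary_forms (d - m)"
    "\<And>t. f t = (p $ 2 * t $ 1 - p $ 1 * t $ 2) ^ m * k t"
    using f unfolding root_mult_ge_def by blast
  have "f (g *v t) = (q $ 2 * t $ 1 - q $ 1 * t $ 2) ^ m * (det g ^ m * k (g *v t))" for t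
    using bracket_subst[of g q t] by (simp add: k(2) h power_mult_distrib)
  then show ?thesis unfolding root_mult_ge_def
    by (intro bexI[OF _ binary_forms_scale[OF binary_forms_subst[OF k(1)], of "det g ^ m" g]] allI)
qed

lemma stable_sextic_subst:
  fixes g :: "complex^2^2"
  assumes "invertible g" "stable_sextic f"
  shows "stable_sextic (\<lambda>t. f (g *v t))"
proof -
  obtain g' where g': "g ** g' = mat 1" "g' ** g = mat 1"
    using assms unfolding invertible_def by blast
  have i: "invertible g'" using g' unfolding invertible_def by blast
  have f: "(\<lambda>t. (\<lambda>s. f (g *v s)) (g' *v t)) = f"
    by (simp add: matrix_vector_mul_assoc g')
  have "f \<noteq> (\<lambda>t. 0)" using assms by (simp add: stable_sextic_def)
  then have "(\<lambda>t. f (g *v t)) \<noteq> (\<lambda>t. 0)" by (subst (asm) f[symmetric]) (auto dest: fun_cong)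
  moreover have False if "p \<noteq> 0" "root_mult_ge 6 (\<lambda>t. f (g *v t)) 3 p" for p
  proof -
    have q: "g' *v (g *v p) = p" by (simp add: matrix_vector_mul_assoc g')
    have "root_mult_ge 6 f 3 (g *v p)"
      using root_mult_ge_subst[OF i that(2) q] f by simp
    moreover have "g *v p \<noteq> 0" using q that(1) by auto
    ultimately show False using assms(2) by (auto simp: stable_sextic_def)
  qed
  ultimately show ?thesis
    using assms(2) binary_forms_subst[of f 6 g] by (auto simp: stable_sextic_def)
qed

lemma stable_sextic_scale:
  assumes "c \<noteq> 0" "stable_sextic f"
  shows "stable_sextic (\<lambda>t. c * f t)"
proof -
  have "(\<lambda>t. c * f t) \<noteq> (\<lambda>t. 0)"
    using assms by (auto simp: stable_sextic_def fun_eq_iff)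
  moreover have "root_mult_ge 6 f 3 p" if r: "root_mult_ge 6 (\<lambda>t. c * f t) 3 p" for p
  proof -
    obtain k where k: "k \<in> binary_forms (6 - 3)"
      "\<And>t. c * f t = (p $ 2 * t $ 1 - p $ 1 * t $ 2) ^ 3 * k t"
      using r unfolding root_mult_ge_def by blast
    have "f t = (p $ 2 * t $ 1 - p $ 1 * t $ 2) ^ 3 * (1 / c * k t)" for t
      using k(2)[of t] assms(1) by (simp add: field_simps)
    then show ?thesis unfolding root_mult_ge_def
      by (intro bexI[OF _ binary_forms_scale[OF k(1), of "1 / c"]] allI)
  qed
  ultimately show ?thesis
    using assms(2) binary_forms_scale[of f 6 c] by (auto simp: stable_sextic_def)
qed

section \<open>Sextics by coefficients, and a normal form for stable ones\<close>

definition sextic :: "(nat \<Rightarrow> complex) \<Rightarrow> complex^2 \<Rightarrow> complex" where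
  "sextic c t = (\<Sum>k\<le>6. c k * t $ 1 ^ (6 - k) * t $ 2 ^ k)"

lemma sextic_expand: "sextic c t = c 0 * t $ 1 ^ 6 + c 1 * t $ 1 ^ 5 * t $ 2
   + c 2 * t $ 1 ^ 4 * t $ 2 ^ 2 + c 3 * t $ 1 ^ 3 * t $ 2 ^ 3 + c 4 * t $ 1 ^ 2 * t $ 2 ^ 4
   + c 5 * t $ 1 * t $ 2 ^ 5 + c 6 * t $ 2 ^ 6"
  by (simp add: sextic_def eval_nat_numeral)

lemma binary_forms_6_iff: "f \<in> binary_forms 6 \<longleftrightarrow> (\<exists>c. f = sextic c)"
  unfolding binary_forms_def sextic_def fun_eq_iff by simp

lemma binary_forms_3_expand:
  assumes "f \<in> binary_forms 3"
  shows "\<exists>h0 h1 h2 h3. \<forall>t. f t = h0 * t $ 1 ^ 3 + h1 * t $ 1 ^ 2 * t $ 2 + h2 * t $ 1 * t $ 2 ^ 2 + h3 * t $ 2 ^ 3"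
proof -
  obtain a where "\<forall>t. f t = (\<Sum>k\<le>3. a k * t $ 1 ^ (3 - k) * t $ 2 ^ k)"
    using assms unfolding binary_forms_def by blast
  then have "\<forall>t. f t = a 0 * t $ 1 ^ 3 + a 1 * t $ 1 ^ 2 * t $ 2 + a 2 * t $ 1 * t $ 2 ^ 2 + a 3 * t $ 2 ^ 3"
    by (simp add: eval_nat_numeral)
  then show ?thesis by blast
qed

lemma triple_root_1:
  assumes "root_mult_ge 6 (sextic c) 3 (vector [1, 0])"
  shows "c 0 = 0 \<and> c 1 = 0 \<and> c 2 = 0"
proof -
  obtain k where k: "k \<in> binary_forms 3" "\<And>t. sextic c t = (- t $ 2) ^ 3 * k t"
    using assms unfolding root_mult_ge_def by auto
  obtain h0 h1 h2 h3 where h: "\<And>t. k t = h0 * t $ 1 ^ 3 + h1 * t $ 1 ^ 2 * t $ 2 + h2 * t $ 1 * t $ 2 ^ 2 + h3 * t $ 2 ^ 3"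
    using binary_forms_3_expand[OF k(1)] by blast
  \<comment> \<open>On the chart (1, x) the cubed linear form becomes \<open>(- x) ^ 3\<close>,
    which accounts for the three zeros and the signs.\<close>
  have "poly [:c 0, c 1, c 2, c 3, c 4, c 5, c 6:] x = poly [:0, 0, 0, - h0, - h1, - h2, - h3:] x" for x
    using k(2)[of "vector [1, x]"] unfolding h sextic_expand
    by (simp add: algebra_simps power2_eq_square power3_eq_cube eval_nat_numeral)
  then have "[:c 0, c 1, c 2, c 3, c 4, c 5, c 6:] = [:0, 0, 0, - h0, - h1, - h2, - h3:]"
    by (intro poly_ext)
  then show ?thesis by simp
qed

lemma binary_cubic_in_forms: "(\<lambda>t. h0 * t $ 1 ^ 3 + h1 * t $ 1 ^ 2 * t $ 2 + h2 * t $ 1 * t $ 2 ^ 2 + h3 * t $ 2 ^ 3) \<in> binary_forms 3"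
proof -
  have "\<forall>t. h0 * t $ 1 ^ 3 + h1 * t $ 1 ^ 2 * t $ 2 + h2 * t $ 1 * t $ 2 ^ 2 + h3 * t $ 2 ^ 3
     = (\<Sum>k\<le>3. ([h0,h1,h2,h3] ! k) * t $ 1 ^ (3 - k) * t $ 2 ^ k)"
    by (simp add: eval_nat_numeral)
  then show ?thesis unfolding binary_forms_def by (auto intro!: exI[of _ "\<lambda>k. [h0,h1,h2,h3] ! k"])
qed

lemma triple_root_1I:
  assumes "c 0 = 0" "c 1 = 0" "c 2 = 0"
  shows "root_mult_ge 6 (sextic c) 3 (vector [1, 0])"
proof -
  have "sextic c t = ((vector [1, 0] :: complex^2) $ 2 * t $ 1 - (vector [1, 0] :: complex^2) $ 1 * t $ 2) ^ 3
    * (- c 3 * t $ 1 ^ 3 + - c 4 * t $ 1 ^ 2 * t $ 2 + - c 5 * t $ 1 * t $ 2 ^ 2 + - c 6 * t $ 2 ^ 3)" for t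
    using assms by (simp add: sextic_expand algebra_simps power2_eq_square power3_eq_cube eval_nat_numeral)
  then show ?thesis unfolding root_mult_ge_def
    using binary_cubic_in_forms[of "- c 3" "- c 4" "- c 5" "- c 6"]
    by (intro bexI[of _ "\<lambda>t. - c 3 * t $ 1 ^ 3 + - c 4 * t $ 1 ^ 2 * t $ 2 + - c 5 * t $ 1 * t $ 2 ^ 2 + - c 6 * t $ 2 ^ 3"]) auto
qed

lemma triple_root_2I:
  assumes "c 4 = 0" "c 5 = 0" "c 6 = 0"
  shows "root_mult_ge 6 (sextic c) 3 (vector [0, 1])"
proof -
  have "sextic c t = ((vector [0, 1] :: complex^2) $ 2 * t $ 1 - (vector [0, 1] :: complex^2) $ 1 * t $ 2) ^ 3
    * (c 0 * t $ 1 ^ 3 + c 1 * t $ 1 ^ 2 * t $ 2 + c 2 * t $ 1 * t $ 2 ^ 2 + c 3 * t $ 2 ^ 3)" for t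
    using assms by (simp add: sextic_expand algebra_simps power2_eq_square power3_eq_cube eval_nat_numeral)
  then show ?thesis unfolding root_mult_ge_def
    using binary_cubic_in_forms[of "c 0" "c 1" "c 2" "c 3"]
    by (intro bexI[of _ "\<lambda>t. c 0 * t $ 1 ^ 3 + c 1 * t $ 1 ^ 2 * t $ 2 + c 2 * t $ 1 * t $ 2 ^ 2 + c 3 * t $ 2 ^ 3"]) auto
qed

lemma frame_matrix:
  fixes p q :: "complex^2"
  assumes "p $ 1 * q $ 2 - p $ 2 * q $ 1 \<noteq> 0"
  shows "\<exists>g :: complex^2^2. invertible g \<and> g *v vector [1, 0] = p \<and> g *v vector [0, 1] = q"
proof -
  define g :: "complex^2^2" where "g = vector [vector [p $ 1, q $ 1], vector [p $ 2, q $ 2]]"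
  have "det g = p $ 1 * q $ 2 - p $ 2 * q $ 1" by (simp add: g_def det_2 mult.commute)
  then have "invertible g" using assms by (simp add: invertible_det_nz)
  then show ?thesis
    by (intro exI[of _ g]) (auto simp: vec2_eq mult_vec_2 g_def)
qed

lemma frame_matrix1:
  fixes p :: "complex^2"
  assumes "p \<noteq> 0"
  shows "\<exists>g :: complex^2^2. invertible g \<and> g *v vector [1, 0] = p"
proof (cases "p $ 1 = 0")
  case True
  then have "p $ 2 \<noteq> 0" using assms by (simp add: vec2_eq)
  then show ?thesis using frame_matrix[of p "vector [1, 0]"] by auto
next
  case False
  then show ?thesis using frame_matrix[of p "vector [0, 1]"] by auto
qed

text \<open>Yields a root different from (1, 0): on the chart (r, 1) the form has degree 5 or 4 and
  is not constant.\<close>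

lemma sextic_root: "c 0 = 0 \<Longrightarrow> (c 1, c 2) \<noteq> (0, 0) \<Longrightarrow> \<exists>r. sextic c (vector [r, 1]) = 0"
proof -
  assume h: "c 0 = 0" "(c 1, c 2) \<noteq> (0, 0)"
  have "degree [:c 6, c 5, c 4, c 3, c 2, c 1:] > 0"
    using h by auto
  then obtain r where "poly [:c 6, c 5, c 4, c 3, c 2, c 1:] r = 0"
    using alg_closed_imp_poly_has_root by blast
  then have "sextic c (vector [r, 1]) = 0"
    by (simp add: sextic_expand h algebra_simps eval_nat_numeral)
  then show ?thesis by blast
qed

lemma sextic_exists_root: "\<exists>p. p \<noteq> 0 \<and> sextic c p = 0"
proof (cases "c 0 = 0")
  case True
  then show ?thesis by (intro exI[of _ "vector [1, 0]"]) (auto simp: sextic_expand vec2_eq)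
next
  case False
  have "degree [:c 6, c 5, c 4, c 3, c 2, c 1, c 0:] > 0"
    using False by auto
  then obtain r where "poly [:c 6, c 5, c 4, c 3, c 2, c 1, c 0:] r = 0"
    using alg_closed_imp_poly_has_root by blast
  then have "sextic c (vector [r, 1]) = 0"
    by (simp add: sextic_expand algebra_simps eval_nat_numeral)
  then show ?thesis by (intro exI[of _ "vector [r, 1]"]) (auto simp: vec2_eq)
qed

lemma sextic_subst: "\<exists>c'. (\<lambda>t. sextic c (g *v t)) = sextic c'"
  using binary_forms_subst[of "sextic c" 6 g] binary_forms_6_iff by blast

lemma sextic_at: "sextic c (vector [1, 0]) = c 0" "sextic c (vector [0, 1]) = c 6"
  by (simp_all add: sextic_expand)

text \<open>Once a root sits at (1, 0), stability keeps its multiplicity below 3, so there is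
  another root, which a substitution fixing (1, 0) moves to (0, 1). The two inequalities record that
  neither root is triple.\<close>

lemma stable_normal_form:
  assumes "stable_sextic f"
  shows "\<exists>g c. invertible g \<and> (\<lambda>t. f (g *v t)) = sextic c \<and> c 0 = 0 \<and> c 6 = 0 \<and>
     (c 1, c 2) \<noteq> (0, 0) \<and> (c 5, c 4) \<noteq> (0, 0)"
proof -
  obtain c where c: "f = sextic c" using assms binary_forms_6_iff by (auto simp: stable_sextic_def)
  obtain p where p: "p \<noteq> 0" "f p = 0" using sextic_exists_root c by blast
  obtain g1 :: "complex^2^2" where g1: "invertible g1" "g1 *v vector [1, 0] = p"
    using frame_matrix1[OF p(1)] by blast
  obtain c1 where c1: "(\<lambda>t. f (g1 *v t)) = sextic c1" using sextic_subst c by blast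
  have s1: "stable_sextic (sextic c1)" using stable_sextic_subst[OF g1(1) assms] c1 by simp
  have z: "c1 0 = 0" using fun_cong[OF c1, of "vector [1, 0]"] g1 p by (simp add: sextic_at)
  have nz: "(vector [1, 0] :: complex^2) \<noteq> 0" "(vector [0, 1] :: complex^2) \<noteq> 0"
    by (auto simp: vec2_eq)
  have "(c1 1, c1 2) \<noteq> (0, 0)"
    using triple_root_1I[of c1] z s1 nz unfolding stable_sextic_def by auto
  then obtain r where r: "sextic c1 (vector [r, 1]) = 0" using sextic_root[of c1] z by blast
  obtain g2 :: "complex^2^2" where g2: "invertible g2" "g2 *v vector [1, 0] = vector [1, 0]" "g2 *v vector [0, 1] = vector [r, 1]"
    using frame_matrix[of "vector [1, 0]" "vector [r, 1]"] by auto
  obtain c2 where c2: "(\<lambda>t. sextic c1 (g2 *v t)) = sextic c2" using sextic_subst by blast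
  have s2: "stable_sextic (sextic c2)" using stable_sextic_subst[OF g2(1) s1] c2 by simp
  have z2: "c2 0 = 0" "c2 6 = 0"
    using fun_cong[OF c2, of "vector [1, 0]"] fun_cong[OF c2, of "vector [0, 1]"] g2 r z
    by (simp_all add: sextic_at)
  have "(c2 1, c2 2) \<noteq> (0, 0)" "(c2 5, c2 4) \<noteq> (0, 0)"
    using triple_root_1I[of c2] triple_root_2I[of c2] z2 s2 nz unfolding stable_sextic_def by auto
  moreover have "(\<lambda>t. f ((g1 ** g2) *v t)) = sextic c2"
    using c2 fun_cong[OF c1] by (auto simp: matrix_vector_mul_assoc[symmetric])
  ultimately show ?thesis using invertible_mult[OF g1(1) g2(1)] z2 by blast
qed


section \<open>Parametrizations of the conic \<open>\<Sum> \<alpha>\<^sub>i z\<^sub>i\<^sup>2 = 0\<close> in the plane \<open>\<Sum> \<alpha>\<^sub>i z\<^sub>i = 0\<close>\<close>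

lemma vector_4:
  "(vector [a, b, c, d] :: 'a::zero^4) $ 1 = a" "(vector [a, b, c, d] :: 'a^4) $ 2 = b"
  "(vector [a, b, c, d] :: 'a^4) $ 3 = c" "(vector [a, b, c, d] :: 'a^4) $ 4 = d"
  by (simp_all add: vector_def)

definition wdot :: "complex^4 \<Rightarrow> complex^4 \<Rightarrow> complex^4 \<Rightarrow> complex" where
  "wdot \<alpha> u v = (\<Sum>i\<in>UNIV. \<alpha> $ i * u $ i * v $ i)"

lemma wdot_4: "wdot \<alpha> u v = \<alpha> $ 1 * u $ 1 * v $ 1 + \<alpha> $ 2 * u $ 2 * v $ 2 + \<alpha> $ 3 * u $ 3 * v $ 3 + \<alpha> $ 4 * u $ 4 * v $ 4"
  by (simp add: wdot_def sum_4)

lemma wdot_sym: "wdot \<alpha> u v = wdot \<alpha> v u"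
  by (simp add: wdot_4 algebra_simps)

lemma plane_wdot: "z \<in> plane \<alpha> \<longleftrightarrow> wdot \<alpha> 1 z = 0"
  by (simp add: plane_def wdot_def)

definition asum :: "complex^4 \<Rightarrow> complex" where
  "asum \<alpha> = \<alpha> $ 1 + \<alpha> $ 2 + \<alpha> $ 3 + \<alpha> $ 4"

definition nondeg :: "complex^4 \<Rightarrow> bool" where
  "nondeg \<alpha> \<longleftrightarrow> (\<forall>i. \<alpha> $ i \<noteq> 0) \<and> asum \<alpha> \<noteq> 0"

text \<open>
  The coefficients \<open>A\<close>, \<open>B\<close>, \<open>C\<close> of a parametrization \<open>t\<^sub>0\<^sup>2 A + t\<^sub>0 t\<^sub>1 B + t\<^sub>1\<^sup>2 C\<close>,
  described through the dual quadratic form; \<open>frame_gram\<close> is the equivalent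
  description through the form itself.
\<close>

definition frame :: "complex^4 \<Rightarrow> complex \<Rightarrow> complex^4 \<Rightarrow> complex^4 \<Rightarrow> complex^4 \<Rightarrow> bool" where
  "frame \<alpha> \<nu> A B C \<longleftrightarrow> \<nu> \<noteq> 0 \<and> (\<forall>i j. A $ i * C $ j + C $ i * A $ j - B $ i * B $ j / 2
      = \<nu> * ((if i = j then 1 / \<alpha> $ i else 0) - 1 / asum \<alpha>))"

definition gram :: "complex^4 \<Rightarrow> complex \<Rightarrow> complex^4 \<Rightarrow> complex^4 \<Rightarrow> complex^4 \<Rightarrow> bool" where
  "gram \<alpha> \<nu> A B C \<longleftrightarrow> \<nu> \<noteq> 0 \<and> wdot \<alpha> 1 A = 0 \<and> wdot \<alpha> 1 B = 0 \<and> wdot \<alpha> 1 C = 0 \<and>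
     wdot \<alpha> A A = 0 \<and> wdot \<alpha> A B = 0 \<and> wdot \<alpha> B C = 0 \<and> wdot \<alpha> C C = 0 \<and>
     wdot \<alpha> A C = \<nu> \<and> wdot \<alpha> B B = - 2 * \<nu>"

text \<open>Both descriptions say that \<open>M\<close>, with rows 1, \<open>A\<close>,
  \<open>B\<close>, \<open>C\<close>, and \<open>P\<close> are inverse to each other:
  \<open>frame\<close> is \<open>P ** M = mat 1\<close> and \<open>gram\<close> is
  \<open>M ** P = mat 1\<close>.\<close>

lemma frame_gram:
  assumes "nondeg \<alpha>"
  shows "frame \<alpha> \<nu> A B C \<longleftrightarrow> gram \<alpha> \<nu> A B C"
proof (cases "\<nu> = 0")
  case False
  define M :: "complex^4^4" where "M = vector [1, A, B, C]"
  \<comment> \<open>The columns are \<open>\<alpha>\<close> times the vectors that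
    \<open>gram\<close> makes dual to 1, \<open>A\<close>, \<open>B\<close>, \<open>C\<close> with
    respect to \<open>wdot\<close>.\<close>
  define P :: "complex^4^4" where
    "P = (\<chi> i. vector [\<alpha> $ i / asum \<alpha>, \<alpha> $ i * C $ i / \<nu>, - (\<alpha> $ i * B $ i / (2 * \<nu>)), \<alpha> $ i * A $ i / \<nu>])"
  have nz: "\<alpha> $ i \<noteq> 0" "asum \<alpha> \<noteq> 0" for i using assms by (auto simp: nondeg_def)
  have PM: "(P ** M) $ i $ j = \<alpha> $ i / \<nu> * (\<nu> / asum \<alpha> + (A $ i * C $ j + C $ i * A $ j - B $ i * B $ j / 2))" for i j
    using False by (simp add: P_def M_def matrix_matrix_mult_def sum_4 vector_4 field_simps)
  have eq1: "(P ** M) $ i $ j = (mat 1 :: complex^4^4) $ i $ j \<longleftrightarrow> A $ i * C $ j + C $ i * A $ j - B $ i * B $ j / 2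
      = \<nu> * ((if i = j then 1 / \<alpha> $ i else 0) - 1 / asum \<alpha>)" for i j
  proof -
    have "(P ** M) $ i $ j = (mat 1 :: complex^4^4) $ i $ j \<longleftrightarrow>
       (\<nu> / asum \<alpha> + (A $ i * C $ j + C $ i * A $ j - B $ i * B $ j / 2)) = \<nu> / \<alpha> $ i * (mat 1 :: complex^4^4) $ i $ j"
      unfolding PM using False nz(1)[of i] by (auto simp: field_simps)
    also have "\<dots> \<longleftrightarrow> A $ i * C $ j + C $ i * A $ j - B $ i * B $ j / 2
      = \<nu> * ((if i = j then 1 / \<alpha> $ i else 0) - 1 / asum \<alpha>)"
      by (auto simp: mat_def algebra_simps add_eq_0_iff2)
    finally show ?thesis .
  qed
  have 1: "frame \<alpha> \<nu> A B C \<longleftrightarrow> P ** M = mat 1"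
    unfolding frame_def vec_eq_iff[of "P ** M"] vec_eq_iff[of "(P ** M) $ _"] eq1 using False by simp
  have MP: "(M ** P) $ i $ j = wdot \<alpha> (M $ i) (vector [1 / asum \<alpha> *s 1, 1 / \<nu> *s C, (- 1 / (2 * \<nu>)) *s B, 1 / \<nu> *s A] $ j)" for i j
  proof -
    have "\<forall>j. (M ** P) $ i $ j = wdot \<alpha> (M $ i) (vector [1 / asum \<alpha> *s 1, 1 / \<nu> *s C, (- 1 / (2 * \<nu>)) *s B, 1 / \<nu> *s A] $ j)"
      unfolding forall_4 by (simp add: P_def matrix_matrix_mult_def sum_4 vector_4 wdot_4 mult_ac)
    then show ?thesis by blast
  qed
  have scale: "wdot \<alpha> u (c *s v) = c * wdot \<alpha> u v" "wdot \<alpha> u (- v) = - wdot \<alpha> u v" for u v c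
    by (simp_all add: wdot_4 algebra_simps)
  have t: "wdot \<alpha> 1 1 = asum \<alpha>" by (simp add: wdot_4 asum_def)
  have 2: "gram \<alpha> \<nu> A B C \<longleftrightarrow> M ** P = mat 1"
    unfolding vec_eq_iff[of "M ** P"] vec_eq_iff[of "(M ** P) $ _"] MP
    unfolding forall_4
    apply (simp add: M_def vector_4 scale mat_def t nz False gram_def)
    using False nz(2)
    apply (auto simp: wdot_sym[of \<alpha> _ 1] wdot_sym[of \<alpha> C A] wdot_sym[of \<alpha> C B] wdot_sym[of \<alpha> B A] field_simps)
    apply (metis minus_minus)
    done
  show ?thesis unfolding 1 2 by (rule matrix_left_right_inverse)
qed (simp add: frame_def gram_def)

definition quadmap :: "complex^4 \<Rightarrow> complex^4 \<Rightarrow> complex^4 \<Rightarrow> complex^2 \<Rightarrow> complex^4" where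
  "quadmap A B C t = (\<chi> i. qd (A $ i) (B $ i) (C $ i) t)"

lemma quadmap_nth [simp]: "quadmap A B C t $ i = qd (A $ i) (B $ i) (C $ i) t"
  by (simp add: quadmap_def)

text \<open>Contract the frame identity with \<open>\<alpha> $ i * z $ i\<close>; its constant term
  drops out because \<open>z\<close> lies in the plane.\<close>

lemma frame_expand:
  assumes "nondeg \<alpha>" "frame \<alpha> \<nu> A B C" "wdot \<alpha> 1 z = 0"
  shows "z $ j = wdot \<alpha> z C / \<nu> * A $ j - wdot \<alpha> z B / (2 * \<nu>) * B $ j + wdot \<alpha> z A / \<nu> * C $ j"
proof -
  have nu: "\<nu> \<noteq> 0" using assms(2) by (simp add: frame_def)
  have nz: "\<alpha> $ i \<noteq> 0" for i using assms(1) by (auto simp: nondeg_def)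
  have f: "\<nu> * (if i = j then 1 / \<alpha> $ i else 0) = A $ i * C $ j + C $ i * A $ j - B $ i * B $ j / 2 + \<nu> / asum \<alpha>" for i
    using assms(2) by (simp add: frame_def algebra_simps)
  have "\<nu> * z $ j = (\<Sum>i\<in>UNIV. \<alpha> $ i * z $ i * (\<nu> * (if i = j then 1 / \<alpha> $ i else 0)))"
    using nz[of j] by (subst sum.remove[of _ j]) (auto)
  also have "\<dots> = (\<Sum>i\<in>UNIV. \<alpha> $ i * z $ i * (A $ i * C $ j + C $ i * A $ j - B $ i * B $ j / 2 + \<nu> / asum \<alpha>))"
    by (simp only: f)
  also have "\<dots> = wdot \<alpha> z C * A $ j - wdot \<alpha> z B / 2 * B $ j + wdot \<alpha> z A * C $ j + \<nu> / asum \<alpha> * wdot \<alpha> 1 z"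
    by (simp add: wdot_4 sum_4 algebra_simps)
  finally show ?thesis using assms(3) nu by (simp add: field_simps)
qed

text \<open>The left side of the frame identity is the polarized discriminant of quadratics, so a
  substitution multiplies it by the square of its determinant, which \<open>\<nu>\<close>
  absorbs.\<close>

lemma frame_subst:
  fixes g :: "complex^2^2"
  assumes "frame \<alpha> \<nu> A B C" "invertible g"
  shows "\<exists>\<nu>' A' B' C'. frame \<alpha> \<nu>' A' B' C' \<and> (\<forall>t. quadmap A B C (g *v t) = quadmap A' B' C' t)"
proof -
  define p q r s where g: "p = g $ 1 $ 1" "q = g $ 1 $ 2" "r = g $ 2 $ 1" "s = g $ 2 $ 2"
  define A' where "A' = (\<chi> i. p^2 * A $ i + p * r * B $ i + r^2 * C $ i)"
  define B' where "B' = (\<chi> i. 2 * p * q * A $ i + (p * s + q * r) * B $ i + 2 * r * s * C $ i)"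
  define C' where "C' = (\<chi> i. q^2 * A $ i + q * s * B $ i + s^2 * C $ i)"
  have "det g \<noteq> 0" using assms(2) invertible_det_nz by blast
  then have nz: "p * s - q * r \<noteq> 0" by (simp add: det_2 g)
  have "A' $ i * C' $ j + C' $ i * A' $ j - B' $ i * B' $ j / 2
     = (p * s - q * r)^2 * (A $ i * C $ j + C $ i * A $ j - B $ i * B $ j / 2)" for i j
    by (simp add: A'_def B'_def C'_def power2_eq_square field_simps)
  then have "frame \<alpha> ((p * s - q * r)^2 * \<nu>) A' B' C'"
    using assms(1) nz unfolding frame_def by (simp add: mult.assoc)
  moreover have "quadmap A B C (g *v t) = quadmap A' B' C' t" for t
    by (simp add: vec_eq_iff mult_vec_2 qd_def A'_def B'_def C'_def g power2_eq_square algebra_simps)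
  ultimately show ?thesis by blast
qed

text \<open>
  Every common zero being excluded, \<open>X Z = Y\<^sup>2\<close> forces \<open>X\<close> and \<open>Z\<close> to be squares:
  move a root of \<open>X\<close> to \<open>(1, 0)\<close> and compare coefficients.
\<close>

lemma conic_points_quadratic:
  assumes X: "X \<in> binary_forms 2" and Y: "Y \<in> binary_forms 2" and Z: "Z \<in> binary_forms 2"
    and eq: "\<And>t. X t * Z t = Y t ^ 2"
    and nz: "\<And>t. t \<noteq> 0 \<Longrightarrow> \<not> (X t = 0 \<and> Y t = 0 \<and> Z t = 0)"
  shows "\<exists>g :: complex^2^2. invertible g \<and> (\<forall>t. X t = (g *v t) $ 1 ^ 2 \<and>
     Y t = (g *v t) $ 1 * (g *v t) $ 2 \<and> Z t = (g *v t) $ 2 ^ 2)"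
proof -
  obtain p where p: "p \<noteq> 0" "X p = 0" using X qd_root binary_forms_2_iff by metis
  obtain h :: "complex^2^2" where h: "invertible h" "h *v vector [1, 0] = p" using frame_matrix1[OF p(1)] by blast
  obtain h' where h': "h ** h' = mat 1" "h' ** h = mat 1" using h unfolding invertible_def by blast
  obtain x0 x1 x2 where x: "\<And>t. X (h *v t) = qd x0 x1 x2 t"
    using binary_forms_subst[OF X, of h] unfolding binary_forms_2_iff fun_eq_iff by blast
  obtain y0 y1 y2 where y: "\<And>t. Y (h *v t) = qd y0 y1 y2 t"
    using binary_forms_subst[OF Y, of h] unfolding binary_forms_2_iff fun_eq_iff by blast
  obtain z0 z1 z2 where z: "\<And>t. Z (h *v t) = qd z0 z1 z2 t"
    using binary_forms_subst[OF Z, of h] unfolding binary_forms_2_iff fun_eq_iff by blast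
  have nz': "\<not> (qd x0 x1 x2 t = 0 \<and> qd y0 y1 y2 t = 0 \<and> qd z0 z1 z2 t = 0)" if "t \<noteq> 0" for t
  proof -
    have "h' *v (h *v t) = t" using h' by (simp add: matrix_vector_mul_assoc)
    then have "h *v t \<noteq> 0" using that by auto
    then show ?thesis using nz x y z by metis
  qed
  have x0: "x0 = 0" using x[of "vector [1, 0]"] h(2) p by (simp add: qd_def)
  have "poly ([:x0, x1, x2:] * [:z0, z1, z2:]) u = poly ([:y0, y1, y2:]^2) u" for u
    using eq[of "h *v vector [1, u]"] unfolding x y z
    by (simp add: qd_def power2_eq_square algebra_simps)
  then have "[:x0, x1, x2:] * [:z0, z1, z2:] = [:y0, y1, y2:]^2" by (intro poly_ext)
  then have e: "y0 = 0" "x1 * z0 = 0" "x1 * z1 + x2 * z0 = y1 * y1" "x1 * z2 + x2 * z1 = 2 * y1 * y2" "x2 * z2 = y2 * y2"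
    using x0 by (auto simp: power2_eq_square algebra_simps)
  have "z0 \<noteq> 0" using nz'[of "vector [1, 0]"] x0 e(1) by (auto simp: qd_def vec2_eq)
  then have x1: "x1 = 0" using e by simp
  obtain w where w: "w \<noteq> 0" "qd z0 z1 z2 w = 0" using qd_root by blast
  have x2: "x2 \<noteq> 0"
  proof
    assume "x2 = 0"
    then have "y1 = 0" "y2 = 0" using e x1 by auto
    then show False using nz'[OF w(1)] w(2) x0 x1 \<open>x2 = 0\<close> e(1) by (simp add: qd_def)
  qed
  define m where "m = csqrt x2"
  have m: "m * m = x2" "m \<noteq> 0" using x2 by (auto simp: m_def power2_eq_square[symmetric])
  \<comment> \<open>Now \<open>X\<close> is \<open>m\<^sup>2 t\<^sub>1\<^sup>2\<close>, so
    \<open>m * t $ 2\<close> is the first linear form, and dividing \<open>Y\<close> by it gives the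
    second.\<close>
  define k :: "complex^2^2" where "k = vector [vector [0, m], vector [y1 / m, y2 / m]]"
  have "y1 \<noteq> 0" using e(3) x1 x2 \<open>z0 \<noteq> 0\<close> by auto
  then have k: "invertible k" using m by (simp add: invertible_det_nz det_2 k_def)
  have kk: "qd x0 x1 x2 t = (k *v t) $ 1 ^ 2" "qd y0 y1 y2 t = (k *v t) $ 1 * (k *v t) $ 2"
    "qd z0 z1 z2 t = (k *v t) $ 2 ^ 2" for t
  proof -
    show "qd x0 x1 x2 t = (k *v t) $ 1 ^ 2" using m(1) x0 x1
      by (simp add: qd_def mult_vec_2 k_def power2_eq_square algebra_simps flip: m(1))
    show "qd y0 y1 y2 t = (k *v t) $ 1 * (k *v t) $ 2" using m(2) e(1)
      by (simp add: qd_def mult_vec_2 k_def power2_eq_square field_simps)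
    have "z0 = (y1 / m)^2" "z1 = 2 * (y1 / m) * (y2 / m)" "z2 = (y2 / m)^2"
      using e x1 x2 m by (simp_all add: power2_eq_square field_simps)
    then show "qd z0 z1 z2 t = (k *v t) $ 2 ^ 2"
      by (simp add: qd_def mult_vec_2 k_def power2_eq_square algebra_simps)
  qed
  have "invertible h'" using h' unfolding invertible_def by blast
  then have "invertible (k ** h')" by (rule invertible_mult[OF k])
  moreover have "t = h *v (h' *v t)" for t using h' by (simp add: matrix_vector_mul_assoc)
  then have "X t = ((k ** h') *v t) $ 1 ^ 2 \<and> Y t = ((k ** h') *v t) $ 1 * ((k ** h') *v t) $ 2 \<and>
      Z t = ((k ** h') *v t) $ 2 ^ 2" for t
    using x[of "h' *v t"] y[of "h' *v t"] z[of "h' *v t"] kk[of "h' *v t"]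
    by (simp add: matrix_vector_mul_assoc[symmetric] h')
  ultimately show ?thesis by blast
qed

text \<open>In the basis \<open>A\<close>, \<open>B\<close>, \<open>C\<close> the conic reads X Z =
  Y^2. The coordinates of any other parametrization are therefore the two squares and the product of
  two linear forms, and these are the rows of \<open>g\<close>.\<close>

lemma frame_unique:
  assumes nd: "nondeg \<alpha>" and fr: "frame \<alpha> \<nu> A B C"
    and q: "\<And>k. (\<lambda>t. \<phi> t $ k) \<in> binary_forms 2" and nz: "\<And>t. t \<noteq> 0 \<Longrightarrow> \<phi> t \<noteq> 0"
    and pl: "\<And>t. wdot \<alpha> 1 (\<phi> t) = 0" and iso: "\<And>t. wdot \<alpha> (\<phi> t) (\<phi> t) = 0"
  shows "\<exists>g. invertible g \<and> (\<forall>t. \<phi> t = quadmap A B C (g *v t))"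
proof -
  have nu: "\<nu> \<noteq> 0" using fr by (simp add: frame_def)
  define X where "X = (\<lambda>t. wdot \<alpha> (\<phi> t) C / \<nu>)"
  define Y where "Y = (\<lambda>t. - wdot \<alpha> (\<phi> t) B / (2 * \<nu>))"
  define Z where "Z = (\<lambda>t. wdot \<alpha> (\<phi> t) A / \<nu>)"
  have expand: "\<phi> t $ j = X t * A $ j + Y t * B $ j + Z t * C $ j" for t j
    using frame_expand[OF nd fr pl, of t j] by (simp add: X_def Y_def Z_def)
  have bf: "(\<lambda>t. c * wdot \<alpha> (\<phi> t) v) \<in> binary_forms 2" for c v
  proof -
    have "(\<lambda>t. \<Sum>i\<in>UNIV. (c * \<alpha> $ i * v $ i) * \<phi> t $ i) \<in> binary_forms 2"
      by (intro binary_forms_sum binary_forms_scale q) simp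
    moreover have "(\<lambda>t. \<Sum>i\<in>UNIV. (c * \<alpha> $ i * v $ i) * \<phi> t $ i) = (\<lambda>t. c * wdot \<alpha> (\<phi> t) v)"
      by (simp add: wdot_def sum_distrib_left mult_ac)
    ultimately show ?thesis by simp
  qed
  have XYZ: "X \<in> binary_forms 2" "Y \<in> binary_forms 2" "Z \<in> binary_forms 2"
    using bf[of "1 / \<nu>" C] bf[of "- 1 / (2 * \<nu>)" B] bf[of "1 / \<nu>" A] by (simp_all add: X_def Y_def Z_def)
  have "X t * Z t = Y t ^ 2" for t
  proof -
    have "wdot \<alpha> (\<phi> t) (\<phi> t) = X t * wdot \<alpha> (\<phi> t) A + Y t * wdot \<alpha> (\<phi> t) B + Z t * wdot \<alpha> (\<phi> t) C"
      by (simp add: wdot_def expand sum.distrib sum_distrib_left algebra_simps)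
    also have "\<dots> = 2 * \<nu> * (X t * Z t - Y t ^ 2)"
      using nu by (simp add: X_def Y_def Z_def power2_eq_square field_simps)
    finally show ?thesis using iso nu by simp
  qed
  moreover have "\<not> (X t = 0 \<and> Y t = 0 \<and> Z t = 0)" if "t \<noteq> 0" for t
    using nz[OF that] expand[of t] by (auto simp: vec_eq_iff)
  ultimately obtain g :: "complex^2^2" where "invertible g" "\<forall>t. X t = (g *v t) $ 1 ^ 2 \<and>
     Y t = (g *v t) $ 1 * (g *v t) $ 2 \<and> Z t = (g *v t) $ 2 ^ 2"
    using conic_points_quadratic[OF XYZ] by blast
  then show ?thesis using expand
    by (intro exI[of _ g]) (simp add: vec_eq_iff qd_def algebra_simps)
qed


section \<open>Stability of the cubic restricted to the conic\<close>

definition cubic_form :: "complex^4 \<Rightarrow> complex^4 \<Rightarrow> complex" where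
  "cubic_form \<alpha> z = (\<Sum>i\<in>UNIV. \<alpha> $ i * z $ i ^ 3)"

text \<open>The \<open>x\<close> mark a subset of the indices. The empty set contradicts
  \<open>e3\<close>, and sets of size 1 and 4 contradict \<open>e1\<close>. For two indices,
  \<open>e1\<close> and \<open>e2\<close> make the two values of \<open>b\<close> equal, against
  \<open>e3\<close>. For three, \<open>e2\<close> and \<open>e4\<close> give \<open>b = 0\<close> at
  the missing index, so \<open>e3\<close> and \<open>e5\<close> force
  \<open>\<nu> = 0\<close>.\<close>

lemma subset_sums_contradiction:
  fixes a b x :: "4 \<Rightarrow> complex"
  assumes a: "a 1 \<noteq> 0" "a 2 \<noteq> 0" "a 3 \<noteq> 0" "a 4 \<noteq> 0" "a 1 + a 2 + a 3 + a 4 \<noteq> 0"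
    and x: "x 1 = 0 \<or> x 1 = 1" "x 2 = 0 \<or> x 2 = 1" "x 3 = 0 \<or> x 3 = 1" "x 4 = 0 \<or> x 4 = 1"
    and nu: "\<nu> \<noteq> 0"
    and e1: "a 1 * x 1 + a 2 * x 2 + a 3 * x 3 + a 4 * x 4 = 0"
    and e2: "a 1 * x 1 * b 1 + a 2 * x 2 * b 2 + a 3 * x 3 * b 3 + a 4 * x 4 * b 4 = 0"
    and e3: "a 1 * x 1 * b 1 ^ 2 + a 2 * x 2 * b 2 ^ 2 + a 3 * x 3 * b 3 ^ 2 + a 4 * x 4 * b 4 ^ 2 = - \<nu>"
    and e4: "a 1 * b 1 + a 2 * b 2 + a 3 * b 3 + a 4 * b 4 = 0"
    and e5: "a 1 * b 1 ^ 2 + a 2 * b 2 ^ 2 + a 3 * b 3 ^ 2 + a 4 * b 4 ^ 2 = - 2 * \<nu>"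
  shows False
proof -
  have pair: False if "p + q = 0" "p \<noteq> 0" "p * u + q * v = 0" "p * u ^ 2 + q * v ^ 2 = - \<nu>" for p q u v :: complex
  proof -
    have q: "q = - p" using that(1) by (simp add: add_eq_0_iff)
    then have "u = v" using that(2,3) by simp
    then show False using that(4) q nu by simp
  qed
  show False
    using x
    apply (elim disjE)
    subgoal using e3 nu by simp
    subgoal using e1 a by simp
    subgoal using e1 a by simp
    subgoal using pair[of "a 3" "a 4" "b 3" "b 4"] e1 e2 e3 a by simp
    subgoal using e1 a by simp
    subgoal using pair[of "a 2" "a 4" "b 2" "b 4"] e1 e2 e3 a by simp
    subgoal using pair[of "a 2" "a 3" "b 2" "b 3"] e1 e2 e3 a by simp
    subgoal premises prems
    proof -
      have "a 1 * b 1 = 0" using prems e2 e4 by algebra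
      then have "b 1 = 0" using a by simp
      then have "\<nu> = 0" using prems e3 e5 by algebra
      then show False using nu by simp
    qed
    subgoal using e1 a by simp
    subgoal using pair[of "a 1" "a 4" "b 1" "b 4"] e1 e2 e3 a by simp
    subgoal using pair[of "a 1" "a 3" "b 1" "b 3"] e1 e2 e3 a by simp
    subgoal premises prems
    proof -
      have "a 2 * b 2 = 0" using prems e2 e4 by algebra
      then have "b 2 = 0" using a by simp
      then have "\<nu> = 0" using prems e3 e5 by algebra
      then show False using nu by simp
    qed
    subgoal using pair[of "a 1" "a 2" "b 1" "b 2"] e1 e2 e3 a by simp
    subgoal premises prems
    proof -
      have "a 3 * b 3 = 0" using prems e2 e4 by algebra
      then have "b 3 = 0" using a by simp
      then have "\<nu> = 0" using prems e3 e5 by algebra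
      then show False using nu by simp
    qed
    subgoal premises prems
    proof -
      have "a 4 * b 4 = 0" using prems e2 e4 by algebra
      then have "b 4 = 0" using a by simp
      then have "\<nu> = 0" using prems e3 e5 by algebra
      then show False using nu by simp
    qed
    subgoal using e1 a by simp
    done
qed

text \<open>The vector \<open>w\<close> of squares lies in the plane because \<open>A\<close> is
  isotropic, and \<open>c0\<close>, \<open>c1\<close> make it orthogonal to \<open>A\<close> and
  \<open>B\<close>. In the expansion by the frame only a multiple \<open>q\<close> of
  \<open>A\<close> survives, so \<open>A / q\<close> has entries 0 and 1.\<close>

lemma no_triple_root:
  assumes nd: "nondeg \<alpha>" and fr: "frame \<alpha> \<nu> A B C"
    and c0: "wdot \<alpha> A (\<chi> i. A $ i ^ 2) = 0" and c1: "wdot \<alpha> B (\<chi> i. A $ i ^ 2) = 0"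
    and c2: "wdot \<alpha> C (\<chi> i. A $ i ^ 2) + wdot \<alpha> A (\<chi> i. B $ i ^ 2) = 0"
  shows False
proof -
  have gr: "gram \<alpha> \<nu> A B C" using frame_gram[OF nd] fr by blast
  then have nu: "\<nu> \<noteq> 0" by (simp add: gram_def)
  define q where "q = wdot \<alpha> C (\<chi> i. A $ i ^ 2) / \<nu>"
  have "wdot \<alpha> 1 (\<chi> i. A $ i ^ 2) = wdot \<alpha> A A" by (simp add: wdot_4 power2_eq_square algebra_simps)
  then have "wdot \<alpha> 1 (\<chi> i. A $ i ^ 2) = 0" using gr by (simp add: gram_def)
  define w where "w = (\<chi> i. A $ i ^ 2)"
  have w: "wdot \<alpha> w A = 0" "wdot \<alpha> w B = 0" "wdot \<alpha> w C / \<nu> = q" "wdot \<alpha> 1 w = 0"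
    using c0 c1 \<open>wdot \<alpha> 1 (\<chi> i. A $ i ^ 2) = 0\<close>
    unfolding w_def[symmetric] q_def by (simp_all add: wdot_sym[of \<alpha> w])
  have A2: "A $ j ^ 2 = q * A $ j" for j
  proof -
    have "w $ j = A $ j ^ 2" by (simp add: w_def)
    then show ?thesis using frame_expand[OF nd fr w(4), of j] unfolding w(1-3) by simp
  qed
  have q: "q \<noteq> 0"
  proof
    assume "q = 0"
    then have "A $ j = 0" for j using A2[of j] by simp
    then have "wdot \<alpha> A C = 0" by (simp add: wdot_4)
    then show False using gr nu by (simp add: gram_def)
  qed
  have A: "A $ j = 0 \<or> A $ j = q" for j using A2[of j] by (simp add: power2_eq_square)
  define a b x where "a = (\<lambda>n. \<alpha> $ n)" and "b = (\<lambda>n. B $ n)" and "x = (\<lambda>n. A $ n / q)"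
  have qx: "A $ 1 = q * x 1" "A $ 2 = q * x 2" "A $ 3 = q * x 3" "A $ 4 = q * x 4" using q by (simp_all add: x_def)
  have x: "x n = 0 \<or> x n = 1" for n using A[of n] q by (auto simp: x_def)
  have "wdot \<alpha> C (\<chi> i. A $ i ^ 2) = q * \<nu>" using nu by (simp add: q_def)
  then have "wdot \<alpha> A (\<chi> i. B $ i ^ 2) = - (q * \<nu>)" using c2 by (simp add: add_eq_0_iff2)
  moreover have "wdot \<alpha> A (\<chi> i. B $ i ^ 2) = q * (a 1 * x 1 * b 1 ^ 2 + a 2 * x 2 * b 2 ^ 2 + a 3 * x 3 * b 3 ^ 2 + a 4 * x 4 * b 4 ^ 2)"
    by (simp add: wdot_4 qx a_def b_def algebra_simps)
  ultimately have "q * (a 1 * x 1 * b 1 ^ 2 + a 2 * x 2 * b 2 ^ 2 + a 3 * x 3 * b 3 ^ 2 + a 4 * x 4 * b 4 ^ 2) = q * (- \<nu>)"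
    by simp
  then have e3: "a 1 * x 1 * b 1 ^ 2 + a 2 * x 2 * b 2 ^ 2 + a 3 * x 3 * b 3 ^ 2 + a 4 * x 4 * b 4 ^ 2 = - \<nu>"
    using q by (simp only: mult_cancel_left) simp
  have "wdot \<alpha> 1 A = q * (a 1 * x 1 + a 2 * x 2 + a 3 * x 3 + a 4 * x 4)"
    by (simp add: wdot_4 qx a_def algebra_simps)
  moreover have "wdot \<alpha> 1 A = 0" using gr by (simp add: gram_def)
  ultimately have e1: "a 1 * x 1 + a 2 * x 2 + a 3 * x 3 + a 4 * x 4 = 0" using q by simp
  have "wdot \<alpha> A B = q * (a 1 * x 1 * b 1 + a 2 * x 2 * b 2 + a 3 * x 3 * b 3 + a 4 * x 4 * b 4)"
    by (simp add: wdot_4 qx a_def b_def algebra_simps)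
  moreover have "wdot \<alpha> A B = 0" using gr by (simp add: gram_def)
  ultimately have e2: "a 1 * x 1 * b 1 + a 2 * x 2 * b 2 + a 3 * x 3 * b 3 + a 4 * x 4 * b 4 = 0" using q by simp
  have e4: "a 1 * b 1 + a 2 * b 2 + a 3 * b 3 + a 4 * b 4 = 0"
    using gr by (simp add: gram_def wdot_4 a_def b_def)
  have e5: "a 1 * b 1 ^ 2 + a 2 * b 2 ^ 2 + a 3 * b 3 ^ 2 + a 4 * b 4 ^ 2 = - 2 * \<nu>"
    using gr by (simp add: gram_def wdot_4 a_def b_def power2_eq_square mult.assoc)
  have nz: "a 1 \<noteq> 0" "a 2 \<noteq> 0" "a 3 \<noteq> 0" "a 4 \<noteq> 0" "a 1 + a 2 + a 3 + a 4 \<noteq> 0"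
    using nd by (auto simp: nondeg_def a_def asum_def)
  show False by (rule subset_sums_contradiction[OF nz x x x x nu e1 e2 e3 e4 e5])
qed

lemma frame_sextic:
  "\<exists>c. (\<lambda>t. cubic_form \<alpha> (quadmap A B C t)) = sextic c \<and> c 0 = wdot \<alpha> A (\<chi> i. A $ i ^ 2)
     \<and> c 1 = 3 * wdot \<alpha> B (\<chi> i. A $ i ^ 2)
     \<and> c 2 = 3 * (wdot \<alpha> C (\<chi> i. A $ i ^ 2) + wdot \<alpha> A (\<chi> i. B $ i ^ 2))"
proof -
  define c where "c = (\<lambda>n. \<Sum>i\<in>UNIV. \<alpha> $ i * ([A $ i ^ 3, 3 * A $ i ^ 2 * B $ i, 3 * (A $ i ^ 2 * C $ i + A $ i * B $ i ^ 2),
     6 * A $ i * B $ i * C $ i + B $ i ^ 3, 3 * (A $ i * C $ i ^ 2 + B $ i ^ 2 * C $ i), 3 * B $ i * C $ i ^ 2, C $ i ^ 3] ! n))"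
  have one: "qd a b d t ^ 3 = a ^ 3 * t $ 1 ^ 6 + 3 * a ^ 2 * b * t $ 1 ^ 5 * t $ 2 + 3 * (a ^ 2 * d + a * b ^ 2) * t $ 1 ^ 4 * t $ 2 ^ 2
     + (6 * a * b * d + b ^ 3) * t $ 1 ^ 3 * t $ 2 ^ 3 + 3 * (a * d ^ 2 + b ^ 2 * d) * t $ 1 ^ 2 * t $ 2 ^ 4 + 3 * b * d ^ 2 * t $ 1 * t $ 2 ^ 5
     + d ^ 3 * t $ 2 ^ 6" for a b d t
    by (simp add: qd_def eval_nat_numeral algebra_simps)
  have "cubic_form \<alpha> (quadmap A B C t) = sextic c t" for t
    unfolding cubic_form_def quadmap_nth one sextic_expand c_def
    by (simp add: sum_4) (simp add: algebra_simps)
  then show ?thesis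
    by (intro exI[of _ c] conjI ext)
      (simp_all add: c_def sum_4 wdot_4 eval_nat_numeral algebra_simps)
qed

lemma frame_sextic_stable:
  assumes nd: "nondeg \<alpha>" and fr: "frame \<alpha> \<nu> A B C"
  shows "stable_sextic (\<lambda>t. cubic_form \<alpha> (quadmap A B C t))"
proof -
  let ?J = "\<lambda>t. cubic_form \<alpha> (quadmap A B C t)"
  have bf: "?J \<in> binary_forms 6" using frame_sextic[of \<alpha> A B C] binary_forms_6_iff by blast
  have nr: False if p: "p \<noteq> 0" and r: "root_mult_ge 6 ?J 3 p" for p
  proof -
    obtain g :: "complex^2^2" where g: "invertible g" "g *v vector [1, 0] = p" using frame_matrix1[OF p] by blast
    obtain \<nu>' A' B' C' where f': "frame \<alpha> \<nu>' A' B' C'" and e: "\<forall>t. quadmap A B C (g *v t) = quadmap A' B' C' t"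
      using frame_subst[OF fr g(1)] by blast
    have r': "root_mult_ge 6 (\<lambda>t. cubic_form \<alpha> (quadmap A' B' C' t)) 3 (vector [1, 0])"
      using root_mult_ge_subst[OF g(1) r g(2)] e by simp
    obtain c where c: "(\<lambda>t. cubic_form \<alpha> (quadmap A' B' C' t)) = sextic c" "c 0 = wdot \<alpha> A' (\<chi> i. A' $ i ^ 2)"
      "c 1 = 3 * wdot \<alpha> B' (\<chi> i. A' $ i ^ 2)"
      "c 2 = 3 * (wdot \<alpha> C' (\<chi> i. A' $ i ^ 2) + wdot \<alpha> A' (\<chi> i. B' $ i ^ 2))"
      using frame_sextic by blast
    have z: "c 0 = 0 \<and> c 1 = 0 \<and> c 2 = 0" using triple_root_1 r' unfolding c(1) by blast
    have "wdot \<alpha> A' (\<chi> i. A' $ i ^ 2) = 0" using z unfolding c(2) by blast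
    moreover have "wdot \<alpha> B' (\<chi> i. A' $ i ^ 2) = 0" using z unfolding c(3) mult_eq_0_iff by auto
    moreover have "wdot \<alpha> C' (\<chi> i. A' $ i ^ 2) + wdot \<alpha> A' (\<chi> i. B' $ i ^ 2) = 0"
      using z unfolding c(4) mult_eq_0_iff by auto
    ultimately show False by (rule no_triple_root[OF nd f'])
  qed
  \<comment> \<open>The zero form would have a triple root at every point.\<close>
  have "?J \<noteq> (\<lambda>t. 0)"
  proof
    assume z: "?J = (\<lambda>t. 0)"
    have "(\<lambda>t. 0 * (t $ 1 ^ 3 * t $ 2 ^ 0)) \<in> binary_forms 3"
      using binary_forms_scale[OF binary_forms_monomial[of 3 0], of 0] by simp
    then have "root_mult_ge 6 ?J 3 (vector [1, 0])"
      unfolding z root_mult_ge_def by (intro bexI[of _ "\<lambda>t. 0"]) simp_all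
    moreover have "(vector [1, 0] :: complex^2) \<noteq> 0" by (auto simp: vec2_eq)
    ultimately show False using nr by blast
  qed
  then show ?thesis unfolding stable_sextic_def using bf nr by blast
qed


lemma singular_kernel:
  fixes M :: "complex^'n^'n"
  assumes "det M = 0"
  shows "\<exists>x. x \<noteq> 0 \<and> M *v x = 0"
  using assms invertible_det_nz[of M] invertible_left_inverse[of M] matrix_left_invertible_ker[of M] by blast

lemma wdot_linear:
  "wdot \<alpha> (u + v) w = wdot \<alpha> u w + wdot \<alpha> v w" "wdot \<alpha> (u - v) w = wdot \<alpha> u w - wdot \<alpha> v w"
  "wdot \<alpha> (c *s u) w = c * wdot \<alpha> u w"
  "wdot \<alpha> w (u + v) = wdot \<alpha> w u + wdot \<alpha> w v" "wdot \<alpha> w (u - v) = wdot \<alpha> w u - wdot \<alpha> w v"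
  "wdot \<alpha> w (c *s u) = c * wdot \<alpha> w u"
  by (simp_all add: wdot_4 algebra_simps)

text \<open>
  A hyperbolic pair \<open>A\<close>, \<open>C\<close> of the form on the plane, completed by a vector orthogonal to both.
\<close>

lemma frame_exists:
  assumes nd: "nondeg \<alpha>"
  shows "\<exists>\<nu> A B C. frame \<alpha> \<nu> A B C"
proof -
  have nz: "\<alpha> $ i \<noteq> 0" "asum \<alpha> \<noteq> 0" for i using nd by (auto simp: nondeg_def)
  \<comment> \<open>This quadratic is the form restricted to the vectors of the plane with fourth
    coordinate 0, after eliminating the third coordinate.\<close>
  obtain s :: "complex^2" where s: "s \<noteq> 0" "qd (\<alpha> $ 1 + \<alpha> $ 1 ^ 2 / \<alpha> $ 3) (2 * \<alpha> $ 1 * \<alpha> $ 2 / \<alpha> $ 3) (\<alpha> $ 2 + \<alpha> $ 2 ^ 2 / \<alpha> $ 3) s = 0"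
    using qd_root by blast
  define A :: "complex^4" where "A = vector [s $ 1, s $ 2, - (\<alpha> $ 1 * s $ 1 + \<alpha> $ 2 * s $ 2) / \<alpha> $ 3, 0]"
  have A1: "wdot \<alpha> 1 A = 0" using nz(1)[of 3] by (simp add: wdot_4 A_def vector_4)
  have "wdot \<alpha> A A = qd (\<alpha> $ 1 + \<alpha> $ 1 ^ 2 / \<alpha> $ 3) (2 * \<alpha> $ 1 * \<alpha> $ 2 / \<alpha> $ 3) (\<alpha> $ 2 + \<alpha> $ 2 ^ 2 / \<alpha> $ 3) s"
    using nz(1)[of 3] by (simp add: wdot_4 A_def vector_4 qd_def power2_eq_square field_simps)
  then have AA: "wdot \<alpha> A A = 0" using s by simp
  have "A $ 1 \<noteq> 0 \<or> A $ 2 \<noteq> 0" using s(1) by (simp add: A_def vector_4 vec2_eq)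
  then obtain i0 where i0: "A $ i0 \<noteq> 0" by blast
  \<comment> \<open>A multiple of the projection of a unit vector to the plane; its product with
    \<open>A\<close> is nonzero by the choice of \<open>i0\<close>.\<close>
  define D :: "complex^4" where "D = asum \<alpha> *s axis i0 1 - \<alpha> $ i0 *s 1"
  have ax: "wdot \<alpha> v (axis i0 1) = \<alpha> $ i0 * v $ i0" for v
    unfolding wdot_def by (subst sum.remove[of _ i0]) (auto simp: axis_def)
  have t: "wdot \<alpha> 1 1 = asum \<alpha>" by (simp add: wdot_4 asum_def)
  have D1: "wdot \<alpha> 1 D = 0" by (simp add: D_def wdot_linear ax t)
  define n where "n = wdot \<alpha> A D"
  have "n = asum \<alpha> * \<alpha> $ i0 * A $ i0" by (simp add: n_def D_def wdot_linear ax wdot_sym[of \<alpha> A 1] A1)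
  then have n: "n \<noteq> 0" using nz i0 by simp
  define C where "C = D - (wdot \<alpha> D D / (2 * n)) *s A"
  have C1: "wdot \<alpha> 1 C = 0" by (simp add: C_def wdot_linear D1 A1)
  have AC: "wdot \<alpha> A C = n" by (simp add: C_def wdot_linear AA n_def)
  have CC: "wdot \<alpha> C C = 0"
    using n by (simp add: C_def wdot_linear AA wdot_sym[of \<alpha> D A] n_def[symmetric])
  \<comment> \<open>The rows are the functionals of pairing with 1, \<open>A\<close>,
    \<open>C\<close> and \<open>v\<close>. A zero last row makes the matrix singular, and its kernel
    contains the third basis vector.\<close>
  define N :: "complex^4 \<Rightarrow> complex^4^4" where
    "N = (\<lambda>v. vector [\<alpha>, (\<chi> i. \<alpha> $ i * A $ i), (\<chi> i. \<alpha> $ i * C $ i), (\<chi> i. \<alpha> $ i * v $ i)])"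
  have Nv: "(N v *v x) $ 1 = wdot \<alpha> 1 x \<and> (N v *v x) $ 2 = wdot \<alpha> A x \<and>
      (N v *v x) $ 3 = wdot \<alpha> C x \<and> (N v *v x) $ 4 = wdot \<alpha> v x" for v x
    by (simp add: N_def matrix_vector_mult_def vector_4 wdot_def)
  have "row 4 (N 0) = 0" by (simp add: N_def row_def vector_4 vec_eq_iff)
  then have "det (N 0) = 0" by (rule det_zero_row)
  then obtain B0 where B0: "B0 \<noteq> 0" "N 0 *v B0 = 0" using singular_kernel by blast
  have B: "wdot \<alpha> 1 B0 = 0" "wdot \<alpha> A B0 = 0" "wdot \<alpha> C B0 = 0"
    using Nv[of 0 B0] B0(2) by simp_all
  \<comment> \<open>An isotropic \<open>B0\<close> would be killed by \<open>N B0\<close>, making 1,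
    \<open>A\<close>, \<open>C\<close>, \<open>B0\<close> linearly dependent; pairing the relation
    with 1, \<open>A\<close> and \<open>C\<close> shows that all its coefficients vanish.\<close>
  have BB: "wdot \<alpha> B0 B0 \<noteq> 0"
  proof
    assume "wdot \<alpha> B0 B0 = 0"
    then have "N B0 *v B0 = 0" using Nv[of B0 B0] B by (simp add: vec_eq_iff forall_4)
    then have "\<not> invertible (N B0)" using B0(1)
      using invertible_left_inverse[of "N B0"] matrix_left_invertible_ker[of "N B0"] by blast
    then have "det (transpose (N B0)) = 0" by (simp add: invertible_det_nz)
    then obtain c where c: "c \<noteq> 0" "transpose (N B0) *v c = 0" using singular_kernel by blast
    have "c $ 1 + c $ 2 * A $ i + c $ 3 * C $ i + c $ 4 * B0 $ i = 0" for i
    proof -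
      have "(transpose (N B0) *v c) $ i = \<alpha> $ i * (c $ 1 + c $ 2 * A $ i + c $ 3 * C $ i + c $ 4 * B0 $ i)"
        by (simp add: N_def matrix_vector_mult_def transpose_def vector_4 sum_4 algebra_simps)
      then show ?thesis using c(2) nz(1)[of i] by simp
    qed
    then have v: "c $ 1 *s 1 + c $ 2 *s A + c $ 3 *s C + c $ 4 *s B0 = 0" by (simp add: vec_eq_iff)
    have w0: "wdot \<alpha> u 0 = 0" for u by (simp add: wdot_4)
    have "c $ 1 = 0"
      using arg_cong[OF v, of "wdot \<alpha> 1"] nz(2) by (simp add: wdot_linear t A1 C1 B w0)
    moreover have "c $ 3 = 0"
      using arg_cong[OF v, of "wdot \<alpha> A"] n by (simp add: wdot_linear AA AC B w0 wdot_sym[of \<alpha> A 1] A1)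
    moreover have "c $ 2 = 0"
      using arg_cong[OF v, of "wdot \<alpha> C"] n by (simp add: wdot_linear CC AC B w0 wdot_sym[of \<alpha> C 1] wdot_sym[of \<alpha> C A] C1)
    moreover have "c $ 4 = 0" using v calculation B0(1) by (simp add: vector_smult_assoc)
    ultimately show False using c(1) by (simp add: vec_eq_iff forall_4)
  qed
  define r where "r = csqrt (- 2 * n / wdot \<alpha> B0 B0)"
  have r: "r * r = - 2 * n / wdot \<alpha> B0 B0" by (simp add: r_def flip: power2_eq_square)
  have "r * r * wdot \<alpha> B0 B0 = - 2 * n" unfolding r using BB by simp
  then have "gram \<alpha> n A (r *s B0) C"
    using n AA CC A1 C1 B AC
    by (simp add: gram_def wdot_linear wdot_sym[of \<alpha> B0 C] mult.assoc)
  then show ?thesis using frame_gram[OF nd] by blast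
qed

lemma frame_on_conic:
  assumes "nondeg \<alpha>" "frame \<alpha> \<nu> A B C"
  shows "wdot \<alpha> 1 (quadmap A B C t) = 0" "wdot \<alpha> (quadmap A B C t) (quadmap A B C t) = 0"
proof -
  have q: "quadmap A B C t = t $ 1 ^ 2 *s A + (t $ 1 * t $ 2) *s B + t $ 2 ^ 2 *s C"
    by (simp add: vec_eq_iff qd_def algebra_simps)
  have "gram \<alpha> \<nu> A B C" using assms frame_gram by blast
  then show "wdot \<alpha> 1 (quadmap A B C t) = 0" "wdot \<alpha> (quadmap A B C t) (quadmap A B C t) = 0"
    unfolding q wdot_linear gram_def
    by (simp_all add: wdot_sym[of \<alpha> B A] wdot_sym[of \<alpha> C A] wdot_sym[of \<alpha> C B] power2_eq_square)
qed

section \<open>The Jacobian of the pencil attached to a frame\<close>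

lemma cofactor_column:
  fixes A1 A2 A3 B1 B2 B3 C1 C2 C3 X Y Z e1 e2 e3 :: complex
  assumes "A1 * X + B1 * Y + C1 * Z = e1" "A2 * X + B2 * Y + C2 * Z = e2" "A3 * X + B3 * Y + C3 * Z = e3"
    and D: "D = (A1 * B2 - A2 * B1) * C3 + (A2 * B3 - A3 * B2) * C1 + (A3 * B1 - A1 * B3) * C2"
  shows "D * Z = (A1 * B2 - A2 * B1) * e3 + (A2 * B3 - A3 * B2) * e1 + (A3 * B1 - A1 * B3) * e2"
    "D * X = (B1 * C2 - B2 * C1) * e3 + (B2 * C3 - B3 * C2) * e1 + (B3 * C1 - B1 * C3) * e2"
    "D * Y = (C1 * A2 - C2 * A1) * e3 + (C2 * A3 - C3 * A2) * e1 + (C3 * A1 - C1 * A3) * e2"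
  unfolding D assms(1-3)[symmetric] by (simp_all add: algebra_simps)

text \<open>The Jacobian determinant of two binary quadratics, through their coefficients.\<close>

definition qd_jac :: "complex \<Rightarrow> complex \<Rightarrow> complex \<Rightarrow> complex \<Rightarrow> complex \<Rightarrow> complex \<Rightarrow> complex^2 \<Rightarrow> complex" where
  "qd_jac a b c a' b' c' = qd (2 * (a * b' - a' * b)) (4 * (a * c' - a' * c)) (2 * (b * c' - b' * c))"

text \<open>
  With \<open>P\<close>, \<open>Q\<close>, \<open>R\<close> the Jacobians of the pairs among \<open>z\<^sub>1\<close>, \<open>z\<^sub>2\<close>, \<open>z\<^sub>3\<close>, Euler's relation gives
  \<open>P z\<^sub>1 + Q z\<^sub>2 + R z\<^sub>3 = 0\<close>, which removes the other terms of the product rule.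
\<close>

lemma jacobian_triangle_pencil:
  assumes "z1 = qd A1 B1 C1" "z2 = qd A2 B2 C2" "z3 = qd A3 B3 C3"
  shows "jacobian_form (\<lambda>t. (z1 t - z2 t) * z3 t) (\<lambda>t. (z1 t - z3 t) * z2 t) t
    = - 2 * (qd_jac A2 B2 C2 A3 B3 C3 t * z1 t ^ 2 + qd_jac A3 B3 C3 A1 B1 C1 t * z2 t ^ 2
        + qd_jac A1 B1 C1 A2 B2 C2 t * z3 t ^ 2)"
    "qd_jac A2 B2 C2 A3 B3 C3 t * z1 t + qd_jac A3 B3 C3 A1 B1 C1 t * z2 t
        + qd_jac A1 B1 C1 A2 B2 C2 t * z3 t = 0"
proof -
  note d = has_partial_qd
  show e: "qd_jac A2 B2 C2 A3 B3 C3 t * z1 t + qd_jac A3 B3 C3 A1 B1 C1 t * z2 t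
        + qd_jac A1 B1 C1 A2 B2 C2 t * z3 t = 0"
    unfolding assms by (simp add: qd_def qd_jac_def power2_eq_square algebra_simps)
  define p where "p = (\<lambda>a b :: complex. 2 * a * t $ 1 + b * t $ 2)"
  define q where "q = (\<lambda>b c :: complex. b * t $ 1 + 2 * c * t $ 2)"
  have j: "qd_jac a b c a' b' c' t = p a b * q b' c' - q b c * p a' b'" for a b c a' b' c'
    by (simp add: qd_jac_def qd_def p_def q_def power2_eq_square algebra_simps)
  define w1 w2 w3 where w: "w1 = z1 t" "w2 = z2 t" "w3 = z3 t"
  have "jacobian_form (\<lambda>t. (z1 t - z2 t) * z3 t) (\<lambda>t. (z1 t - z3 t) * z2 t) t
    = ((p A1 B1 - p A2 B2) * w3 + (w1 - w2) * p A3 B3) * ((q B1 C1 - q B3 C3) * w2 + (w1 - w3) * q B2 C2)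
    - ((q B1 C1 - q B2 C2) * w3 + (w1 - w2) * q B3 C3) * ((p A1 B1 - p A3 B3) * w2 + (w1 - w3) * p A2 B2)"
    unfolding assms
    unfolding jacobian_form_partials[OF has_partial_mult[OF has_partial_diff[OF d(1) d(1)] d(1)]
          has_partial_mult[OF has_partial_diff[OF d(2) d(2)] d(2)]
          has_partial_mult[OF has_partial_diff[OF d(1) d(1)] d(1)]
          has_partial_mult[OF has_partial_diff[OF d(2) d(2)] d(2)]]
    unfolding p_def q_def w assms ..
  also have "\<dots> = (w1 + w2 + w3) * (qd_jac A2 B2 C2 A3 B3 C3 t * w1 + qd_jac A3 B3 C3 A1 B1 C1 t * w2
        + qd_jac A1 B1 C1 A2 B2 C2 t * w3)
      - 2 * (qd_jac A2 B2 C2 A3 B3 C3 t * w1 ^ 2 + qd_jac A3 B3 C3 A1 B1 C1 t * w2 ^ 2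
        + qd_jac A1 B1 C1 A2 B2 C2 t * w3 ^ 2)"
    unfolding j by (simp add: power2_eq_square algebra_simps)
  finally show "jacobian_form (\<lambda>t. (z1 t - z2 t) * z3 t) (\<lambda>t. (z1 t - z3 t) * z2 t) t
    = - 2 * (qd_jac A2 B2 C2 A3 B3 C3 t * z1 t ^ 2 + qd_jac A3 B3 C3 A1 B1 C1 t * z2 t ^ 2
        + qd_jac A1 B1 C1 A2 B2 C2 t * z3 t ^ 2)"
    using e unfolding w by simp
qed

text \<open>The frame identity inverts the coefficient matrix of the first three coordinates. By
  Cramer's rule the Jacobian of two of them is proportional to
  \<open>\<alpha> $ m * (z m t - z 4 t)\<close> with the third index \<open>m\<close>; what differs
  from the cubic is \<open>z 4 t\<close> times the equation of the conic.\<close>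

lemma frame_pencil_jacobian:
  assumes nd: "nondeg \<alpha>" and fr: "frame \<alpha> \<nu> A B C"
  defines "z \<equiv> \<lambda>n. qd (A $ n) (B $ n) (C $ n)"
  shows "\<exists>c. c \<noteq> 0 \<and> jacobian_form (\<lambda>t. (z 1 t - z 2 t) * z 3 t) (\<lambda>t. (z 1 t - z 3 t) * z 2 t)
      = (\<lambda>t. c * cubic_form \<alpha> (quadmap A B C t))"
proof -
  have nu: "\<nu> \<noteq> 0" using fr by (simp add: frame_def)
  have nz: "\<alpha> $ i \<noteq> 0" for i using nd by (auto simp: nondeg_def)
  \<comment> \<open>Subtracting column 4 of the frame identity from column \<open>m\<close> cancels
    the constant \<open>1 / asum \<alpha>\<close>.\<close>
  define X where "X = (\<lambda>m. \<alpha> $ m * (C $ m - C $ 4) / \<nu>)"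
  define Y where "Y = (\<lambda>m. - \<alpha> $ m * (B $ m - B $ 4) / (2 * \<nu>))"
  define Z where "Z = (\<lambda>m. \<alpha> $ m * (A $ m - A $ 4) / \<nu>)"
  have c: "A $ n * X m + B $ n * Y m + C $ n * Z m = (if n = m then 1 else 0)" if "n \<noteq> 4" for n m
  proof -
    have "A $ n * X m + B $ n * Y m + C $ n * Z m
       = \<alpha> $ m / \<nu> * ((A $ n * C $ m + C $ n * A $ m - B $ n * B $ m / 2) - (A $ n * C $ 4 + C $ n * A $ 4 - B $ n * B $ 4 / 2))"
      using nu by (simp add: X_def Y_def Z_def field_simps)
    also have "\<dots> = \<alpha> $ m / \<nu> * (\<nu> * ((if n = m then 1 / \<alpha> $ n else 0) - 1 / asum \<alpha>) - \<nu> * ((if n = 4 then 1 / \<alpha> $ n else 0) - 1 / asum \<alpha>))"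
      using fr by (simp only: frame_def)
    also have "\<dots> = (if n = m then 1 else 0)" using that nu nz[of m] by (simp add: algebra_simps)
    finally show ?thesis .
  qed
  have eqs: "A $ 1 * X m + B $ 1 * Y m + C $ 1 * Z m = (if 1 = m then 1 else 0)"
    "A $ 2 * X m + B $ 2 * Y m + C $ 2 * Z m = (if 2 = m then 1 else 0)"
    "A $ 3 * X m + B $ 3 * Y m + C $ 3 * Z m = (if 3 = m then 1 else 0)" for m
    by (rule c, simp)+
  define D where "D = (A $ 1 * B $ 2 - A $ 2 * B $ 1) * C $ 3 + (A $ 2 * B $ 3 - A $ 3 * B $ 2) * C $ 1 + (A $ 3 * B $ 1 - A $ 1 * B $ 3) * C $ 2"
  note cof = cofactor_column[OF eqs D_def]
  \<comment> \<open>Otherwise Cramer's rule for column 3 makes all minors of the first two rows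
    vanish, against Cauchy-Binet for the 2 by 2 unit block.\<close>
  have D: "D \<noteq> 0"
  proof
    assume "D = 0"
    then have "A $ 1 * B $ 2 - A $ 2 * B $ 1 = 0" "B $ 1 * C $ 2 - B $ 2 * C $ 1 = 0" "C $ 1 * A $ 2 - C $ 2 * A $ 1 = 0"
      using cof[of 3] by simp_all
    moreover have "(A $ 1 * X 1 + B $ 1 * Y 1 + C $ 1 * Z 1) * (A $ 2 * X 2 + B $ 2 * Y 2 + C $ 2 * Z 2)
       - (A $ 1 * X 2 + B $ 1 * Y 2 + C $ 1 * Z 2) * (A $ 2 * X 1 + B $ 2 * Y 1 + C $ 2 * Z 1)
       = (A $ 1 * B $ 2 - A $ 2 * B $ 1) * (X 1 * Y 2 - X 2 * Y 1) + (B $ 1 * C $ 2 - B $ 2 * C $ 1) * (Y 1 * Z 2 - Y 2 * Z 1)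
        + (C $ 1 * A $ 2 - C $ 2 * A $ 1) * (Z 1 * X 2 - Z 2 * X 1)"
      by (simp add: algebra_simps)
    ultimately show False unfolding eqs by simp
  qed
  define \<kappa> where "\<kappa> = 2 * D / \<nu>"
  have k: "qd (2 * D * Z m) (- 4 * D * Y m) (2 * D * X m) t = \<kappa> * \<alpha> $ m * (z m t - z 4 t)" for m t
    using nu by (simp add: qd_def z_def \<kappa>_def X_def Y_def Z_def field_simps)
  have J: "qd_jac (A $ 2) (B $ 2) (C $ 2) (A $ 3) (B $ 3) (C $ 3) t = \<kappa> * \<alpha> $ 1 * (z 1 t - z 4 t)"
    "qd_jac (A $ 3) (B $ 3) (C $ 3) (A $ 1) (B $ 1) (C $ 1) t = \<kappa> * \<alpha> $ 2 * (z 2 t - z 4 t)"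
    "qd_jac (A $ 1) (B $ 1) (C $ 1) (A $ 2) (B $ 2) (C $ 2) t = \<kappa> * \<alpha> $ 3 * (z 3 t - z 4 t)" for t
    unfolding k[symmetric] qd_jac_def
    using cof[of 1] cof[of 2] cof[of 3] by (simp_all add: mult.assoc) (simp_all add: algebra_simps)
  have "jacobian_form (\<lambda>t. (z 1 t - z 2 t) * z 3 t) (\<lambda>t. (z 1 t - z 3 t) * z 2 t) t
      = (- 2 * \<kappa>) * cubic_form \<alpha> (quadmap A B C t)" for t
  proof -
    have iso: "\<alpha> $ 1 * z 1 t * z 1 t + \<alpha> $ 2 * z 2 t * z 2 t + \<alpha> $ 3 * z 3 t * z 3 t + \<alpha> $ 4 * z 4 t * z 4 t = 0"
      using frame_on_conic(2)[OF nd fr, of t] by (simp add: wdot_4 z_def)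
    have "jacobian_form (\<lambda>t. (z 1 t - z 2 t) * z 3 t) (\<lambda>t. (z 1 t - z 3 t) * z 2 t) t
      = - 2 * (\<kappa> * \<alpha> $ 1 * (z 1 t - z 4 t) * z 1 t ^ 2 + \<kappa> * \<alpha> $ 2 * (z 2 t - z 4 t) * z 2 t ^ 2
         + \<kappa> * \<alpha> $ 3 * (z 3 t - z 4 t) * z 3 t ^ 2)"
      using jacobian_triangle_pencil(1)[of "z 1" "A $ 1" "B $ 1" "C $ 1" "z 2" "A $ 2" "B $ 2" "C $ 2" "z 3" "A $ 3" "B $ 3" "C $ 3" t]
      unfolding J by (simp add: z_def)
    also have "\<dots> = (- 2 * \<kappa>) * cubic_form \<alpha> (quadmap A B C t) + 2 * \<kappa> * z 4 t *
        (\<alpha> $ 1 * z 1 t * z 1 t + \<alpha> $ 2 * z 2 t * z 2 t + \<alpha> $ 3 * z 3 t * z 3 t + \<alpha> $ 4 * z 4 t * z 4 t)"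
      by (simp add: cubic_form_def sum_4 z_def[symmetric]) (simp add: power2_eq_square power3_eq_cube algebra_simps z_def)
    finally show ?thesis using iso by simp
  qed
  moreover have "- 2 * \<kappa> \<noteq> 0" using D nu by (simp add: \<kappa>_def)
  ultimately show ?thesis by blast
qed


section \<open>Desargues configurations and their von Staudt conics\<close>

text \<open>
  To treat the five reference points alike, a fifth coordinate \<open>0\<close> and a fifth
  coefficient are added, so that the \<open>ac \<alpha> n\<close> sum to \<open>0\<close>, and the fifth reference
  point is replaced by its negative, so that the \<open>rp n\<close> sum to \<open>0\<close>.
  Only differences of the coordinates \<open>zc z n\<close> then have a meaning.
\<close>

definition zc :: "complex^4 \<Rightarrow> nat \<Rightarrow> complex" where
  "zc z n = (if n = 1 then z $ 1 else if n = 2 then z $ 2 else if n = 3 then z $ 3 else if n = 4 then z $ 4 else 0)"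

definition ac :: "complex^4 \<Rightarrow> nat \<Rightarrow> complex" where
  "ac \<alpha> n = (if n = 5 then - asum \<alpha> else zc \<alpha> n)"

definition rp :: "nat \<Rightarrow> complex^4" where
  "rp n = (if n = 5 then - ref_pt 5 else ref_pt n)"

lemma five: "{1..5::nat} = {1, 2, 3, 4, 5}" by auto

lemma five_distinct:
  assumes "{i, j, k, l, m} = {1..5::nat}"
  shows "distinct [i, j, k, l, m]"
proof (rule card_distinct)
  have "set [i, j, k, l, m] = {1..5}" using assms by simp
  then show "card (set [i, j, k, l, m]) = length [i, j, k, l, m]" by simp
qed

lemma sum_five:
  fixes f :: "nat \<Rightarrow> 'a::ab_group_add"
  assumes "{i, j, k, l, m} = {1..5::nat}"
  shows "(\<Sum>n\<in>{1..5}. f n) = f i + f j + f k + f l + f m"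
  using five_distinct[OF assms] unfolding assms[symmetric] by (simp add: add.assoc)

lemma sum_one_five: "(\<Sum>n\<in>{1..5::nat}. f n) = f 1 + f 2 + f 3 + f 4 + (f 5 :: 'a::ab_group_add)"
  by (rule sum_five) auto

lemma zc_simps: "zc z 1 = z $ 1" "zc z (Suc 0) = z $ 1" "zc z 2 = z $ 2" "zc z 3 = z $ 3" "zc z 4 = z $ 4" "zc z 5 = 0"
  by (simp_all add: zc_def)

lemma ac_simps5: "ac z 1 = z $ 1" "ac z (Suc 0) = z $ 1" "ac z 2 = z $ 2" "ac z 3 = z $ 3" "ac z 4 = z $ 4" "ac z 5 = - asum z"
  by (simp_all add: ac_def zc_def)

lemma rp_simps: "rp 1 = vector [1,0,0,0]" "rp (Suc 0) = vector [1,0,0,0]" "rp 2 = vector [0,1,0,0]"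
  "rp 3 = vector [0,0,1,0]" "rp 4 = vector [0,0,0,1]" "rp 5 = - vector [1,1,1,1]"
  by (simp_all add: rp_def ref_pt_def)

lemma zc_linear: "zc (u + v) n = zc u n + zc v n" "zc (u - v) n = zc u n - zc v n" "zc (c *s u) n = c * zc u n" "zc (- u) n = - zc u n" "zc 0 n = 0"
  by (simp_all add: zc_def)

lemma zc_rp: "n \<in> {1..5} \<Longrightarrow> p \<in> {1..5} \<Longrightarrow> zc (rp n) p = (if n = p then 1 else 0) - (if n = 5 then 1 else 0)"
  unfolding five by (auto simp: rp_simps zc_simps zc_linear vector_4)

lemma sum_ac: "(\<Sum>n\<in>{1..5}. ac \<alpha> n) = 0"
  unfolding sum_one_five by (simp add: ac_simps5 asum_def)

lemma ac_nonzero: "nondeg \<alpha> \<Longrightarrow> n \<in> {1..5} \<Longrightarrow> ac \<alpha> n \<noteq> 0"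
  unfolding five by (auto simp: nondeg_def ac_simps5)

lemma plane_ac: "z \<in> plane \<alpha> \<longleftrightarrow> (\<Sum>n\<in>{1..5}. ac \<alpha> n * zc z n) = 0"
  unfolding sum_one_five by (simp add: plane_def sum_4 ac_simps5 zc_simps)

lemma wdot_ac: "wdot \<alpha> u v = (\<Sum>n\<in>{1..5}. ac \<alpha> n * zc u n * zc v n)"
  unfolding sum_one_five by (simp add: wdot_4 ac_simps5 zc_simps)

text \<open>The constant \<open>c\<close> is free because the \<open>rp\<close> sum to 0; choosing
  it as one of the coordinates removes that term.\<close>

lemma rp_expand:
  assumes "{i, j, k, l, m} = {1..5::nat}"
  shows "z = (zc z i - c) *s rp i + (zc z j - c) *s rp j + (zc z k - c) *s rp k + (zc z l - c) *s rp l + (zc z m - c) *s rp m"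
proof -
  have "(\<Sum>n\<in>{1..5}. (zc z n - c) *s rp n) = z"
    unfolding sum_one_five by (simp add: vec_eq_iff forall_4 zc_simps rp_simps vector_4)
  then show ?thesis unfolding sum_five[OF assms] by simp
qed

lemma sum_rp:
  assumes "{i, j, k, l, m} = {1..5::nat}"
  shows "rp i + rp j + rp k + rp l + rp m = 0"
proof -
  have "(\<Sum>n\<in>{1..5}. rp n) = 0" unfolding sum_one_five by (simp add: vec_eq_iff forall_4 rp_simps vector_4)
  then show ?thesis unfolding sum_five[OF assms] .
qed

lemma span_two: "v \<in> vec.span {a, b} \<longleftrightarrow> (\<exists>x y. v = x *s a + y *s b)"
  by (auto simp: vec.span_breakdown_eq algebra_simps)

lemma span_three: "v \<in> vec.span {a, b, c} \<longleftrightarrow> (\<exists>x y z. v = x *s a + y *s b + z *s c)"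
  by (auto simp: vec.span_breakdown_eq algebra_simps)

lemma rp_ref_pt: "\<exists>e. e * e = 1 \<and> (\<forall>x. x *s ref_pt n = (x * e) *s rp n) \<and> (\<forall>x. x *s rp n = (x * e) *s ref_pt n)"
proof (cases "n = 5")
  case True
  then show ?thesis by (intro exI[of _ "- 1"]) (auto simp: rp_def)
next
  case False
  then show ?thesis by (intro exI[of _ 1]) (auto simp: rp_def)
qed

lemma span_rp2: "v \<in> vec.span {ref_pt i, ref_pt j} \<longleftrightarrow> (\<exists>x y. v = x *s rp i + y *s rp j)"
proof -
  obtain e f where "\<forall>x. x *s ref_pt i = (x * e) *s rp i" "\<forall>x. x *s rp i = (x * e) *s ref_pt i"
    "\<forall>x. x *s ref_pt j = (x * f) *s rp j" "\<forall>x. x *s rp j = (x * f) *s ref_pt j"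
    using rp_ref_pt by metis
  then show ?thesis unfolding span_two by metis
qed

lemma span_rp3: "v \<in> vec.span {ref_pt i, ref_pt j, ref_pt k} \<longleftrightarrow> (\<exists>x y z. v = x *s rp i + y *s rp j + z *s rp k)"
proof -
  obtain e f g where "\<forall>x. x *s ref_pt i = (x * e) *s rp i" "\<forall>x. x *s rp i = (x * e) *s ref_pt i"
    "\<forall>x. x *s ref_pt j = (x * f) *s rp j" "\<forall>x. x *s rp j = (x * f) *s ref_pt j"
    "\<forall>x. x *s ref_pt k = (x * g) *s rp k" "\<forall>x. x *s rp k = (x * g) *s ref_pt k"
    using rp_ref_pt by metis
  then show ?thesis unfolding span_three by metis
qed

lemma five_mem: "{i, j, k, l, m} = {1..5::nat} \<Longrightarrow> i \<in> {1..5} \<and> j \<in> {1..5} \<and> k \<in> {1..5} \<and> l \<in> {1..5} \<and> m \<in> {1..5}"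
  by blast

lemma zc_rp_diff: "n \<in> {1..5} \<Longrightarrow> p \<in> {1..5} \<Longrightarrow> q \<in> {1..5} \<Longrightarrow>
    zc (rp n) p - zc (rp n) q = (if n = p then 1 else 0) - (if n = q then 1 else 0)"
  by (simp add: zc_rp)

lemma span_rp2_iff:
  assumes "{i, j, k, l, m} = {1..5::nat}"
  shows "v \<in> vec.span {ref_pt i, ref_pt j} \<longleftrightarrow> zc v k = zc v l \<and> zc v l = zc v m"
proof
  note d = five_distinct[OF assms] five_mem[OF assms]
  assume "v \<in> vec.span {ref_pt i, ref_pt j}"
  then obtain x y where v: "v = x *s rp i + y *s rp j" unfolding span_rp2 by blast
  have "zc v p - zc v q = 0" if "p \<in> {k, l, m}" "q \<in> {k, l, m}" for p q
  proof -
    have "zc v p - zc v q = x * (zc (rp i) p - zc (rp i) q) + y * (zc (rp j) p - zc (rp j) q)"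
      by (simp add: v zc_linear algebra_simps)
    also have "\<dots> = 0" using that d by (subst zc_rp_diff; (subst zc_rp_diff)?) auto
    finally show ?thesis .
  qed
  from this[of k l] this[of l m] show "zc v k = zc v l \<and> zc v l = zc v m" by simp
next
  assume "zc v k = zc v l \<and> zc v l = zc v m"
  then have "v = (zc v i - zc v k) *s rp i + (zc v j - zc v k) *s rp j"
    using rp_expand[OF assms, of v "zc v k"] by simp
  then show "v \<in> vec.span {ref_pt i, ref_pt j}" unfolding span_rp2 by blast
qed

lemma span_rp3_iff:
  assumes "{i, j, k, l, m} = {1..5::nat}"
  shows "v \<in> vec.span {ref_pt i, ref_pt j, ref_pt k} \<longleftrightarrow> zc v l = zc v m"
proof
  note d = five_distinct[OF assms] five_mem[OF assms]
  assume "v \<in> vec.span {ref_pt i, ref_pt j, ref_pt k}"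
  then obtain x y z where v: "v = x *s rp i + y *s rp j + z *s rp k" unfolding span_rp3 by blast
  have "zc v l - zc v m = x * (zc (rp i) l - zc (rp i) m) + y * (zc (rp j) l - zc (rp j) m) + z * (zc (rp k) l - zc (rp k) m)"
    by (simp add: v zc_linear algebra_simps)
  moreover have "zc (rp i) l - zc (rp i) m = 0" "zc (rp j) l - zc (rp j) m = 0" "zc (rp k) l - zc (rp k) m = 0"
    using d by (auto simp: zc_rp)
  ultimately show "zc v l = zc v m" by simp
next
  assume "zc v l = zc v m"
  then have "v = (zc v i - zc v l) *s rp i + (zc v j - zc v l) *s rp j + (zc v k - zc v l) *s rp k"
    using rp_expand[OF assms, of v "zc v l"] by simp
  then show "v \<in> vec.span {ref_pt i, ref_pt j, ref_pt k}" unfolding span_rp3 by blast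
qed

text \<open>The point \<open>p\<^bsub>ij\<^esub>\<close>, as a vector.\<close>

definition dpt :: "complex^4 \<Rightarrow> nat \<Rightarrow> nat \<Rightarrow> complex^4" where
  "dpt \<alpha> i j = ac \<alpha> j *s rp i - ac \<alpha> i *s rp j"

lemma sum_ac_zc_rp: "n \<in> {1..5} \<Longrightarrow> (\<Sum>p\<in>{1..5}. ac \<alpha> p * zc (rp n) p) = ac \<alpha> n"
proof -
  assume n: "n \<in> {1..5}"
  have "(\<Sum>p\<in>{1..5}. ac \<alpha> p * zc (rp n) p) = (\<Sum>p\<in>{1..5}. (if n = p then ac \<alpha> p else 0) - ac \<alpha> p * (if n = 5 then 1 else 0))"
    using n by (intro sum.cong) (simp_all add: zc_rp algebra_simps)
  also have "\<dots> = ac \<alpha> n - (\<Sum>p\<in>{1..5}. ac \<alpha> p) * (if n = 5 then 1 else 0)"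
    using n unfolding sum_subtractf sum_distrib_right[symmetric] by (simp only: sum.delta' finite_atLeastAtMost if_True)
  finally show ?thesis unfolding sum_ac by simp
qed

text \<open>For \<open>n = 5\<close> the vector \<open>rp 5\<close> shifts all coordinates, and the
  plane equation of \<open>v\<close> cancels the effect.\<close>

lemma wdot_rp:
  assumes "n \<in> {1..5}" "v \<in> plane \<alpha>"
  shows "wdot \<alpha> (rp n) v = ac \<alpha> n * (zc v n)"
proof -
  have "wdot \<alpha> (rp n) v = (\<Sum>p\<in>{1..5}. (if n = p then ac \<alpha> p * zc v p else 0) - ac \<alpha> p * zc v p * (if n = 5 then 1 else 0))"
    unfolding wdot_ac using assms(1) by (intro sum.cong) (simp_all add: zc_rp algebra_simps)
  also have "\<dots> = ac \<alpha> n * zc v n - (\<Sum>p\<in>{1..5}. ac \<alpha> p * zc v p) * (if n = 5 then 1 else 0)"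
    using assms(1) unfolding sum_subtractf sum_distrib_right[symmetric] by (simp only: sum.delta' finite_atLeastAtMost if_True)
  finally show ?thesis using assms(2) unfolding plane_ac by simp
qed

lemma plane_subspace: "vec.subspace (plane \<alpha>)"
proof -
  have "wdot \<alpha> 1 0 = 0" by (simp add: wdot_4)
  then show ?thesis by (auto simp: vec.subspace_def plane_wdot wdot_linear)
qed

lemma plane_comb:
  assumes "n \<in> {1..5}" "p \<in> {1..5}"
  shows "x *s rp n + y *s rp p \<in> plane \<alpha> \<longleftrightarrow> x * ac \<alpha> n + y * ac \<alpha> p = 0"
proof -
  have "(\<Sum>r\<in>{1..5}. ac \<alpha> r * zc (x *s rp n + y *s rp p) r)
    = x * (\<Sum>r\<in>{1..5}. ac \<alpha> r * zc (rp n) r) + y * (\<Sum>r\<in>{1..5}. ac \<alpha> r * zc (rp p) r)"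
    by (simp add: zc_linear sum_distrib_left sum.distrib algebra_simps)
  then show ?thesis unfolding plane_ac sum_ac_zc_rp[OF assms(1)] sum_ac_zc_rp[OF assms(2)] by simp
qed

lemma dpt_in_plane:
  assumes "i \<in> {1..5}" "j \<in> {1..5}"
  shows "dpt \<alpha> i j \<in> plane \<alpha>"
  using plane_comb[OF assms, of "ac \<alpha> j" "- ac \<alpha> i" \<alpha>] by (simp add: dpt_def)

lemma dpt_in_span: "dpt \<alpha> i j \<in> vec.span {ref_pt i, ref_pt j}"
proof -
  have "dpt \<alpha> i j = ac \<alpha> j *s rp i + (- ac \<alpha> i) *s rp j" by (simp add: dpt_def)
  then show ?thesis unfolding span_rp2 by blast
qed

lemma desargues_point_eq:
  assumes nd: "nondeg \<alpha>" and ij: "i \<in> {1..5}" "j \<in> {1..5}"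
  shows "desargues_point (plane \<alpha>) i j = {c *s dpt \<alpha> i j | c. True}"
proof
  show "desargues_point (plane \<alpha>) i j \<subseteq> {c *s dpt \<alpha> i j | c. True}"
  proof
    fix v assume "v \<in> desargues_point (plane \<alpha>) i j"
    then obtain x y where v: "v = x *s rp i + y *s rp j" "v \<in> plane \<alpha>"
      unfolding desargues_point_def Int_iff span_rp2 by blast
    have "x * ac \<alpha> i + y * ac \<alpha> j = 0" using plane_comb[OF ij] v by blast
    then have "y = - (x / ac \<alpha> j) * ac \<alpha> i" "x = (x / ac \<alpha> j) * ac \<alpha> j"
      using ac_nonzero[OF nd ij(2)] by (simp_all add: field_simps add_eq_0_iff2)
    then have "v = (x / ac \<alpha> j) *s dpt \<alpha> i j"
      unfolding v(1) dpt_def by (simp add: vec_eq_iff algebra_simps)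
    then show "v \<in> {c *s dpt \<alpha> i j | c. True}" by blast
  qed
  show "{c *s dpt \<alpha> i j | c. True} \<subseteq> desargues_point (plane \<alpha>) i j"
    unfolding desargues_point_def using dpt_in_span dpt_in_plane[OF ij]
    by (auto intro: vec.span_scale vec.subspace_scale[OF plane_subspace])
qed

text \<open>So the polar of p_ij is the line z_i = z_j, which is also the trace of the plane through
  the other three reference points.\<close>

lemma wdot_dpt:
  assumes "i \<in> {1..5}" "j \<in> {1..5}" "v \<in> plane \<alpha>"
  shows "wdot \<alpha> (dpt \<alpha> i j) v = ac \<alpha> i * ac \<alpha> j * (zc v i - zc v j)"
  using assms by (simp add: dpt_def wdot_linear wdot_rp algebra_simps)

definition diag_form :: "complex^4 \<Rightarrow> complex^4^4" where
  "diag_form \<alpha> = (\<chi> i j. if i = j then \<alpha> $ i else 0)"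

lemma bform_diag: "bform (diag_form \<alpha>) u v = wdot \<alpha> u v"
  by (simp add: bform_def diag_form_def wdot_def if_distrib if_distribR sum.delta cong: if_cong)

lemma polar_dpt:
  assumes nd: "nondeg \<alpha>" and idx: "{i, j, k, l, m} = {1..5::nat}"
    and c: "\<And>u v. u \<in> plane \<alpha> \<Longrightarrow> v \<in> plane \<alpha> \<Longrightarrow> bform B u v = wdot \<alpha> u v"
  shows "polar_line (plane \<alpha>) B (desargues_point (plane \<alpha>) i j) = desargues_line (plane \<alpha>) k l m"
proof -
  note mem = five_mem[OF idx]
  have idx': "{k, l, m, i, j} = {1..5::nat}" using idx by blast
  have nz: "ac \<alpha> i \<noteq> 0" "ac \<alpha> j \<noteq> 0" using ac_nonzero[OF nd] mem by blast+
  have "(\<forall>u\<in>desargues_point (plane \<alpha>) i j. bform B u v = 0) \<longleftrightarrow> zc v i = zc v j" if v: "v \<in> plane \<alpha>" for v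
  proof -
    have "(\<forall>u\<in>desargues_point (plane \<alpha>) i j. bform B u v = 0) \<longleftrightarrow> (\<forall>x. wdot \<alpha> (x *s dpt \<alpha> i j) v = 0)"
      unfolding desargues_point_eq[OF nd conjunct1[OF mem] conjunct1[OF conjunct2[OF mem]]]
      using c v mem dpt_in_plane[of i j \<alpha>] vec.subspace_scale[OF plane_subspace] by auto
    also have "\<dots> \<longleftrightarrow> wdot \<alpha> (dpt \<alpha> i j) v = 0" by (auto simp: wdot_linear)
    also have "\<dots> \<longleftrightarrow> zc v i = zc v j" using wdot_dpt[of i j v \<alpha>] mem v nz by simp
    finally show ?thesis .
  qed
  then show ?thesis
    unfolding polar_line_def desargues_line_def using span_rp3_iff[OF idx'] by blast
qed

lemma von_staudt_diag:
  assumes nd: "nondeg \<alpha>"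
  shows "von_staudt_conic (plane \<alpha>) (diag_form \<alpha>)"
proof -
  have "transpose (diag_form \<alpha>) = diag_form \<alpha>" by (auto simp: transpose_def diag_form_def vec_eq_iff)
  moreover have "u = 0" if u: "u \<in> plane \<alpha>" "\<forall>v\<in>plane \<alpha>. bform (diag_form \<alpha>) u v = 0" for u
  proof -
    have "zc u n = 0" if n: "n \<in> {1..5}" for n
    proof -
      \<comment> \<open>As the fifth coordinate is 0, pairing with p_n5 isolates the coordinate
        \<open>zc u n\<close>.\<close>
      have "wdot \<alpha> (dpt \<alpha> n 5) u = 0"
        using u(2) dpt_in_plane[OF n, of 5 \<alpha>] unfolding bform_diag wdot_sym[of \<alpha> u] by simp
      then show ?thesis using wdot_dpt[OF n, of 5 u \<alpha>] u(1) ac_nonzero[OF nd, of n] ac_nonzero[OF nd, of 5] n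
        by (simp add: zc_simps)
    qed
    from this[of 1] this[of 2] this[of 3] this[of 4] show "u = 0"
      by (simp add: vec_eq_iff forall_4 zc_simps)
  qed
  ultimately show ?thesis
    unfolding von_staudt_conic_def smooth_conic_def using polar_dpt[OF nd] bform_diag by blast
qed

lemma bform_linear:
  "bform B (u + v) w = bform B u w + bform B v w" "bform B (u - v) w = bform B u w - bform B v w"
  "bform B (c *s u) w = c * bform B u w"
  "bform B w (u + v) = bform B w u + bform B w v" "bform B w (u - v) = bform B w u - bform B w v"
  "bform B w (c *s u) = c * bform B w u"
  by (simp_all add: bform_def sum_4 algebra_simps)

lemma bform_sym:
  assumes "transpose B = B"
  shows "bform B u v = bform B v u"
proof -
  have B: "B $ i $ j = B $ j $ i" for i j
  proof -
    have "transpose B $ i $ j = B $ j $ i" by (simp add: transpose_def)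
    then show ?thesis unfolding assms .
  qed
  have e: "B $ i $ j * u $ i * v $ j = B $ j $ i * v $ j * u $ i" for i j
    unfolding B[of i j] by (simp only: mult_ac)
  show ?thesis unfolding bform_def e by (rule sum.swap)
qed

text \<open>
  In terms of the vectors \<open>w\<^sub>n\<close> of the points \<open>p\<^bsub>n5\<^esub>\<close>, the polarities make all \<open>B(w\<^sub>j, w\<^sub>l)\<close>
  with \<open>j \<noteq> l\<close> equal, and \<open>\<Sum> \<alpha>\<^sub>n w\<^sub>n = 0\<close> then determines the \<open>B(w\<^sub>n, w\<^sub>n)\<close>.
\<close>

lemma von_staudt_unique:
  assumes nd: "nondeg \<alpha>" and vs: "von_staudt_conic (plane \<alpha>) B"
  shows "\<exists>c. c \<noteq> 0 \<and> (\<forall>u\<in>plane \<alpha>. \<forall>v\<in>plane \<alpha>. bform B u v = c * wdot \<alpha> u v)"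
proof -
  let ?a = "ac \<alpha>"
  have sym: "bform B u v = bform B v u" for u v
    using vs bform_sym unfolding von_staudt_conic_def smooth_conic_def by blast
  define w where "w = (\<lambda>n. (1 / (?a n * ?a 5)) *s dpt \<alpha> n 5)"
  have nz: "?a n \<noteq> 0" if "n \<in> {1..5}" for n using ac_nonzero[OF nd that] .
  have w: "w n = (1 / ?a n) *s rp n - (1 / ?a 5) *s rp 5" if "n \<in> {1..5}" for n
    using nz[OF that] nz[of 5] by (simp add: w_def dpt_def vec_eq_iff field_simps)
  have wi: "?a n * w n $ i = rp n $ i - ?a n * (rp 5 $ i / ?a 5)" if "n \<in> {1..4}" for n i
  proof -
    have "w n $ i = rp n $ i / ?a n - rp 5 $ i / ?a 5" by (subst w) (use that in simp_all)
    then show ?thesis using nz[of n] that by (simp add: right_diff_distrib)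
  qed
  have wi: "?a 1 * w 1 $ i = rp 1 $ i - ?a 1 * (rp 5 $ i / ?a 5)"
    "?a 2 * w 2 $ i = rp 2 $ i - ?a 2 * (rp 5 $ i / ?a 5)"
    "?a 3 * w 3 $ i = rp 3 $ i - ?a 3 * (rp 5 $ i / ?a 5)"
    "?a 4 * w 4 $ i = rp 4 $ i - ?a 4 * (rp 5 $ i / ?a 5)" for i
    by (rule wi, simp)+
  have wp: "w n \<in> plane \<alpha>" if "n \<in> {1..5}" for n
    unfolding w_def using dpt_in_plane[OF that, of 5 \<alpha>] vec.subspace_scale[OF plane_subspace] by simp
  \<comment> \<open>The difference \<open>w j - w k\<close> represents p_jk, and \<open>w l\<close>
    lies on the line with indices l, m, 5, which is its polar.\<close>
  have pol: "bform B (w j) (w l) = bform B (w k) (w l)" if idx: "{j, k, l, m, 5} = {1..5::nat}" for j k l m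
  proof -
    note mem = five_mem[OF idx]
    have "w l \<in> vec.span {ref_pt l, ref_pt m, ref_pt 5}"
    proof -
      have "w l = (1 / ?a l) *s rp l + 0 *s rp m + (- (1 / ?a 5)) *s rp 5" using w[of l] mem by simp
      then show ?thesis unfolding span_rp3 by blast
    qed
    then have "w l \<in> desargues_line (plane \<alpha>) l m 5"
      unfolding desargues_line_def using wp mem by blast
    then have "w l \<in> polar_line (plane \<alpha>) B (desargues_point (plane \<alpha>) j k)"
      using vs idx unfolding von_staudt_conic_def by blast
    moreover have "w j - w k \<in> desargues_point (plane \<alpha>) j k"
    proof -
      have "w j - w k = (1 / ?a j) *s rp j + (- (1 / ?a k)) *s rp k" using w mem by simp
      then have "w j - w k \<in> vec.span {ref_pt j, ref_pt k}" unfolding span_rp2 by blast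
      then show ?thesis unfolding desargues_point_def using wp mem vec.subspace_diff[OF plane_subspace] by blast
    qed
    ultimately have "bform B (w j - w k) (w l) = 0" unfolding polar_line_def by blast
    then show ?thesis by (simp add: bform_linear)
  qed
  define \<beta> where "\<beta> = bform B (w 1) (w 2)"
  have idx: "{1, 3, 2, 4, 5} = {1..5::nat}" "{1, 4, 2, 3, 5} = {1..5::nat}" "{1, 2, 3, 4, 5} = {1..5::nat}"
     "{1, 2, 4, 3, 5} = {1..5::nat}" "{1, 3, 4, 2, 5} = {1..5::nat}" by auto
  have b: "bform B (w 1) (w 2) = \<beta>" "bform B (w 2) (w 1) = \<beta>" "bform B (w 3) (w 2) = \<beta>" "bform B (w 2) (w 3) = \<beta>"
    "bform B (w 4) (w 2) = \<beta>" "bform B (w 2) (w 4) = \<beta>" "bform B (w 1) (w 3) = \<beta>" "bform B (w 3) (w 1) = \<beta>"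
    "bform B (w 1) (w 4) = \<beta>" "bform B (w 4) (w 1) = \<beta>" "bform B (w 3) (w 4) = \<beta>" "bform B (w 4) (w 3) = \<beta>"
    using pol[OF idx(1)] pol[OF idx(2)] pol[OF idx(3)] pol[OF idx(4)] pol[OF idx(5)] sym \<beta>_def by metis+
  have rp5: "rp 5 = - (rp 1 + rp 2 + rp 3 + rp 4)"
    using sum_rp[OF idx(3)] by (simp only: add_eq_0_iff)
  have a5: "?a 5 = - (?a 1 + ?a 2 + ?a 3 + ?a 4)" using sum_ac[of \<alpha>] unfolding sum_one_five
    by (simp only: add_eq_0_iff)
  have z: "z = (?a 1 * zc z 1) *s w 1 + (?a 2 * zc z 2) *s w 2 + (?a 3 * zc z 3) *s w 3 + (?a 4 * zc z 4) *s w 4"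
    (is "z = ?r") if zp: "z \<in> plane \<alpha>" for z
  proof -
    have "?r = zc z 1 *s rp 1 + zc z 2 *s rp 2 + zc z 3 *s rp 3 + zc z 4 *s rp 4
        - ((?a 1 * zc z 1 + ?a 2 * zc z 2 + ?a 3 * zc z 3 + ?a 4 * zc z 4) / ?a 5) *s rp 5"
      unfolding vec_eq_iff
    proof
      fix i
      show "?r $ i = (zc z 1 *s rp 1 + zc z 2 *s rp 2 + zc z 3 *s rp 3 + zc z 4 *s rp 4
        - ((?a 1 * zc z 1 + ?a 2 * zc z 2 + ?a 3 * zc z 3 + ?a 4 * zc z 4) / ?a 5) *s rp 5) $ i"
        unfolding vector_add_component vector_minus_component vector_smult_component times_divide_eq_left
          times_divide_eq_right[symmetric]
        using wi[of i] by algebra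
    qed
    also have "?a 1 * zc z 1 + ?a 2 * zc z 2 + ?a 3 * zc z 3 + ?a 4 * zc z 4 = 0"
      using zp unfolding plane_ac sum_one_five by (simp add: zc_simps)
    also have "zc z 1 *s rp 1 + zc z 2 *s rp 2 + zc z 3 *s rp 3 + zc z 4 *s rp 4 - (0 / ?a 5) *s rp 5 = z"
      using rp_expand[OF idx(3), of z 0] by (simp add: zc_simps)
    finally show ?thesis by simp
  qed
  have sw: "?a 1 *s w 1 + ?a 2 *s w 2 + ?a 3 *s w 3 + ?a 4 *s w 4 = 0"
  proof -
    have n: "?a 1 \<noteq> 0" "?a 2 \<noteq> 0" "?a 3 \<noteq> 0" "?a 4 \<noteq> 0" "?a 5 \<noteq> 0" using nz by simp_all
    have "?a 1 *s w 1 + ?a 2 *s w 2 + ?a 3 *s w 3 + ?a 4 *s w 4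
       = rp 1 + rp 2 + rp 3 + rp 4 - ((?a 1 + ?a 2 + ?a 3 + ?a 4) / ?a 5) *s rp 5"
      unfolding vec_eq_iff
    proof
      fix i
      show "(?a 1 *s w 1 + ?a 2 *s w 2 + ?a 3 *s w 3 + ?a 4 *s w 4) $ i
       = (rp 1 + rp 2 + rp 3 + rp 4 - ((?a 1 + ?a 2 + ?a 3 + ?a 4) / ?a 5) *s rp 5) $ i"
        unfolding vector_add_component vector_minus_component vector_smult_component times_divide_eq_left
          times_divide_eq_right[symmetric]
        using wi[of i] by algebra
    qed
    also have "(?a 1 + ?a 2 + ?a 3 + ?a 4) / ?a 5 = - 1"
      using n(5) unfolding a5 by (simp add: divide_eq_minus_1_iff) 
    finally show ?thesis unfolding rp5 by simp
  qed
  define s where "s = ?a 1 + ?a 2 + ?a 3 + ?a 4"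
  have "bform B (?a 1 *s w 1 + ?a 2 *s w 2 + ?a 3 *s w 3 + ?a 4 *s w 4) v = 0" for v
    unfolding sw by (simp add: bform_def)
  from this[of "w 1"] this[of "w 2"] this[of "w 3"] this[of "w 4"]
  have bb: "?a 1 * bform B (w 1) (w 1) = \<beta> * ?a 1 - \<beta> * s" "?a 2 * bform B (w 2) (w 2) = \<beta> * ?a 2 - \<beta> * s"
    "?a 3 * bform B (w 3) (w 3) = \<beta> * ?a 3 - \<beta> * s" "?a 4 * bform B (w 4) (w 4) = \<beta> * ?a 4 - \<beta> * s"
    unfolding bform_linear b s_def by algebra+
  have main: "bform B u v = - \<beta> * s * wdot \<alpha> u v" if uv: "u \<in> plane \<alpha>" "v \<in> plane \<alpha>" for u v
  proof -
    define p q where "p = zc u" and "q = zc v"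
    have "bform B u v = bform B ((?a 1 * p 1) *s w 1 + (?a 2 * p 2) *s w 2 + (?a 3 * p 3) *s w 3 + (?a 4 * p 4) *s w 4)
       ((?a 1 * q 1) *s w 1 + (?a 2 * q 2) *s w 2 + (?a 3 * q 3) *s w 3 + (?a 4 * q 4) *s w 4)"
      unfolding p_def q_def using z[OF uv(1)] z[OF uv(2)] by simp
    also have "\<dots> = \<beta> * (?a 1 * p 1 + ?a 2 * p 2 + ?a 3 * p 3 + ?a 4 * p 4) * (?a 1 * q 1 + ?a 2 * q 2 + ?a 3 * q 3 + ?a 4 * q 4)
       - \<beta> * s * (?a 1 * p 1 * q 1 + ?a 2 * p 2 * q 2 + ?a 3 * p 3 * q 3 + ?a 4 * p 4 * q 4)"
      unfolding bform_linear b using bb by algebra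
    also have "?a 1 * p 1 + ?a 2 * p 2 + ?a 3 * p 3 + ?a 4 * p 4 = 0"
      using uv(1) unfolding plane_ac sum_one_five by (simp add: zc_simps p_def)
    also have "?a 1 * p 1 * q 1 + ?a 2 * p 2 * q 2 + ?a 3 * p 3 * q 3 + ?a 4 * p 4 * q 4 = wdot \<alpha> u v"
      unfolding wdot_ac sum_one_five by (simp add: zc_simps p_def q_def)
    finally show ?thesis by simp
  qed
  \<comment> \<open>With constant 0 the form would vanish on the plane, and p_12 would be a nonzero
    vector in its radical.\<close>
  have "- \<beta> * s \<noteq> 0"
  proof
    assume "- \<beta> * s = 0"
    then have "\<forall>v\<in>plane \<alpha>. bform B (dpt \<alpha> 1 2) v = 0" using main dpt_in_plane[of 1 2 \<alpha>] by simp
    then have "dpt \<alpha> 1 2 = 0" using vs dpt_in_plane[of 1 2 \<alpha>] unfolding von_staudt_conic_def smooth_conic_def by simp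
    then have "dpt \<alpha> 1 2 $ 1 = 0" by simp
    then show False using nz[of 2] by (simp add: dpt_def rp_simps vector_4)
  qed
  then show ?thesis using main by blast
qed


section \<open>Parametrizations of the von Staudt conic\<close>

lemma span_one: "v \<in> vec.span {a} \<longleftrightarrow> (\<exists>x. v = x *s a)"
  by (auto simp: vec.span_breakdown_eq)

lemma span_one_scale: "c \<noteq> 0 \<Longrightarrow> vec.span {c *s v} = vec.span {v}"
  for v :: "complex^'n"
proof -
  assume c: "c \<noteq> 0"
  have "v = (1 / c) *s (c *s v)" using c by simp
  then have "v \<in> vec.span {c *s v}" unfolding span_one by blast
  then have "vec.span {v} \<subseteq> vec.span {c *s v}" by (intro vec.span_minimal) auto
  moreover have "vec.span {c *s v} \<subseteq> vec.span {v}"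
    by (intro vec.span_minimal) (auto simp: span_one)
  ultimately show ?thesis by blast
qed

lemma parametrization_on_conic:
  assumes nd: "nondeg \<alpha>" and vs: "von_staudt_conic (plane \<alpha>) B" and cp: "conic_parametrization (plane \<alpha>) B \<phi>"
  shows "wdot \<alpha> 1 (\<phi> t) = 0 \<and> wdot \<alpha> (\<phi> t) (\<phi> t) = 0"
proof (cases "t = 0")
  case True
  \<comment> \<open>The bijection concerns nonzero \<open>t\<close> only; at 0 homogeneity gives the
    value.\<close>
  have "\<phi> 0 $ k = 0" for k
  proof -
    obtain a b c where "(\<lambda>t. \<phi> t $ k) = qd a b c"
      using cp binary_forms_2_iff unfolding conic_parametrization_def by blast
    from fun_cong[OF this, of 0] show ?thesis by (simp add: qd_def)
  qed
  then show ?thesis unfolding True by (simp add: wdot_4)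
next
  case False
  let ?P = "vec.span (\<phi> ` vec.span {t})"
  have "vec.span {t} \<in> proj_points UNIV" using False unfolding proj_points_def by blast
  then have P: "?P \<in> conic_points (plane \<alpha>) B"
    using cp unfolding conic_parametrization_def by (blast dest: bij_betwE)
  then obtain v where v: "v \<in> plane \<alpha>" "?P = vec.span {v}" unfolding conic_points_def proj_points_def by blast
  have m: "\<phi> t \<in> ?P" by (intro vec.span_base imageI) (auto intro: vec.span_base)
  have "vec.span {v} \<subseteq> plane \<alpha>" using v(1) by (intro vec.span_minimal plane_subspace) auto
  then have pl: "\<phi> t \<in> plane \<alpha>" using m v(2) by blast
  have "bform B (\<phi> t) (\<phi> t) = 0" using P m unfolding conic_points_def by blast
  moreover obtain c where "c \<noteq> 0" "\<forall>u\<in>plane \<alpha>. \<forall>v\<in>plane \<alpha>. bform B u v = c * wdot \<alpha> u v"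
    using von_staudt_unique[OF nd vs] by blast
  ultimately show ?thesis using pl unfolding plane_wdot[symmetric] by auto
qed

lemma parametrization_frame:
  assumes nd: "nondeg \<alpha>" and fr: "frame \<alpha> \<nu> A B C" and vs: "von_staudt_conic (plane \<alpha>) M" and cp: "conic_parametrization (plane \<alpha>) M \<phi>"
  shows "\<exists>g :: complex^2^2. invertible g \<and> (\<forall>t. \<phi> t = quadmap A B C (g *v t))"
proof (rule frame_unique[OF nd fr])
  show "(\<lambda>t. \<phi> t $ k) \<in> binary_forms 2" for k using cp unfolding conic_parametrization_def by blast
  show "t \<noteq> 0 \<Longrightarrow> \<phi> t \<noteq> 0" for t using cp unfolding conic_parametrization_def by blast
  show "wdot \<alpha> 1 (\<phi> t) = 0" "wdot \<alpha> (\<phi> t) (\<phi> t) = 0" for t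
    using parametrization_on_conic[OF nd vs cp] by blast+
qed

lemma quadmap_expand: "quadmap A B C t = t $ 1 ^ 2 *s A + (t $ 1 * t $ 2) *s B + t $ 2 ^ 2 *s C"
  by (simp add: vec_eq_iff qd_def algebra_simps)

lemma quadmap_coords:
  assumes nd: "nondeg \<alpha>" and fr: "frame \<alpha> \<nu> A B C"
  shows "wdot \<alpha> (quadmap A B C t) C = \<nu> * t $ 1 ^ 2"
    "wdot \<alpha> (quadmap A B C t) B = - 2 * \<nu> * (t $ 1 * t $ 2)"
    "wdot \<alpha> (quadmap A B C t) A = \<nu> * t $ 2 ^ 2"
proof -
  have "gram \<alpha> \<nu> A B C" using frame_gram[OF nd] fr by blast
  then show "wdot \<alpha> (quadmap A B C t) C = \<nu> * t $ 1 ^ 2"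
    "wdot \<alpha> (quadmap A B C t) B = - 2 * \<nu> * (t $ 1 * t $ 2)"
    "wdot \<alpha> (quadmap A B C t) A = \<nu> * t $ 2 ^ 2"
    unfolding quadmap_expand wdot_linear gram_def
    by (simp_all add: wdot_sym[of \<alpha> B A] wdot_sym[of \<alpha> C A] wdot_sym[of \<alpha> C B])
qed

lemma proportional_span:
  fixes s t :: "complex^2"
  assumes "s \<noteq> 0" "t \<noteq> 0" "t $ 1 * s $ 2 = t $ 2 * s $ 1"
  shows "vec.span {t} = vec.span {s}"
proof -
  have "\<exists>d. t = d *s s"
  proof (cases "s $ 1 = 0")
    case True
    then have "s $ 2 \<noteq> 0" "t $ 1 = 0" using assms by (auto simp: vec2_eq)
    then show ?thesis using True by (intro exI[of _ "t $ 2 / s $ 2"]) (simp add: vec2_eq)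
  next
    case False
    then show ?thesis using assms(3) by (intro exI[of _ "t $ 1 / s $ 1"]) (simp add: vec2_eq field_simps)
  qed
  then obtain d where d: "t = d *s s" by blast
  then have "d \<noteq> 0" using assms(2) by auto
  then show ?thesis unfolding d by (rule span_one_scale)
qed

text \<open>Pairing with \<open>C\<close>, \<open>B\<close>, \<open>A\<close> recovers the monomials
  of degree 2 in \<open>t\<close> up to constants, hence \<open>t\<close> up to a scalar, so the map
  is injective. It is onto because an isotropic vector has coordinates with X Z = Y^2, and
  compatible square roots of X and Z give \<open>t\<close>.\<close>

lemma frame_parametrization:
  assumes nd: "nondeg \<alpha>" and fr: "frame \<alpha> \<nu> A B C"
  shows "conic_parametrization (plane \<alpha>) (diag_form \<alpha>) (quadmap A B C)"
proof -
  let ?\<phi> = "quadmap A B C"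
  have nu: "\<nu> \<noteq> 0" using fr by (simp add: frame_def)
  note co = quadmap_coords[OF nd fr]
  have w0: "wdot \<alpha> 0 v = 0" for v by (simp add: wdot_4)
  have nz: "?\<phi> t \<noteq> 0" if "t \<noteq> 0" for t
  proof
    assume "?\<phi> t = 0"
    then have "t $ 1 = 0" "t $ 2 = 0" using co(1)[of t] co(3)[of t] nu w0 by simp_all
    then show False using that by (simp add: vec2_eq)
  qed
  have im: "vec.span (?\<phi> ` vec.span {t}) = vec.span {?\<phi> t}" for t
  proof
    show "vec.span (?\<phi> ` vec.span {t}) \<subseteq> vec.span {?\<phi> t}"
    proof (intro vec.span_minimal subsetI vec.subspace_span)
      fix v assume "v \<in> ?\<phi> ` vec.span {t}"
      then obtain c where "v = ?\<phi> (c *s t)" unfolding span_one image_iff Bex_def by blast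
      then have "v = c ^ 2 *s ?\<phi> t" by (simp add: vec_eq_iff qd_def power2_eq_square algebra_simps)
      then show "v \<in> vec.span {?\<phi> t}" unfolding span_one by blast
    qed
    show "vec.span {?\<phi> t} \<subseteq> vec.span (?\<phi> ` vec.span {t})"
      by (intro vec.span_mono) (auto intro: vec.span_base)
  qed
  have cpts: "conic_points (plane \<alpha>) (diag_form \<alpha>) = {vec.span {v} | v. v \<in> plane \<alpha> \<and> v \<noteq> 0 \<and> wdot \<alpha> v v = 0}"
  proof -
    have "(\<forall>u\<in>vec.span {v}. bform (diag_form \<alpha>) u u = 0) \<longleftrightarrow> wdot \<alpha> v v = 0" for v
    proof -
      have "(\<forall>u\<in>vec.span {v}. bform (diag_form \<alpha>) u u = 0) \<longleftrightarrow> (\<forall>x. wdot \<alpha> (x *s v) (x *s v) = 0)"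
        unfolding Ball_def span_one bform_diag by blast
      also have "\<dots> \<longleftrightarrow> wdot \<alpha> v v = 0" unfolding wdot_linear by (auto dest: spec[of _ 1])
      finally show ?thesis .
    qed
    then show ?thesis unfolding conic_points_def proj_points_def by auto
  qed
  have inj: "inj_on (\<lambda>L. vec.span (?\<phi> ` L)) (proj_points UNIV)"
  proof (rule inj_onI)
    fix L L' assume "L \<in> proj_points UNIV" "L' \<in> proj_points UNIV" and eq: "vec.span (?\<phi> ` L) = vec.span (?\<phi> ` L')"
    then obtain t s where L: "L = vec.span {t}" "t \<noteq> 0" "L' = vec.span {s}" "s \<noteq> 0" unfolding proj_points_def by blast
    have "?\<phi> t \<in> vec.span {?\<phi> s}" using eq unfolding L im by (metis vec.span_base insertI1)
    then obtain c where c: "?\<phi> t = c *s ?\<phi> s" unfolding span_one by blast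
    have "\<nu> * t $ 1 ^ 2 = \<nu> * (c * s $ 1 ^ 2)" "\<nu> * (t $ 1 * t $ 2) = \<nu> * (c * (s $ 1 * s $ 2))" "\<nu> * t $ 2 ^ 2 = \<nu> * (c * s $ 2 ^ 2)"
      using co[of t] co[of s] unfolding c wdot_linear by algebra+
    then have "t $ 1 ^ 2 = c * s $ 1 ^ 2" "t $ 1 * t $ 2 = c * (s $ 1 * s $ 2)" "t $ 2 ^ 2 = c * s $ 2 ^ 2"
      using nu by simp_all
    then have "(t $ 1 * s $ 2 - t $ 2 * s $ 1) ^ 2 = 0" by algebra
    then have "t $ 1 * s $ 2 = t $ 2 * s $ 1" by simp
    then show "L = L'" unfolding L using proportional_span L by blast
  qed
  have surj: "(\<lambda>L. vec.span (?\<phi> ` L)) ` proj_points UNIV = conic_points (plane \<alpha>) (diag_form \<alpha>)"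
  proof
    show "(\<lambda>L. vec.span (?\<phi> ` L)) ` proj_points UNIV \<subseteq> conic_points (plane \<alpha>) (diag_form \<alpha>)"
    proof
      fix P assume "P \<in> (\<lambda>L. vec.span (?\<phi> ` L)) ` proj_points UNIV"
      then obtain t where t: "P = vec.span {?\<phi> t}" "t \<noteq> 0" unfolding proj_points_def using im by blast
      then show "P \<in> conic_points (plane \<alpha>) (diag_form \<alpha>)"
        unfolding cpts plane_wdot using frame_on_conic[OF nd fr] nz by blast
    qed
    show "conic_points (plane \<alpha>) (diag_form \<alpha>) \<subseteq> (\<lambda>L. vec.span (?\<phi> ` L)) ` proj_points UNIV"
    proof
      fix P assume "P \<in> conic_points (plane \<alpha>) (diag_form \<alpha>)"
      then obtain v where v: "P = vec.span {v}" "wdot \<alpha> 1 v = 0" "v \<noteq> 0" "wdot \<alpha> v v = 0"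
        unfolding cpts plane_wdot by blast
      define X Y Z where X: "X = wdot \<alpha> v C / \<nu>" and Y: "Y = - wdot \<alpha> v B / (2 * \<nu>)" and Z: "Z = wdot \<alpha> v A / \<nu>"
      have e: "v = X *s A + Y *s B + Z *s C"
        using frame_expand[OF nd fr v(2)] by (simp add: vec_eq_iff X Y Z)
      have gr: "gram \<alpha> \<nu> A B C" using frame_gram[OF nd] fr by blast
      have "wdot \<alpha> v v = 2 * \<nu> * (X * Z - Y ^ 2)"
        using gr unfolding e wdot_linear gram_def
        by (simp add: wdot_sym[of \<alpha> B A] wdot_sym[of \<alpha> C A] wdot_sym[of \<alpha> C B] power2_eq_square algebra_simps)
      then have XZ: "X * Z = Y ^ 2" using v(4) nu by simp
      define l where "l = csqrt X"
      have l: "l * l = X" by (simp add: l_def flip: power2_eq_square)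
      obtain m where m: "l * m = Y" "m * m = Z"
      proof (cases "l = 0")
        case True
        then have "Y = 0" using XZ l by simp
        then show ?thesis using that[of "csqrt Z"] True by (simp flip: power2_eq_square)
      next
        case False
        have "Y / l * (Y / l) = Z" using XZ False unfolding l[symmetric] by (simp add: power2_eq_square field_simps)
        then show ?thesis using that[of "Y / l"] False by simp
      qed
      obtain t :: "complex^2" where t: "t $ 1 = l" "t $ 2 = m" using exists_vec2 by blast
      have vt: "v = ?\<phi> t" unfolding quadmap_expand t e using l m by (simp add: power2_eq_square)
      have "t \<noteq> 0"
      proof
        assume "t = 0"
        then have "v = 0" unfolding vt by (simp add: vec_eq_iff qd_def)
        then show False using v(3) by simp
      qed
      then have "vec.span {t} \<in> proj_points UNIV" unfolding proj_points_def by blast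
      moreover have "P = vec.span (?\<phi> ` vec.span {t})" using v(1) vt im by simp
      ultimately show "P \<in> (\<lambda>L. vec.span (?\<phi> ` L)) ` proj_points UNIV" by blast
    qed
  qed
  have "(\<lambda>t. ?\<phi> t $ k) \<in> binary_forms 2" for k
    using qd_in_forms[of "A $ k" "B $ k" "C $ k"] by simp
  then show ?thesis unfolding conic_parametrization_def bij_betw_def using nz inj surj by blast
qed

section \<open>The pencil of conics through four of the Desargues points\<close>

definition zdiff :: "nat \<Rightarrow> nat \<Rightarrow> complex^4" where
  "zdiff p q = (\<chi> r. zc (axis r 1) p - zc (axis r 1) q)"

lemma zdiff_sum: "(\<Sum>r\<in>UNIV. zdiff p q $ r * z $ r) = zc z p - zc z q"
  by (simp add: zdiff_def sum_4 zc_def axis_def)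

definition prod_form :: "complex^4 \<Rightarrow> complex^4 \<Rightarrow> complex^4^4" where
  "prod_form u v = (\<chi> r s. (u $ r * v $ s + u $ s * v $ r) / 2)"

lemma bform_prod_form: "bform (prod_form u v) z z = (\<Sum>r\<in>UNIV. u $ r * z $ r) * (\<Sum>r\<in>UNIV. v $ r * z $ r)"
  by (simp add: bform_def prod_form_def sum_4 field_simps)

text \<open>The pullback of the line pair z_j = z_k, z_l = z_m. Of the four points p_in, those with
  n in {l, m} lie on the first line and those with n in {j, k} on the second.\<close>

definition pencil_form :: "nat \<Rightarrow> nat \<Rightarrow> nat \<Rightarrow> nat \<Rightarrow> (complex^2 \<Rightarrow> complex^4) \<Rightarrow> complex^2 \<Rightarrow> complex" where
  "pencil_form j k l m \<phi> t = (zc (\<phi> t) j - zc (\<phi> t) k) * (zc (\<phi> t) l - zc (\<phi> t) m)"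

text \<open>The four points have vectors \<open>w\<close> with sum 0, three of which span the plane.
  A conic through those three has zero diagonal, and passing through the fourth forces its three
  remaining values to sum to 0; two parameters are left, and they are the coefficients of the two
  line pairs.\<close>

lemma restricted_pencil_eq:
  assumes nd: "nondeg \<alpha>" and pl: "\<And>t. \<phi> t \<in> plane \<alpha>" and idx: "{i, j, k, l, m} = {1..5::nat}"
  shows "restricted_pencil (plane \<alpha>) \<phi> i = form_pencil (pencil_form j k l m \<phi>) (pencil_form j l k m \<phi>)"
proof
  note d = five_distinct[OF idx] and mem = five_mem[OF idx]
  have idx': "{i, j, k, l, m} = {1..5::nat}" "{i, k, j, l, m} = {1..5::nat}" "{i, l, k, j, m} = {1..5::nat}" "{i, m, k, l, j} = {1..5::nat}"
    using idx by blast+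
  have sub: "{1..5} - {i} = {j, k, l, m}" using idx d by auto
  show "form_pencil (pencil_form j k l m \<phi>) (pencil_form j l k m \<phi>) \<subseteq> restricted_pencil (plane \<alpha>) \<phi> i"
  proof
    fix f assume "f \<in> form_pencil (pencil_form j k l m \<phi>) (pencil_form j l k m \<phi>)"
    then obtain x y where f: "f = (\<lambda>t. x * pencil_form j k l m \<phi> t + y * pencil_form j l k m \<phi> t)"
      unfolding form_pencil_def by blast
    define C where "C = (\<chi> r s. x * prod_form (zdiff j k) (zdiff l m) $ r $ s + y * prod_form (zdiff j l) (zdiff k m) $ r $ s)"
    have C: "bform C z z = x * ((zc z j - zc z k) * (zc z l - zc z m)) + y * ((zc z j - zc z l) * (zc z k - zc z m))" for z
    proof -
      have "bform C z z = x * bform (prod_form (zdiff j k) (zdiff l m)) z z + y * bform (prod_form (zdiff j l) (zdiff k m)) z z"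
        by (simp add: bform_def C_def sum_4 algebra_simps)
      then show ?thesis unfolding bform_prod_form zdiff_sum by simp
    qed
    have "transpose C = C" by (simp add: transpose_def C_def prod_form_def vec_eq_iff algebra_simps)
    moreover have "\<forall>n\<in>{1..5} - {i}. \<forall>v\<in>desargues_point (plane \<alpha>) i n. bform C v v = 0"
      unfolding sub desargues_point_def C
      using span_rp2_iff[OF idx'(1)] span_rp2_iff[OF idx'(2)] span_rp2_iff[OF idx'(3)] span_rp2_iff[OF idx'(4)]
      by auto
    moreover have "f = (\<lambda>t. bform C (\<phi> t) (\<phi> t))" unfolding f C pencil_form_def ..
    ultimately show "f \<in> restricted_pencil (plane \<alpha>) \<phi> i" unfolding restricted_pencil_def by blast
  qed
  show "restricted_pencil (plane \<alpha>) \<phi> i \<subseteq> form_pencil (pencil_form j k l m \<phi>) (pencil_form j l k m \<phi>)"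
  proof
    fix f assume "f \<in> restricted_pencil (plane \<alpha>) \<phi> i"
    then obtain C where f: "f = (\<lambda>t. bform C (\<phi> t) (\<phi> t))" and C: "transpose C = C"
      and van: "\<forall>n\<in>{1..5} - {i}. \<forall>v\<in>desargues_point (plane \<alpha>) i n. bform C v v = 0"
      unfolding restricted_pencil_def by blast
    have sym: "bform C u v = bform C v u" for u v using bform_sym[OF C] .
    have ai: "ac \<alpha> i \<noteq> 0" using ac_nonzero[OF nd] mem by blast
    define w where "w = (\<lambda>n. rp n - (ac \<alpha> n / ac \<alpha> i) *s rp i)"
    have wd: "w n = (- 1 / ac \<alpha> i) *s dpt \<alpha> i n" for n
      using ai by (simp add: w_def dpt_def vec_eq_iff field_simps)
    have w: "bform C (w n) (w n) = 0" if n: "n \<in> {j, k, l, m}" for n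
    proof -
      have "w n \<in> desargues_point (plane \<alpha>) i n"
        using desargues_point_eq[OF nd, of i n] mem n wd[of n] by blast
      then show ?thesis using van n unfolding sub by blast
    qed
    have wm: "w j + w k + w l + w m = 0"
    proof -
      have "ac \<alpha> i + ac \<alpha> j + ac \<alpha> k + ac \<alpha> l + ac \<alpha> m = 0" using sum_ac[of \<alpha>] unfolding sum_five[OF idx] .
      then have s: "(ac \<alpha> j + ac \<alpha> k + ac \<alpha> l + ac \<alpha> m) / ac \<alpha> i = - 1" using ai
        by (simp add: divide_eq_eq add_eq_0_iff algebra_simps)
      have "w j + w k + w l + w m = rp j + rp k + rp l + rp m - ((ac \<alpha> j + ac \<alpha> k + ac \<alpha> l + ac \<alpha> m) / ac \<alpha> i) *s rp i"
        by (simp add: w_def vec_eq_iff add_divide_distrib algebra_simps)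
      also have "\<dots> = rp i + rp j + rp k + rp l + rp m" unfolding s by simp
      finally show ?thesis using sum_rp[OF idx] by simp
    qed
    define cjk cjl ckl where c: "cjk = bform C (w j) (w k)" "cjl = bform C (w j) (w l)" "ckl = bform C (w k) (w l)"
    have "w m = - (w j + w k + w l)" using wm by (simp only: add_eq_0_iff)
    then have "w m = - 1 *s (w j + w k + w l)" by simp
    then have "bform C (w m) (w m) = bform C (w j + w k + w l) (w j + w k + w l)"
      by (simp only: bform_linear(3,6)) simp
    then have "bform C (w j + w k + w l) (w j + w k + w l) = 0" using w[of m] by simp
    then have cc: "cjk + cjl + ckl = 0"
      using w[of j] w[of k] w[of l] sym[of "w k" "w j"] sym[of "w l" "w j"] sym[of "w l" "w k"]
      unfolding bform_linear c[symmetric] by simp algebra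
    have "bform C z z = 2 * cjl * ((zc z j - zc z k) * (zc z l - zc z m)) + 2 * cjk * ((zc z j - zc z l) * (zc z k - zc z m))"
      if z: "z \<in> plane \<alpha>" for z
    proof -
      define y where "y = (\<lambda>n. zc z n - zc z m)"
      have "(\<Sum>n\<in>{1..5}. ac \<alpha> n * y n) = (\<Sum>n\<in>{1..5}. ac \<alpha> n * zc z n) - (\<Sum>n\<in>{1..5}. ac \<alpha> n) * zc z m"
        unfolding y_def sum_distrib_right sum_subtractf[symmetric] by (simp only: right_diff_distrib)
      also have "\<dots> = 0" using z sum_ac[of \<alpha>] unfolding plane_ac by simp
      finally have "ac \<alpha> i * y i + ac \<alpha> j * y j + ac \<alpha> k * y k + ac \<alpha> l * y l + ac \<alpha> m * y m = 0"
        unfolding sum_five[OF idx] .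
      then have yi: "y i = - (ac \<alpha> j * y j + ac \<alpha> k * y k + ac \<alpha> l * y l) / ac \<alpha> i"
        using ai by (simp add: y_def field_simps add_eq_0_iff)
      have "z = y i *s rp i + y j *s rp j + y k *s rp k + y l *s rp l"
        using rp_expand[OF idx, of z "zc z m"] by (simp add: y_def)
      also have "\<dots> = y j *s w j + y k *s w k + y l *s w l"
        unfolding yi w_def by (simp add: vec_eq_iff add_divide_distrib diff_divide_distrib algebra_simps)
      finally have zz: "z = y j *s w j + y k *s w k + y l *s w l" .
      have "bform C z z = 2 * (cjk * y j * y k + cjl * y j * y l + ckl * y k * y l)"
        unfolding zz bform_linear using w[of j] w[of k] w[of l] sym[of "w k" "w j"] sym[of "w l" "w j"] sym[of "w l" "w k"]
        unfolding c[symmetric] by (simp add: algebra_simps)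
      also have "\<dots> = 2 * cjl * ((y j - y k) * y l) + 2 * cjk * ((y j - y l) * y k)"
        using cc by algebra
      finally show ?thesis by (simp add: y_def)
    qed
    then have "f = (\<lambda>t. (2 * cjl) * pencil_form j k l m \<phi> t + (2 * cjk) * pencil_form j l k m \<phi> t)"
      unfolding f pencil_form_def using pl by blast
    then show "f \<in> form_pencil (pencil_form j k l m \<phi>) (pencil_form j l k m \<phi>)"
      unfolding form_pencil_def by blast
  qed
qed


text \<open>Puts j, k, l, i in the first four places and m in the fifth; subtracting the coordinate
  of m restores the convention that the fifth is 0.\<close>

definition reindex :: "nat \<Rightarrow> nat \<Rightarrow> nat \<Rightarrow> nat \<Rightarrow> nat \<Rightarrow> complex^4 \<Rightarrow> complex^4" where
  "reindex i j k l m z = vector [zc z j - zc z m, zc z k - zc z m, zc z l - zc z m, zc z i - zc z m]"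

definition reindex_coeffs :: "nat \<Rightarrow> nat \<Rightarrow> nat \<Rightarrow> nat \<Rightarrow> complex^4 \<Rightarrow> complex^4" where
  "reindex_coeffs i j k l \<alpha> = vector [ac \<alpha> j, ac \<alpha> k, ac \<alpha> l, ac \<alpha> i]"

text \<open>Reduces all five pencils of a configuration to the one of \<open>frame_pencil_jacobian\<close>.\<close>

lemma reindex_frame:
  assumes nd: "nondeg \<alpha>" and idx: "{i, j, k, l, m} = {1..5::nat}"
  shows "nondeg (reindex_coeffs i j k l \<alpha>)"
    "frame \<alpha> \<nu> A B C \<Longrightarrow> frame (reindex_coeffs i j k l \<alpha>) \<nu> (reindex i j k l m A) (reindex i j k l m B) (reindex i j k l m C)"
    "wdot \<alpha> 1 z = 0 \<Longrightarrow> wdot \<alpha> z z = 0 \<Longrightarrow> cubic_form (reindex_coeffs i j k l \<alpha>) (reindex i j k l m z) = cubic_form \<alpha> z"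
proof -
  let ?c = "ac \<alpha>"
  note mem = five_mem[OF idx]
  let ?a = "reindex_coeffs i j k l \<alpha>" and ?r = "reindex i j k l m"
  have s0: "?c i + ?c j + ?c k + ?c l + ?c m = 0" using sum_ac[of \<alpha>] unfolding sum_five[OF idx] .
  have "asum ?a = - ?c m" using s0 by (simp add: asum_def reindex_coeffs_def vector_4 eq_neg_iff_add_eq_0 ac_simps)
  then show nd': "nondeg ?a" using ac_nonzero[OF nd] mem
    unfolding nondeg_def forall_4 by (simp add: reindex_coeffs_def vector_4)
  have one: "wdot \<alpha> 1 u = ?c i * zc u i + ?c j * zc u j + ?c k * zc u k + ?c l * zc u l + ?c m * zc u m" for u
  proof -
    have "wdot \<alpha> 1 u = (\<Sum>n\<in>{1..5}. ?c n * zc u n)"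
      unfolding sum_one_five by (simp add: wdot_4 ac_simps5 zc_simps)
    then show ?thesis unfolding sum_five[OF idx] .
  qed
  have two: "wdot \<alpha> u v = ?c i * zc u i * zc v i + ?c j * zc u j * zc v j + ?c k * zc u k * zc v k
     + ?c l * zc u l * zc v l + ?c m * zc u m * zc v m" for u v
    unfolding wdot_ac sum_five[OF idx] ..
  have r1: "wdot ?a 1 (?r u) = wdot \<alpha> 1 u" for u
  proof -
    have "wdot ?a 1 (?r u) = ?c j * (zc u j - zc u m) + ?c k * (zc u k - zc u m) + ?c l * (zc u l - zc u m) + ?c i * (zc u i - zc u m)"
      by (simp add: wdot_4 reindex_coeffs_def reindex_def vector_4)
    also have "\<dots> = wdot \<alpha> 1 u" unfolding one using s0 by algebra
    finally show ?thesis .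
  qed
  have r2: "wdot ?a (?r u) (?r v) = wdot \<alpha> u v" if "wdot \<alpha> 1 u = 0" "wdot \<alpha> 1 v = 0" for u v
  proof -
    have "wdot ?a (?r u) (?r v) = ?c j * (zc u j - zc u m) * (zc v j - zc v m) + ?c k * (zc u k - zc u m) * (zc v k - zc v m)
        + ?c l * (zc u l - zc u m) * (zc v l - zc v m) + ?c i * (zc u i - zc u m) * (zc v i - zc v m)"
      by (simp add: wdot_4 reindex_coeffs_def reindex_def vector_4)
    also have "\<dots> = wdot \<alpha> u v" using that[unfolded one] s0 unfolding two by algebra
    finally show ?thesis .
  qed
  show "frame ?a \<nu> (?r A) (?r B) (?r C)" if "frame \<alpha> \<nu> A B C"
    using that unfolding frame_gram[OF nd] frame_gram[OF nd'] gram_def using r1 r2 by simp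
  show "cubic_form ?a (?r z) = cubic_form \<alpha> z" if "wdot \<alpha> 1 z = 0" "wdot \<alpha> z z = 0"
  proof -
    have three: "cubic_form \<alpha> z = ?c i * zc z i ^ 3 + ?c j * zc z j ^ 3 + ?c k * zc z k ^ 3
     + ?c l * zc z l ^ 3 + ?c m * zc z m ^ 3"
    proof -
      have "cubic_form \<alpha> z = (\<Sum>n\<in>{1..5}. ?c n * zc z n ^ 3)"
        unfolding sum_one_five by (simp add: cubic_form_def sum_4 ac_simps5 zc_simps)
      then show ?thesis unfolding sum_five[OF idx] .
    qed
    have "cubic_form ?a (?r z) = ?c j * (zc z j - zc z m) ^ 3 + ?c k * (zc z k - zc z m) ^ 3
        + ?c l * (zc z l - zc z m) ^ 3 + ?c i * (zc z i - zc z m) ^ 3"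
      by (simp add: cubic_form_def sum_4 reindex_coeffs_def reindex_def vector_4)
    also have "\<dots> = cubic_form \<alpha> z" using that(1)[unfolded one] that(2)[unfolded two] s0 unfolding three by algebra
    finally show ?thesis .
  qed
qed

lemma zc_quadmap: "zc (quadmap A B C t) n = qd (zc A n) (zc B n) (zc C n) t"
  by (simp add: zc_def qd_def)

lemma qd_diff: "qd a b c t - qd a' b' c' t = qd (a - a') (b - b') (c - c') t"
  by (simp add: qd_def algebra_simps)

lemma pencil_form_jacobian:
  assumes nd: "nondeg \<alpha>" and fr: "frame \<alpha> \<nu> A B C" and idx: "{i, j, k, l, m} = {1..5::nat}"
  shows "\<exists>c. c \<noteq> 0 \<and> jacobian_form (pencil_form j k l m (quadmap A B C)) (pencil_form j l k m (quadmap A B C))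
     = (\<lambda>t. c * cubic_form \<alpha> (quadmap A B C t))"
proof -
  let ?r = "reindex i j k l m"
  let ?q = "quadmap (?r A) (?r B) (?r C)"
  have q: "?q t = ?r (quadmap A B C t)" for t
    by (simp add: vec_eq_iff forall_4 reindex_def vector_4 zc_quadmap qd_diff)
  obtain c where c: "c \<noteq> 0" "jacobian_form (\<lambda>t. (?q t $ 1 - ?q t $ 2) * ?q t $ 3) (\<lambda>t. (?q t $ 1 - ?q t $ 3) * ?q t $ 2)
      = (\<lambda>t. c * cubic_form (reindex_coeffs i j k l \<alpha>) (?q t))"
    using frame_pencil_jacobian[OF reindex_frame(1,2)[OF nd idx], OF fr] unfolding quadmap_nth by blast
  have "(\<lambda>t. (?q t $ 1 - ?q t $ 2) * ?q t $ 3) = pencil_form j k l m (quadmap A B C)"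
    "(\<lambda>t. (?q t $ 1 - ?q t $ 3) * ?q t $ 2) = pencil_form j l k m (quadmap A B C)"
    unfolding q by (auto simp: fun_eq_iff pencil_form_def reindex_def vector_4)
  moreover have "cubic_form (reindex_coeffs i j k l \<alpha>) (?q t) = cubic_form \<alpha> (quadmap A B C t)" for t
    unfolding q by (rule reindex_frame(3)[OF nd idx frame_on_conic[OF nd fr]])
  ultimately show ?thesis using c by auto
qed

lemma pencil_form_partials: "has_partials (pencil_form j k l m (quadmap A B C))"
  unfolding pencil_form_def zc_quadmap qd_diff by (intro has_partials_mult has_partials_qd)

section \<open>The Jacobian sextic of a Desargues configuration\<close>

lemma five_complement:
  assumes "i \<in> {1..5::nat}"
  shows "\<exists>j k l m. {i, j, k, l, m} = {1..5}"
proof -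
  have "card ({1..5} - {i}) = 4" using assms by simp
  then obtain j k l m where "{1..5} - {i} = {j, k, l, m}"
    by (auto simp: card_Suc_eq eval_nat_numeral)
  then have "{i, j, k, l, m} = {1..5}" using assms by blast
  then show ?thesis by blast
qed

lemma jacobian_sextic_exists:
  assumes nd: "nondeg \<alpha>" and fr: "frame \<alpha> \<nu> A B C" and idx: "{i, j, k, l, m} = {1..5::nat}"
  shows "jacobian_sextic (plane \<alpha>) (jacobian_form (pencil_form j k l m (quadmap A B C)) (pencil_form j l k m (quadmap A B C)))"
proof -
  have pl: "quadmap A B C t \<in> plane \<alpha>" for t unfolding plane_wdot by (rule frame_on_conic[OF nd fr])
  have "i \<in> {1..5}" using idx by blast
  then show ?thesis
    unfolding jacobian_sextic_def
    using von_staudt_diag[OF nd] frame_parametrization[OF nd fr]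
      restricted_pencil_eq[where \<phi> = "quadmap A B C", OF nd pl idx] by blast
qed

text \<open>The parametrization contributes the substitution \<open>g\<close>, the basis of the
  pencil a factor, and the index \<open>i\<close> another factor, since each of the five pencils has
  the cubic as its Jacobian.\<close>

lemma jacobian_sextic_orbit:
  assumes nd: "nondeg \<alpha>" and fr: "frame \<alpha> \<nu> A B C" and J: "jacobian_sextic (plane \<alpha>) J"
  shows "\<exists>g :: complex^2^2. \<exists>c. invertible g \<and> c \<noteq> 0 \<and> J = (\<lambda>t. c * cubic_form \<alpha> (quadmap A B C (g *v t)))"
proof -
  obtain M \<phi> i f1 f2 where vs: "von_staudt_conic (plane \<alpha>) M" and cp: "conic_parametrization (plane \<alpha>) M \<phi>"
    and i: "i \<in> {1..5}" and rp: "restricted_pencil (plane \<alpha>) \<phi> i = form_pencil f1 f2" and J: "J = jacobian_form f1 f2"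
    using J unfolding jacobian_sextic_def by blast
  obtain g :: "complex^2^2" where g: "invertible g" "\<forall>t. \<phi> t = quadmap A B C (g *v t)"
    using parametrization_frame[OF nd fr vs cp] by blast
  obtain \<nu>' A' B' C' where fr': "frame \<alpha> \<nu>' A' B' C'" and e: "\<forall>t. quadmap A B C (g *v t) = quadmap A' B' C' t"
    using frame_subst[OF fr g(1)] by blast
  have \<phi>: "\<phi> = quadmap A' B' C'" using g e by auto
  obtain j k l m where idx: "{i, j, k, l, m} = {1..5}" using five_complement[OF i] by blast
  have pl: "\<phi> t \<in> plane \<alpha>" for t unfolding plane_wdot \<phi> by (rule frame_on_conic[OF nd fr'])
  have fp: "form_pencil f1 f2 = form_pencil (pencil_form j k l m \<phi>) (pencil_form j l k m \<phi>)"
    using restricted_pencil_eq[OF nd pl idx] rp by simp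
  obtain c where c: "c \<noteq> 0" "J = (\<lambda>t. c * jacobian_form (pencil_form j k l m \<phi>) (pencil_form j l k m \<phi>) t)"
    using jacobian_form_pencil[OF fp] pencil_form_partials unfolding \<phi> J by blast
  obtain c' where c': "c' \<noteq> 0" "jacobian_form (pencil_form j k l m \<phi>) (pencil_form j l k m \<phi>) = (\<lambda>t. c' * cubic_form \<alpha> (quadmap A' B' C' t))"
    using pencil_form_jacobian[OF nd fr' idx] unfolding \<phi> by blast
  have "J = (\<lambda>t. (c * c') * cubic_form \<alpha> (quadmap A B C (g *v t)))"
    unfolding c(2) c'(2) using e by (simp add: mult.assoc)
  then show ?thesis using g(1) c(1) c'(1) by (intro exI[of _ g] exI[of _ "c * c'"]) simp
qed

section \<open>Transport along the projective automorphisms permuting the reference points\<close>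

definition dotc :: "complex^4 \<Rightarrow> complex^4 \<Rightarrow> complex" where
  "dotc u v = (\<Sum>i\<in>UNIV. u $ i * v $ i)"

lemma bform_dotc: "bform B u v = dotc u (B *v v)"
  by (simp add: bform_def dotc_def matrix_vector_mult_def sum_distrib_left mult_ac)

lemma dotc_transpose: "dotc (M *v u) v = dotc u (transpose M *v v)"
  unfolding dotc_def matrix_vector_mult_def transpose_def
  by (simp add: sum_distrib_left sum_distrib_right mult_ac) (rule sum.swap)

lemma bform_congruence: "bform (transpose M ** B ** M) u v = bform B (M *v u) (M *v v)"
  by (simp add: bform_dotc dotc_transpose matrix_vector_mul_assoc matrix_mul_assoc)


lemma matrix_span_image: "vec.span ((*v) (M :: complex^4^4) ` S) = (*v) M ` vec.span S"
proof
  have "vec.subspace ((*v) M ` vec.span S)"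
    unfolding vec.subspace_def
  proof (intro conjI ballI allI)
    have "M *v 0 \<in> (*v) M ` vec.span S" by (intro imageI vec.span_zero)
    then show "0 \<in> (*v) M ` vec.span S" by simp
  next
    fix x y assume "x \<in> (*v) M ` vec.span S" "y \<in> (*v) M ` vec.span S"
    then show "x + y \<in> (*v) M ` vec.span S"
      by (auto simp flip: matrix_vector_right_distrib intro: vec.span_add)
  next
    fix x c assume "x \<in> (*v) M ` vec.span S"
    then obtain u where u: "u \<in> vec.span S" "x = M *v u" by blast
    then have "c *s x = M *v (c *s u)" by (simp add: vector_scalar_commute)
    then show "c *s x \<in> (*v) M ` vec.span S" using vec.span_scale[OF u(1), of c] by blast
  qed
  then show "vec.span ((*v) M ` S) \<subseteq> (*v) M ` vec.span S"
    by (intro vec.span_minimal image_mono vec.span_superset)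
  have "vec.subspace {x. M *v x \<in> vec.span ((*v) M ` S)}"
    unfolding vec.subspace_def
    by (auto simp: matrix_vector_right_distrib vector_scalar_commute intro: vec.span_add vec.span_scale vec.span_zero)
  moreover have "S \<subseteq> {x. M *v x \<in> vec.span ((*v) M ` S)}" by (auto intro: vec.span_base)
  ultimately have "vec.span S \<subseteq> {x. M *v x \<in> vec.span ((*v) M ` S)}" by (intro vec.span_minimal)
  then show "(*v) M ` vec.span S \<subseteq> vec.span ((*v) M ` S)" by blast
qed

text \<open>Every ingredient of the sextic is pulled back from \<open>\<pi>'\<close> to
  \<open>\<pi>\<close>. Together with reflexivity of \<open>S5_rel\<close>, this direction
  identifies the sextics of a whole class with those of one fixed representative.\<close>

locale S5_transport =
  fixes M M' :: "complex^4^4" and \<sigma> :: "nat \<Rightarrow> nat" and \<pi> \<pi>' :: "(complex^4) set"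
  assumes inv: "M ** M' = mat 1" "M' ** M = mat 1"
    and perm: "\<sigma> permutes {1..5}"
    and ref: "\<And>i. i \<in> {1..5} \<Longrightarrow> vec.span {M *v ref_pt i} = vec.span {ref_pt (\<sigma> i)}"
    and img: "\<pi>' = (\<lambda>z. M *v z) ` \<pi>"
begin

lemma cancel: "M' *v (M *v v) = v" "M *v (M' *v v) = v"
  using inv by (simp_all add: matrix_vector_mul_assoc)

lemma mult_image_iff: "M *v v \<in> (*v) M ` S \<longleftrightarrow> v \<in> S"
proof
  assume "M *v v \<in> (*v) M ` S"
  then obtain w where w: "w \<in> S" "M *v v = M *v w" by blast
  then have "M' *v (M *v v) = M' *v (M *v w)" by simp
  then show "v \<in> S" using w(1) unfolding cancel by simp
qed simp

lemma plane_iff: "M *v v \<in> \<pi>' \<longleftrightarrow> v \<in> \<pi>"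
  unfolding img by (rule mult_image_iff)

lemma plane_iff': "v \<in> \<pi>' \<longleftrightarrow> M' *v v \<in> \<pi>"
  using plane_iff[of "M' *v v"] cancel by simp

lemma span_iff:
  assumes "I \<subseteq> {1..5}"
  shows "M *v v \<in> vec.span (ref_pt ` \<sigma> ` I) \<longleftrightarrow> v \<in> vec.span (ref_pt ` I)"
proof -
  have 1: "vec.span (ref_pt ` \<sigma> ` I) = vec.span ((*v) M ` ref_pt ` I)"
  proof
    show "vec.span (ref_pt ` \<sigma> ` I) \<subseteq> vec.span ((*v) M ` ref_pt ` I)"
    proof (intro vec.span_minimal vec.subspace_span subsetI)
      fix x assume "x \<in> ref_pt ` \<sigma> ` I"
      then obtain i where i: "i \<in> I" "x = ref_pt (\<sigma> i)" by blast
      then have "x \<in> vec.span {M *v ref_pt i}" using ref assms by (metis insertI1 subsetD vec.span_base)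
      then show "x \<in> vec.span ((*v) M ` ref_pt ` I)"
        using i(1) vec.span_mono[of "{M *v ref_pt i}" "(*v) M ` ref_pt ` I"] by blast
    qed
    show "vec.span ((*v) M ` ref_pt ` I) \<subseteq> vec.span (ref_pt ` \<sigma> ` I)"
    proof (intro vec.span_minimal vec.subspace_span subsetI)
      fix x assume "x \<in> (*v) M ` ref_pt ` I"
      then obtain i where i: "i \<in> I" "x = M *v ref_pt i" by blast
      then have "x \<in> vec.span {ref_pt (\<sigma> i)}" using ref assms by (metis insertI1 subsetD vec.span_base)
      then show "x \<in> vec.span (ref_pt ` \<sigma> ` I)"
        using i(1) vec.span_mono[of "{ref_pt (\<sigma> i)}" "ref_pt ` \<sigma> ` I"] by blast
    qed
  qed
  show ?thesis unfolding 1 matrix_span_image by (rule mult_image_iff)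
qed

lemma point_iff:
  assumes "i \<in> {1..5}" "j \<in> {1..5}"
  shows "M *v v \<in> desargues_point \<pi>' (\<sigma> i) (\<sigma> j) \<longleftrightarrow> v \<in> desargues_point \<pi> i j"
  using span_iff[of "{i, j}" v] assms plane_iff unfolding desargues_point_def by simp

lemma line_iff:
  assumes "i \<in> {1..5}" "j \<in> {1..5}" "k \<in> {1..5}"
  shows "M *v v \<in> desargues_line \<pi>' (\<sigma> i) (\<sigma> j) (\<sigma> k) \<longleftrightarrow> v \<in> desargues_line \<pi> i j k"
  using span_iff[of "{i, j, k}" v] assms plane_iff unfolding desargues_line_def by simp

lemma von_staudt:
  assumes "von_staudt_conic \<pi>' B"
  shows "von_staudt_conic \<pi> (transpose M ** B ** M)"
  unfolding von_staudt_conic_def smooth_conic_def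
proof (intro conjI allI impI ballI)
  have B: "transpose B = B" using assms unfolding von_staudt_conic_def smooth_conic_def by blast
  show "transpose (transpose M ** B ** M) = transpose M ** B ** M"
    by (simp add: matrix_transpose_mul B matrix_mul_assoc)
next
  fix u assume u: "u \<in> \<pi>" "\<forall>v\<in>\<pi>. bform (transpose M ** B ** M) u v = 0"
  have "bform B (M *v u) v = 0" if "v \<in> \<pi>'" for v
    using u(2) that plane_iff'[of v] cancel[of v] unfolding bform_congruence by metis
  then have "M *v u = 0" using assms u(1) plane_iff[of u] unfolding von_staudt_conic_def smooth_conic_def by blast
  then show "u = 0" using cancel(1)[of u] by simp
next
  fix i j k l m :: nat assume idx: "{i, j, k, l, m} = {1..5}"
  note mem = five_mem[OF idx]
  have "\<sigma> ` {i, j, k, l, m} = {1..5}" unfolding idx using perm by (rule permutes_image)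
  then have "{\<sigma> i, \<sigma> j, \<sigma> k, \<sigma> l, \<sigma> m} = {1..5}" by simp
  then have pol: "polar_line \<pi>' B (desargues_point \<pi>' (\<sigma> i) (\<sigma> j)) = desargues_line \<pi>' (\<sigma> k) (\<sigma> l) (\<sigma> m)"
    using assms unfolding von_staudt_conic_def by blast
  have "v \<in> polar_line \<pi> (transpose M ** B ** M) (desargues_point \<pi> i j) \<longleftrightarrow>
      M *v v \<in> polar_line \<pi>' B (desargues_point \<pi>' (\<sigma> i) (\<sigma> j))" for v
  proof -
    have "(\<forall>u\<in>desargues_point \<pi> i j. bform B (M *v u) (M *v v) = 0) \<longleftrightarrow>
        (\<forall>u\<in>desargues_point \<pi>' (\<sigma> i) (\<sigma> j). bform B u (M *v v) = 0)"
      using point_iff[of i j] mem cancel by metis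
    then show ?thesis unfolding polar_line_def bform_congruence using plane_iff by simp
  qed
  then show "polar_line \<pi> (transpose M ** B ** M) (desargues_point \<pi> i j) = desargues_line \<pi> k l m"
    unfolding pol using line_iff[of k l m] mem by blast
qed

lemma parametrization:
  assumes "conic_parametrization \<pi>' B \<phi>"
  shows "conic_parametrization \<pi> (transpose M ** B ** M) (\<lambda>t. M' *v \<phi> t)"
  unfolding conic_parametrization_def
proof (intro conjI allI impI)
  fix k
  have "(\<lambda>t. \<Sum>j\<in>UNIV. M' $ k $ j * \<phi> t $ j) \<in> binary_forms 2"
    using assms unfolding conic_parametrization_def by (intro binary_forms_sum binary_forms_scale) auto
  then show "(\<lambda>t. (M' *v \<phi> t) $ k) \<in> binary_forms 2" by (simp add: matrix_vector_mult_def)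
next
  fix t :: "complex^2" assume "t \<noteq> 0"
  then have "\<phi> t \<noteq> 0" using assms unfolding conic_parametrization_def by blast
  then show "M' *v \<phi> t \<noteq> 0" using cancel(2)[of "\<phi> t"] by auto
next
  have span': "vec.span {M' *v v} = (*v) M' ` vec.span {v}" for v
    using matrix_span_image[of M' "{v}"] by simp
  have pts: "(`) ((*v) M') ` conic_points \<pi>' B = conic_points \<pi> (transpose M ** B ** M)"
  proof (intro subset_antisym subsetI)
    fix P assume "P \<in> (`) ((*v) M') ` conic_points \<pi>' B"
    then obtain v where v: "P = (*v) M' ` vec.span {v}" "v \<in> \<pi>'" "v \<noteq> 0" "\<forall>w\<in>vec.span {v}. bform B w w = 0"
      unfolding conic_points_def proj_points_def by blast
    have "M' *v v \<in> \<pi>" "M' *v v \<noteq> 0" using v plane_iff'[of v] cancel(2)[of v] by auto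
    then show "P \<in> conic_points \<pi> (transpose M ** B ** M)"
      unfolding conic_points_def proj_points_def bform_congruence
      using v(1,4) span'[of v] cancel(2) by auto
  next
    fix P assume "P \<in> conic_points \<pi> (transpose M ** B ** M)"
    then obtain v where v: "P = vec.span {v}" "v \<in> \<pi>" "v \<noteq> 0" "\<forall>w\<in>vec.span {v}. bform B (M *v w) (M *v w) = 0"
      unfolding conic_points_def proj_points_def bform_congruence by blast
    have e: "P = (*v) M' ` vec.span {M *v v}" using span'[of "M *v v"] v(1) cancel(1) by simp
    have "vec.span {M *v v} = (*v) M ` vec.span {v}" using matrix_span_image[of M "{v}"] by simp
    moreover have "M *v v \<in> \<pi>'" "M *v v \<noteq> 0" using v plane_iff cancel(1)[of v] by auto
    ultimately have "vec.span {M *v v} \<in> conic_points \<pi>' B"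
      unfolding conic_points_def proj_points_def using v(4) by auto
    then show "P \<in> (`) ((*v) M') ` conic_points \<pi>' B" unfolding e by blast
  qed
  have "inj ((*v) M')" using cancel(2) by (metis injI)
  then have "inj_on ((`) ((*v) M')) (conic_points \<pi>' B)"
    by (meson inj_image_eq_iff inj_onI)
  then have b: "bij_betw ((`) ((*v) M')) (conic_points \<pi>' B) (conic_points \<pi> (transpose M ** B ** M))"
    unfolding bij_betw_def using pts by blast
  have "bij_betw (\<lambda>L. vec.span (\<phi> ` L)) (proj_points UNIV) (conic_points \<pi>' B)"
    using assms unfolding conic_parametrization_def by blast
  from bij_betw_trans[OF this b]
  have "bij_betw ((`) ((*v) M') \<circ> (\<lambda>L. vec.span (\<phi> ` L))) (proj_points UNIV) (conic_points \<pi> (transpose M ** B ** M))" .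
  moreover have "((`) ((*v) M') \<circ> (\<lambda>L. vec.span (\<phi> ` L))) = (\<lambda>L. vec.span ((\<lambda>t. M' *v \<phi> t) ` L))"
    unfolding comp_def matrix_span_image[symmetric] image_image ..
  ultimately show "bij_betw (\<lambda>L. vec.span ((\<lambda>t. M' *v \<phi> t) ` L)) (proj_points UNIV) (conic_points \<pi> (transpose M ** B ** M))"
    by simp
qed

lemma pencil:
  assumes "i \<in> {1..5}"
  shows "restricted_pencil \<pi>' \<phi> (\<sigma> i) = restricted_pencil \<pi> (\<lambda>t. M' *v \<phi> t) i"
proof (intro subset_antisym subsetI)
  have mem: "\<sigma> n \<in> {1..5} \<longleftrightarrow> n \<in> {1..5}" for n using permutes_in_image[OF perm] .
  have inj: "\<sigma> n = \<sigma> n' \<longleftrightarrow> n = n'" for n n' using permutes_inj[OF perm] by (simp add: inj_eq)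
  fix f assume "f \<in> restricted_pencil \<pi>' \<phi> (\<sigma> i)"
  then obtain C where C: "f = (\<lambda>t. bform C (\<phi> t) (\<phi> t))" "transpose C = C"
    "\<forall>j\<in>{1..5} - {\<sigma> i}. \<forall>v\<in>desargues_point \<pi>' (\<sigma> i) j. bform C v v = 0"
    unfolding restricted_pencil_def by blast
  have "\<forall>j\<in>{1..5} - {i}. \<forall>v\<in>desargues_point \<pi> i j. bform (transpose M ** C ** M) v v = 0"
    unfolding bform_congruence
  proof (intro ballI)
    fix j v assume j: "j \<in> {1..5} - {i}" and v: "v \<in> desargues_point \<pi> i j"
    have "\<sigma> j \<in> {1..5} - {\<sigma> i}" using j mem[of j] inj by simp
    then show "bform C (M *v v) (M *v v) = 0" using C(3) point_iff[of i j v] v assms j by blast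
  qed
  moreover have "transpose (transpose M ** C ** M) = transpose M ** C ** M"
    by (simp add: matrix_transpose_mul C(2) matrix_mul_assoc)
  moreover have "f = (\<lambda>t. bform (transpose M ** C ** M) (M' *v \<phi> t) (M' *v \<phi> t))"
    unfolding bform_congruence cancel C(1) ..
  ultimately show "f \<in> restricted_pencil \<pi> (\<lambda>t. M' *v \<phi> t) i" unfolding restricted_pencil_def by blast
next
  have mem: "\<sigma> n \<in> {1..5} \<longleftrightarrow> n \<in> {1..5}" for n using permutes_in_image[OF perm] .
  fix f assume "f \<in> restricted_pencil \<pi> (\<lambda>t. M' *v \<phi> t) i"
  then obtain C where C: "f = (\<lambda>t. bform C (M' *v \<phi> t) (M' *v \<phi> t))" "transpose C = C"
    "\<forall>j\<in>{1..5} - {i}. \<forall>v\<in>desargues_point \<pi> i j. bform C v v = 0"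
    unfolding restricted_pencil_def by blast
  have "\<forall>j\<in>{1..5} - {\<sigma> i}. \<forall>v\<in>desargues_point \<pi>' (\<sigma> i) j. bform (transpose M' ** C ** M') v v = 0"
    unfolding bform_congruence
  proof (intro ballI)
    fix j v assume j: "j \<in> {1..5} - {\<sigma> i}" and v: "v \<in> desargues_point \<pi>' (\<sigma> i) j"
    have "j \<in> \<sigma> ` {1..5}" using j permutes_image[OF perm] by simp
    then obtain n where n: "n \<in> {1..5}" "j = \<sigma> n" by blast
    then have "n \<in> {1..5} - {i}" using j by blast
    then show "bform C (M' *v v) (M' *v v) = 0" using C(3) point_iff[of i n "M' *v v"] v assms n cancel(2) by auto
  qed
  moreover have "transpose (transpose M' ** C ** M') = transpose M' ** C ** M'"
    by (simp add: matrix_transpose_mul C(2) matrix_mul_assoc)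
  moreover have "f = (\<lambda>t. bform (transpose M' ** C ** M') (\<phi> t) (\<phi> t))"
    unfolding bform_congruence C(1) ..
  ultimately show "f \<in> restricted_pencil \<pi>' \<phi> (\<sigma> i)" unfolding restricted_pencil_def by blast
qed

lemma pullback_sextic: "jacobian_sextic \<pi>' J \<Longrightarrow> jacobian_sextic \<pi> J"
proof -
  assume "jacobian_sextic \<pi>' J"
  then obtain B \<phi> i' f1 f2 where h: "von_staudt_conic \<pi>' B" "conic_parametrization \<pi>' B \<phi>" "i' \<in> {1..5}"
    "restricted_pencil \<pi>' \<phi> i' = form_pencil f1 f2" "J = jacobian_form f1 f2"
    unfolding jacobian_sextic_def by blast
  have "i' \<in> \<sigma> ` {1..5}" using h(3) permutes_image[OF perm] by simp
  then obtain i where i: "i \<in> {1..5}" "i' = \<sigma> i" by blast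
  show ?thesis unfolding jacobian_sextic_def
    using von_staudt[OF h(1)] parametrization[OF h(2)] pencil[OF i(1), of \<phi>] i h(4,5) by metis
qed

end

lemma S5_rel_sextic:
  assumes "(\<pi>, \<pi>') \<in> S5_rel" "jacobian_sextic \<pi>' J"
  shows "jacobian_sextic \<pi> J"
proof -
  obtain M \<sigma> where M: "\<pi>' = (\<lambda>z. M *v z) ` \<pi>" "invertible M" "\<sigma> permutes {1..5}"
    "\<forall>i\<in>{1..5}. vec.span {M *v ref_pt i} = vec.span {ref_pt (\<sigma> i)}"
    using assms(1) unfolding S5_rel_def S5_matrices_def by blast
  obtain M' where "M ** M' = mat 1" "M' ** M = mat 1" using M(2) unfolding invertible_def by blast
  then interpret S5_transport M M' \<sigma> \<pi> \<pi>' using M by unfold_locales auto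
  show ?thesis by (rule pullback_sextic[OF assms(2)])
qed

lemma S5_rel_refl: "(\<pi>, \<pi>) \<in> S5_rel"
proof -
  have "invertible (mat 1 :: complex^4^4)" unfolding invertible_def by (intro exI[of _ "mat 1"]) simp
  then have "(mat 1 :: complex^4^4) \<in> S5_matrices"
    unfolding S5_matrices_def using permutes_id[of "{1..5::nat}"] by (auto intro!: exI[of _ id])
  then show ?thesis unfolding S5_rel_def by force
qed

section \<open>The map to the moduli space of stable sextics\<close>

lemma nondegenerate_planes_nondeg:
  "nondegenerate_planes = {plane \<alpha> | \<alpha>. nondeg \<alpha>}"
proof -
  have "ref_pt i \<notin> plane \<alpha> \<longleftrightarrow> ac \<alpha> i \<noteq> 0" if "i \<in> {1..5}" for i \<alpha>
  proof -
    have "ref_pt 5 \<in> plane \<alpha> \<longleftrightarrow> asum \<alpha> = 0" by (simp add: ref_pt_def plane_def sum_4 vector_4 asum_def)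
    moreover have "ref_pt 1 \<in> plane \<alpha> \<longleftrightarrow> \<alpha> $ 1 = 0" "ref_pt 2 \<in> plane \<alpha> \<longleftrightarrow> \<alpha> $ 2 = 0"
      "ref_pt 3 \<in> plane \<alpha> \<longleftrightarrow> \<alpha> $ 3 = 0" "ref_pt 4 \<in> plane \<alpha> \<longleftrightarrow> \<alpha> $ 4 = 0"
      by (simp_all add: ref_pt_def plane_def sum_4 vector_4)
    ultimately show ?thesis using that unfolding five by (auto simp: ac_simps5)
  qed
  then have "(\<forall>i\<in>{1..5}. ref_pt i \<notin> plane \<alpha>) \<longleftrightarrow> (\<forall>i\<in>{1..5}. ac \<alpha> i \<noteq> 0)" for \<alpha> by blast
  then have e: "(\<forall>i\<in>{1..5}. ref_pt i \<notin> plane \<alpha>) \<longleftrightarrow> nondeg \<alpha>" for \<alpha>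
    unfolding five by (simp add: nondeg_def forall_4 ac_simps5)
  have "\<alpha> \<noteq> 0" if "nondeg \<alpha>" for \<alpha> using that by (auto simp: nondeg_def)
  then show ?thesis unfolding nondegenerate_planes_def e by blast
qed

text \<open>All sextics of all representatives are sextics of this one plane and lie in one orbit,
  so the union in \<open>Phi\<close> collapses to a single class.\<close>

lemma Phi_eq:
  assumes nd: "nondeg \<alpha>" and J: "jacobian_sextic (plane \<alpha>) J"
  shows "Phi (S5_rel `` {plane \<alpha>}) = rho (form_point J)" "stable_sextic J"
proof -
  obtain \<nu> A B C where fr: "frame \<alpha> \<nu> A B C" using frame_exists[OF nd] by blast
  let ?J = "\<lambda>t. cubic_form \<alpha> (quadmap A B C t)"
  have orb: "rho (form_point J) = rho (form_point ?J) \<and> stable_sextic J" if J: "jacobian_sextic (plane \<alpha>) J" for J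
  proof -
    obtain g :: "complex^2^2" and c where g: "invertible g" "c \<noteq> 0" "J = (\<lambda>t. c * cubic_form \<alpha> (quadmap A B C (g *v t)))"
      using jacobian_sextic_orbit[OF nd fr J] by blast
    show ?thesis unfolding g(3) form_point_scale[OF g(2)]
      using rho_subst[OF g(1), of ?J] stable_sextic_scale[OF g(2) stable_sextic_subst[OF g(1) frame_sextic_stable[OF nd fr]]]
      by simp
  qed
  show "stable_sextic J" using orb[OF J] by blast
  have "jacobian_sextic (plane \<alpha>) K" if "\<pi> \<in> S5_rel `` {plane \<alpha>}" "jacobian_sextic \<pi> K" for \<pi> K
    using S5_rel_sextic that by blast
  moreover have "plane \<alpha> \<in> S5_rel `` {plane \<alpha>}" using S5_rel_refl by blast
  ultimately show "Phi (S5_rel `` {plane \<alpha>}) = rho (form_point J)"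
    unfolding Phi_def using orb J by blast
qed

lemma Phi_M_D_subset: "Phi ` M_D \<subseteq> M6b"
proof
  fix Y assume "Y \<in> Phi ` M_D"
  then obtain \<alpha> where nd: "nondeg \<alpha>" and Y: "Y = Phi (S5_rel `` {plane \<alpha>})"
    unfolding M_D_def quotient_def nondegenerate_planes_nondeg by blast
  obtain \<nu> A B C where fr: "frame \<alpha> \<nu> A B C" using frame_exists[OF nd] by blast
  have idx: "{1, 2, 3, 4, 5} = {1..5::nat}" by auto
  note P = Phi_eq[OF nd jacobian_sextic_exists[OF nd fr idx]]
  show "Y \<in> M6b" unfolding Y P(1) M6b_def quotient_def rho_def U_st_def using P(2) by blast
qed


section \<open>Every stable sextic is a Jacobian of quartics\<close>

text \<open>In the index type 5 the number 5 is 0, so the list given to \<open>vector\<close> begins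
  with entry 1 and ends with entry 0.\<close>

definition v5 :: "complex \<Rightarrow> complex \<Rightarrow> complex \<Rightarrow> complex \<Rightarrow> complex \<Rightarrow> complex^5" where
  "v5 a b c d e = vector [b, c, d, e, a]"

lemma v5_simps: "v5 a b c d e $ 0 = a" "v5 a b c d e $ 1 = b" "v5 a b c d e $ 2 = c" "v5 a b c d e $ 3 = d" "v5 a b c d e $ 4 = e"
  by (simp_all add: v5_def vector_def)

lemma exhaust_5: "x = 0 \<or> x = 1 \<or> x = 2 \<or> x = 3 \<or> x = 4" for x :: 5
proof (induct x)
  case (of_int z)
  then have "0 \<le> z" "z < 5" by simp_all
  then have "z = 0 \<or> z = 1 \<or> z = 2 \<or> z = 3 \<or> z = 4" by arith
  then show ?case by auto
qed

lemma forall_5: "(\<forall>i::5. P i) \<longleftrightarrow> P 0 \<and> P 1 \<and> P 2 \<and> P 3 \<and> P 4"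
  by (metis exhaust_5)

lemma sextic_eqI: "c 0 = d 0 \<Longrightarrow> c 1 = d 1 \<Longrightarrow> c 2 = d 2 \<Longrightarrow> c 3 = d 3 \<Longrightarrow> c 4 = d 4 \<Longrightarrow> c 5 = d 5 \<Longrightarrow> c 6 = d 6
    \<Longrightarrow> sextic c = sextic d"
  by (rule ext) (simp add: sextic_expand)

abbreviation quartic_jac :: "complex^5 \<Rightarrow> complex^5 \<Rightarrow> complex^2 \<Rightarrow> complex" where
  "quartic_jac a b \<equiv> jacobian_form (quartic a) (quartic b)"

text \<open>
  The Jacobian vanishes at a point iff some member of the pencil vanishes doubly there.  For the
  roots \<open>0\<close> and \<open>\<infinity>\<close> these members are different in the first case and equal in the second.
\<close>

lemma jacobian_two_double:
  "quartic_jac (v5 c (b / 4) (a / 6) 0 0) (v5 0 0 (f / 6) (e / 4) d)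
     = sextic (\<lambda>n. 4 * ([0, 2 * c * f, b * f + 3 * c * e, 2 * b * e + 4 * c * d, a * e + 3 * b * d, 2 * a * d, 0] ! n))"
  by (rule ext) (simp add: jacobian_form_quartic Let_def v5_simps sextic_expand eval_nat_numeral field_simps)

lemma jacobian_common_double:
  "quartic_jac (v5 0 0 (1 / 6) 0 0) (v5 p (q / 4) 0 (r / 4) s)
     = sextic (\<lambda>n. 4 * ([0, - 2 * p, - q, 0, r, 2 * s, 0] ! n))"
  by (rule ext) (simp add: jacobian_form_quartic Let_def v5_simps sextic_expand eval_nat_numeral field_simps)

text \<open>These are the coefficient equations of \<open>jacobian_two_double\<close>. If
  \<open>j1\<close> or \<open>j5\<close> is 0, setting suitable unknowns to 0 and 1 leaves at most a
  quadratic equation. Otherwise put \<open>a = 1\<close>: then \<open>d\<close> is fixed,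
  \<open>e\<close> and \<open>c\<close> are polynomials in \<open>b\<close>, and eliminating
  \<open>f\<close> leaves one equation for \<open>b\<close>.\<close>

lemma wronskian_equations:
  fixes j1 j2 j3 j4 j5 :: complex
  assumes "j3 \<noteq> 0" "(j1, j2) \<noteq> (0, 0)" "(j5, j4) \<noteq> (0, 0)"
  shows "\<exists>a b c d e f. 2 * c * f = j1 \<and> b * f + 3 * c * e = j2 \<and> 2 * b * e + 4 * c * d = j3 \<and> a * e + 3 * b * d = j4 \<and> 2 * a * d = j5"
proof -
  consider (both) "j1 = 0" "j5 = 0" | (one) "j1 = 0" "j5 \<noteq> 0" | (five) "j1 \<noteq> 0" "j5 = 0" | (none) "j1 \<noteq> 0" "j5 \<noteq> 0" by blast
  then show ?thesis
  proof cases
    case both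
    show ?thesis
      by (intro exI[of _ 0] exI[of _ 1] exI[of _ "j4 / 3"] exI[of _ "j3 / 2"] exI[of _ j2])
        (use both in simp)
  next
    case one
    define d where "d = j5 / 2"
    have d: "d \<noteq> 0" using one by (simp add: d_def)
    have "degree [:- j3, 2 * j4, - 6 * d:] > 0" using d by simp
    then obtain b where "poly [:- j3, 2 * j4, - 6 * d:] b = 0" using alg_closed_imp_poly_has_root by blast
    then have b: "2 * b * (j4 - 3 * b * d) = j3" by (simp add: algebra_simps)
    then have "b \<noteq> 0" using assms(1) by auto
    then show ?thesis using b one
      by (intro exI[of _ 1] exI[of _ b] exI[of _ 0] exI[of _ d] exI[of _ "j4 - 3 * b * d"] exI[of _ "j2 / b"])
        (simp add: d_def)
  next
    case five
    define c where "c = j1 / 2"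
    have c: "c \<noteq> 0" using five by (simp add: c_def)
    have "degree [:- j3, 2 * j2, - 6 * c:] > 0" using c by simp
    then obtain e where "poly [:- j3, 2 * j2, - 6 * c:] e = 0" using alg_closed_imp_poly_has_root by blast
    then have e: "2 * (j2 - 3 * c * e) * e = j3" by (simp add: algebra_simps)
    then have "e \<noteq> 0" using assms(1) by auto
    then show ?thesis using e five
      by (intro exI[of _ "j4 / e"] exI[of _ "j2 - 3 * c * e"] exI[of _ c] exI[of _ 0] exI[of _ e] exI[of _ 1])
        (simp add: c_def)
  next
    case none
    define d where "d = j5 / 2"
    have d: "d \<noteq> 0" using none by (simp add: d_def)
    define u where "u = [:j3, - 2 * j4, 6 * d:]"
    define v where "v = [:j4, - 3 * d:]"
    \<comment> \<open>The equation for \<open>j2\<close> multiplied by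
      \<open>16 * c * d\<^sup>2\<close>, with \<open>c = u / (4 * d)\<close>, \<open>e = v\<close>
      and \<open>f = j1 / (2 * c)\<close> substituted.\<close>
    define G where "G = [:0, 8 * d ^ 2 * j1:] - smult (4 * d * j2) u + smult 3 (u * u * v)"
    have "coeff G 5 = - 324 * d ^ 3"
      by (simp add: G_def u_def v_def eval_nat_numeral algebra_simps)
    then have "degree G \<ge> 5" using d by (intro le_degree) simp
    then obtain b where b: "poly G b = 0" using alg_closed_imp_poly_has_root[of G] by auto
    define c where "c = poly u b / (4 * d)"
    define e where "e = poly v b"
    have uc: "poly u b = 4 * d * c" using d by (simp add: c_def)
    have "poly G b = 8 * d ^ 2 * j1 * b - 4 * d * j2 * poly u b + 3 * (poly u b * poly u b * e)"
      by (simp add: G_def e_def)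
    then have "16 * d ^ 2 * (b * j1 / 2 - c * j2 + 3 * c ^ 2 * e) = 0"
      using b unfolding uc by (simp add: power2_eq_square algebra_simps)
    then have main: "b * j1 / 2 - c * j2 + 3 * c ^ 2 * e = 0" using d by simp
    \<comment> \<open>Here a nonzero middle coefficient matters: \<open>c = 0\<close> forces
      \<open>b = 0\<close>, and then \<open>u\<close> takes the value \<open>j3\<close>.\<close>
    have c0: "c \<noteq> 0"
    proof
      assume c: "c = 0"
      then have "b = 0" using main none by simp
      then show False using c uc assms(1) by (simp add: u_def)
    qed
    define f where "f = j1 / (2 * c)"
    have "c * (b * f + 3 * c * e) = c * j2" using main c0 by (simp add: f_def power2_eq_square field_simps)
    then have 2: "b * f + 3 * c * e = j2" using c0 by simp
    have e: "e = j4 - 3 * b * d" by (simp add: e_def v_def)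
    have 3: "2 * b * e + 4 * c * d = j3" using uc unfolding e by (simp add: u_def algebra_simps)
    have "2 * c * f = j1" using c0 by (simp add: f_def)
    moreover have "1 * e + 3 * b * d = j4" "2 * 1 * d = j5" by (simp_all add: e d_def)
    ultimately show ?thesis using 2 3 by blast
  qed
qed

text \<open>If the middle coefficient is 0, a pencil containing
  \<open>t\<^sub>0\<^sup>2 t\<^sub>1\<^sup>2\<close> works, because its equations decouple.\<close>

lemma jacobian_surjective:
  assumes "c 0 = 0" "c 6 = 0" "(c 1, c 2) \<noteq> (0, 0)" "(c 5, c 4) \<noteq> (0, 0)"
  shows "\<exists>a b. quartic_jac a b = sextic c"
proof (cases "c 3 = 0")
  case True
  have "sextic (\<lambda>n. 4 * ([0, - 2 * (- c 1 / 8), - (- c 2 / 4), 0, c 4 / 4, 2 * (c 5 / 8), 0] ! n)) = sextic c"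
    by (rule sextic_eqI) (use assms True in \<open>simp_all add: eval_nat_numeral\<close>)
  then show ?thesis using jacobian_common_double by metis
next
  case False
  obtain a b x d e f where h: "2 * x * f = c 1 / 4" "b * f + 3 * x * e = c 2 / 4" "2 * b * e + 4 * x * d = c 3 / 4"
    "a * e + 3 * b * d = c 4 / 4" "2 * a * d = c 5 / 4"
    using wronskian_equations[of "c 3 / 4" "c 1 / 4" "c 2 / 4" "c 5 / 4" "c 4 / 4"] False assms by auto
  have "sextic (\<lambda>n. 4 * ([0, 2 * x * f, b * f + 3 * x * e, 2 * b * e + 4 * x * d, a * e + 3 * b * d, 2 * a * d, 0] ! n)) = sextic c"
    unfolding h by (rule sextic_eqI) (use assms in \<open>simp_all add: eval_nat_numeral\<close>)
  then show ?thesis using jacobian_two_double by metis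
qed

section \<open>Pencils outside the hypersurface\<close>

lemma quartic_linear: "quartic (x *s a + y *s b) = (\<lambda>t. x * quartic a t + y * quartic b t)"
  by (rule ext) (simp add: quartic_def algebra_simps)

lemma quartic_jacobian_lincomb:
  "quartic_jac (x *s a + y *s b) (z *s a + w *s b)
     = (\<lambda>t. (x * w - y * z) * quartic_jac a b t)"
  unfolding quartic_linear by (rule jacobian_form_lincomb[OF has_partials_quartic has_partials_quartic])

lemma Jac_span:
  assumes "quartic_jac a b \<noteq> (\<lambda>t. 0)"
  shows "Jac (vec.span {a, b}) = form_point (quartic_jac a b)"
proof -
  have "form_point (quartic_jac a' b') = form_point (quartic_jac a b)"
    if W: "vec.span {a, b} = vec.span {a', b'}" for a' b'
  proof -
    have "a' \<in> vec.span {a, b}" "b' \<in> vec.span {a, b}" "a \<in> vec.span {a', b'}" "b \<in> vec.span {a', b'}"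
      using W by (metis insertCI vec.span_base)+
    then obtain x y z w x' y' z' w' where
      1: "a' = x *s a + y *s b" "b' = z *s a + w *s b" and 2: "a = x' *s a' + y' *s b'" "b = z' *s a' + w' *s b'"
      unfolding span_two by blast
    have j1: "quartic_jac a' b' = (\<lambda>t. (x * w - y * z) * quartic_jac a b t)"
      unfolding 1 by (rule quartic_jacobian_lincomb)
    have j2: "quartic_jac a b = (\<lambda>t. (x' * w' - y' * z') * quartic_jac a' b' t)"
      by (subst 2, subst 2(2)) (rule quartic_jacobian_lincomb)
    have "x * w - y * z \<noteq> 0"
    proof
      assume "x * w - y * z = 0"
      then have "quartic_jac a' b' = (\<lambda>t. 0)" using j1 by simp
      then show False using j2 assms by simp
    qed
    then show ?thesis unfolding j1 by (rule form_point_scale)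
  qed
  then have "{form_point (quartic_jac a' b') | a' b'. vec.span {a, b} = vec.span {a', b'}}
      = {form_point (quartic_jac a b)}" by blast
  then show ?thesis unfolding Jac_def by simp
qed

lemma span_Gr14:
  assumes "quartic_jac a b \<noteq> (\<lambda>t. 0)"
  shows "vec.span {a, b} \<in> Gr14"
proof -
  have n: "a \<noteq> x *s b" for x
  proof
    assume "a = x *s b"
    then have "quartic_jac a b = (\<lambda>t. 0)"
      using quartic_jacobian_lincomb[of x b 0 b 1 0] by simp
    then show False using assms by simp
  qed
  have b: "b \<noteq> 0"
  proof
    assume "b = 0"
    then have "quartic_jac a b = (\<lambda>t. 0)"
      using quartic_jacobian_lincomb[of 1 a 0 a 0 0] by simp
    then show False using assms by simp
  qed
  have "a \<notin> vec.span {b}" using n by (auto simp: vec.span_breakdown_eq)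
  moreover have "vec.independent {b}" using b by simp
  ultimately have "vec.independent {a, b}" by (rule vec.independent_insertI)
  then have "vec.dim (vec.span {a, b}) = card {a, b}"
    by (simp add: vec.dim_span vec.dim_eq_card_independent)
  moreover have "a \<noteq> b" using n[of 1] by simp
  ultimately show ?thesis unfolding Gr14_def by (simp add: vec.subspace_span)
qed

text \<open>\<open>D_hyp\<close> asks for one basis with discriminant 0, so this applies to any
  basis of any pencil whose Jacobian is a multiple of \<open>J\<close>.\<close>

lemma discriminant_nonzero:
  assumes st: "stable_sextic J" and H: "rho (form_point J) \<notin> H_hyp" and k: "k \<noteq> 0"
    and J: "quartic_jac a b = (\<lambda>t. k * J t)"
  shows "cubic_discriminant (det_cubic a b) \<noteq> 0"
proof
  assume d: "cubic_discriminant (det_cubic a b) = 0"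
  have "J \<noteq> (\<lambda>t. 0)" using st by (simp add: stable_sextic_def)
  then have nz: "quartic_jac a b \<noteq> (\<lambda>t. 0)" unfolding J using k by (auto simp: fun_eq_iff)
  have "vec.span {a, b} \<in> D_hyp" unfolding D_hyp_def using d span_Gr14[OF nz] by blast
  moreover have "Jac (vec.span {a, b}) = form_point J" unfolding Jac_span[OF nz] unfolding J by (rule form_point_scale[OF k])
  ultimately have "form_point J \<in> Jac ` D_hyp" by (metis imageI)
  moreover have "form_point J \<in> U_st" unfolding U_st_def using st by blast
  ultimately show False using H unfolding H_hyp_def by blast
qed

text \<open>The determinant of \<open>q_matrix a\<close>; it vanishes when the conic of the quartic
  is singular.\<close>

definition hankel_det :: "complex^5 \<Rightarrow> complex" where
  "hankel_det a = a $ 0 * a $ 2 * a $ 4 + 2 * a $ 1 * a $ 2 * a $ 3 - a $ 2 ^ 3 - a $ 0 * a $ 3 ^ 2 - a $ 1 ^ 2 * a $ 4"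

lemma det_sym_pencil:
  fixes s11 s12 s13 s22 s23 s33 t11 t12 t13 t22 t23 t33 :: complex
  shows "[:t11, s11:] * [:t22, s22:] * [:t33, s33:] + 2 * [:t12, s12:] * [:t23, s23:] * [:t13, s13:]
     - [:t13, s13:] * [:t22, s22:] * [:t13, s13:] - [:t11, s11:] * [:t23, s23:] * [:t23, s23:] - [:t12, s12:] * [:t12, s12:] * [:t33, s33:]
    = [:t11 * t22 * t33 + 2 * t12 * t23 * t13 - t13 * t22 * t13 - t11 * t23 * t23 - t12 * t12 * t33,
       s11 * (t22 * t33 - t23 ^ 2) + 2 * s12 * (t13 * t23 - t12 * t33) + 2 * s13 * (t12 * t23 - t13 * t22)
         + s22 * (t11 * t33 - t13 ^ 2) + 2 * s23 * (t12 * t13 - t11 * t23) + s33 * (t11 * t22 - t12 ^ 2),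
       t11 * (s22 * s33 - s23 ^ 2) + 2 * t12 * (s13 * s23 - s12 * s33) + 2 * t13 * (s12 * s23 - s13 * s22)
         + t22 * (s11 * s33 - s13 ^ 2) + 2 * t23 * (s12 * s13 - s11 * s23) + t33 * (s11 * s22 - s12 ^ 2),
       s11 * s22 * s33 + 2 * s12 * s23 * s13 - s13 * s22 * s13 - s11 * s23 * s23 - s12 * s12 * s33:]"
  (is "?l = ?r")
proof (rule poly_ext)
  fix x
  show "poly ?l x = poly ?r x" by (simp add: power2_eq_square algebra_simps)
qed

text \<open>The entry \<open>a $ 2\<close> stands at places 13 and 22 and gets a name for each, so
  that two different expressions for it can be inserted. The middle coefficients pair one matrix
  with the adjugate of the other.\<close>

lemma det_cubic_entries:
  assumes "a $ 0 = s11" "a $ 1 = s12" "a $ 2 = s13" "a $ 2 = s22" "a $ 3 = s23" "a $ 4 = s33"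
    "b $ 0 = t11" "b $ 1 = t12" "b $ 2 = t13" "b $ 2 = t22" "b $ 3 = t23" "b $ 4 = t33"
  shows "det_cubic a b = [:hankel_det b,
       s11 * (t22 * t33 - t23 ^ 2) + 2 * s12 * (t13 * t23 - t12 * t33) + 2 * s13 * (t12 * t23 - t13 * t22)
         + s22 * (t11 * t33 - t13 ^ 2) + 2 * s23 * (t12 * t13 - t11 * t23) + s33 * (t11 * t22 - t12 ^ 2),
       t11 * (s22 * s33 - s23 ^ 2) + 2 * t12 * (s13 * s23 - s12 * s33) + 2 * t13 * (s12 * s23 - s13 * s22)
         + t22 * (s11 * s33 - s13 ^ 2) + 2 * t23 * (s12 * s13 - s11 * s23) + t33 * (s11 * s22 - s12 ^ 2),
       hankel_det a:]"
proof -
  have hb: "hankel_det b = t11 * t22 * t33 + 2 * t12 * t23 * t13 - t13 * t22 * t13 - t11 * t23 * t23 - t12 * t12 * t33"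
    and ha: "hankel_det a = s11 * s22 * s33 + 2 * s12 * s23 * s13 - s13 * s22 * s13 - s11 * s23 * s23 - s12 * s12 * s33"
    unfolding hankel_det_def using assms by (auto simp: power2_eq_square power3_eq_cube)
  have "det_cubic a b = [:t11, s11:] * [:t22, s22:] * [:t33, s33:] + [:t12, s12:] * [:t23, s23:] * [:t13, s13:]
     + [:t13, s13:] * [:t12, s12:] * [:t23, s23:] - [:t11, s11:] * [:t23, s23:] * [:t23, s23:]
     - [:t12, s12:] * [:t12, s12:] * [:t33, s33:] - [:t13, s13:] * [:t22, s22:] * [:t13, s13:]"
    unfolding det_cubic_def det_3 by (simp add: q_matrix_def assms(1,2,3,5-9,11,12) flip: assms(4,10))
  also have "\<dots> = [:t11, s11:] * [:t22, s22:] * [:t33, s33:] + 2 * [:t12, s12:] * [:t23, s23:] * [:t13, s13:]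
     - [:t13, s13:] * [:t22, s22:] * [:t13, s13:] - [:t11, s11:] * [:t23, s23:] * [:t23, s23:] - [:t12, s12:] * [:t12, s12:] * [:t33, s33:]"
    by (simp only: mult_ac mult_2 algebra_simps)
  finally show ?thesis unfolding det_sym_pencil ha hb .
qed

lemma det_cubic_coeffs: "coeff (det_cubic a b) 3 = hankel_det a" "coeff (det_cubic a b) 0 = hankel_det b"
  "degree (det_cubic a b) \<le> 3"
  unfolding det_cubic_entries[OF refl refl refl refl refl refl refl refl refl refl refl refl]
  by (simp_all add: eval_nat_numeral)

lemma det_cubic_poly: "poly (det_cubic a b) x = hankel_det (x *s a + b)"
  unfolding det_cubic_entries[OF refl refl refl refl refl refl refl refl refl refl refl refl]
  by (simp add: hankel_det_def power2_eq_square power3_eq_cube algebra_simps)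

text \<open>The determinant cubic of the new basis is \<open>\<lambda>\<mu>(c\<lambda> + d\<mu>)\<close>, with discriminant \<open>c\<^sup>2 d\<^sup>2\<close>.\<close>

lemma degenerate_basis:
  assumes st: "stable_sextic J" and H: "rho (form_point J) \<notin> H_hyp"
    and J: "quartic_jac a b = J"
  shows "\<exists>a' b' k. k \<noteq> 0 \<and> quartic_jac a' b' = (\<lambda>t. k * J t) \<and>
     hankel_det a' = 0 \<and> hankel_det b' = 0"
proof -
  have "\<exists>a' b' k. k \<noteq> 0 \<and> quartic_jac a' b' = (\<lambda>t. k * J t) \<and> hankel_det a' = 0"
  proof (cases "hankel_det a = 0")
    case True
    then show ?thesis using J by (intro exI[of _ a] exI[of _ b] exI[of _ 1]) simp
  next
    case False
    then have "degree (det_cubic a b) \<ge> 3" by (intro le_degree) (simp add: det_cubic_coeffs)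
    then obtain r where "poly (det_cubic a b) r = 0" using alg_closed_imp_poly_has_root[of "det_cubic a b"] by auto
    then have "hankel_det (r *s a + 1 *s b) = 0" by (simp add: det_cubic_poly)
    moreover have "quartic_jac (r *s a + 1 *s b) (1 *s a + 0 *s b) = (\<lambda>t. - 1 * J t)"
      unfolding quartic_jacobian_lincomb J by simp
    ultimately show ?thesis
      by (intro exI[of _ "r *s a + 1 *s b"] exI[of _ "1 *s a + 0 *s b"] exI[of _ "- 1"]) simp
  qed
  then obtain a' b' k where k: "k \<noteq> 0" "quartic_jac a' b' = (\<lambda>t. k * J t)" "hankel_det a' = 0" by blast
  let ?p = "det_cubic a' b'"
  have "cubic_discriminant ?p \<noteq> 0" by (rule discriminant_nonzero[OF st H k(1,2)])
  \<comment> \<open>With leading coefficient 0 the discriminant is divisible by the square of the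
    next one, so a second root exists at a finite place.\<close>
  then have "coeff ?p 2 \<noteq> 0" using det_cubic_coeffs(1)[of a' b'] k(3) by (auto simp: cubic_discriminant_def Let_def)
  then have "degree ?p \<ge> 2" by (rule le_degree)
  then obtain r where "poly ?p r = 0" using alg_closed_imp_poly_has_root[of ?p] by auto
  then have "hankel_det (r *s a' + 1 *s b') = 0" by (simp add: det_cubic_poly)
  moreover have "quartic_jac (1 *s a' + 0 *s b') (r *s a' + 1 *s b') = (\<lambda>t. k * J t)"
    unfolding quartic_jacobian_lincomb k(2) by simp
  ultimately show ?thesis using k by (intro exI[of _ a'] exI[of _ "r *s a' + 1 *s b'"] exI[of _ k]) simp
qed


section \<open>Lines in the plane of the conic of squares, read as binary quadratics\<close>

definition Qv :: "complex^3 \<Rightarrow> complex^2 \<Rightarrow> complex" where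
  "Qv u = qd (u $ 1) (u $ 2) (u $ 3)"

text \<open>Apolarity of quadratics, i.e. conjugacy of the corresponding lines with respect to the conic.\<close>

definition ap :: "complex^3 \<Rightarrow> complex^3 \<Rightarrow> complex" where
  "ap u v = u $ 1 * v $ 3 + u $ 3 * v $ 1 - u $ 2 * v $ 2 / 2"

text \<open>The 3 by 3 determinant of the three vectors: it vanishes exactly for concurrent
  lines.\<close>

definition br :: "complex^3 \<Rightarrow> complex^3 \<Rightarrow> complex^3 \<Rightarrow> complex" where
  "br u v w = (u $ 1 * v $ 2 - v $ 1 * u $ 2) * w $ 3 + (v $ 1 * w $ 2 - w $ 1 * v $ 2) * u $ 3
     + (w $ 1 * u $ 2 - u $ 1 * w $ 2) * v $ 3"

definition pq :: "complex^3 \<Rightarrow> complex^3 \<Rightarrow> complex^5" where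
  "pq u v = v5 (u $ 1 * v $ 1) ((u $ 1 * v $ 2 + u $ 2 * v $ 1) / 4) ((u $ 1 * v $ 3 + u $ 2 * v $ 2 + u $ 3 * v $ 1) / 6)
     ((u $ 2 * v $ 3 + u $ 3 * v $ 2) / 4) (u $ 3 * v $ 3)"

lemma quartic_pq: "quartic (pq u v) = (\<lambda>t. Qv u t * Qv v t)"
  by (rule ext) (simp add: quartic_def pq_def v5_simps Qv_def qd_def power2_eq_square power3_eq_cube power4_eq_xxxx field_simps)

lemma Qv_linear: "Qv (u + v) t = Qv u t + Qv v t" "Qv (u - v) t = Qv u t - Qv v t" "Qv (c *s u) t = c * Qv u t" "Qv (- u) t = - Qv u t"
  by (simp_all add: Qv_def qd_def algebra_simps)

lemma ap_linear: "ap (u + v) w = ap u w + ap v w" "ap (u - v) w = ap u w - ap v w" "ap (c *s u) w = c * ap u w"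
   "ap w (u + v) = ap w u + ap w v" "ap w (u - v) = ap w u - ap w v" "ap w (c *s u) = c * ap w u" "ap (- u) w = - ap u w" "ap w (- u) = - ap w u"
  by (simp_all add: ap_def field_simps)

lemma ap_sym: "ap u v = ap v u"
  by (simp add: ap_def algebra_simps)

text \<open>
  If \<open>u\<close> and \<open>v\<close> are apolar, the conic of the quartic \<open>u v\<close> is the pair of lines \<open>u\<close>, \<open>v\<close>,
  so its entry \<open>a\<^sub>2\<close> has two expressions.
\<close>

lemma pq_entries:
  assumes "ap u v = 0"
  shows "pq u v $ 0 = u $ 1 * v $ 1" "pq u v $ 1 = (u $ 1 * v $ 2 + u $ 2 * v $ 1) / 4"
    "pq u v $ 2 = (u $ 1 * v $ 3 + u $ 3 * v $ 1) / 2" "pq u v $ 2 = u $ 2 * v $ 2 / 4"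
    "pq u v $ 3 = (u $ 2 * v $ 3 + u $ 3 * v $ 2) / 4" "pq u v $ 4 = u $ 3 * v $ 3"
proof -
  have e: "u $ 1 * v $ 3 + u $ 3 * v $ 1 = u $ 2 * v $ 2 / 2" using assms by (simp add: ap_def)
  have "pq u v $ 2 = ((u $ 1 * v $ 3 + u $ 3 * v $ 1) + u $ 2 * v $ 2) / 6" by (simp add: pq_def v5_simps add_ac)
  then show 1: "pq u v $ 2 = u $ 2 * v $ 2 / 4" unfolding e by simp
  then show "pq u v $ 2 = (u $ 1 * v $ 3 + u $ 3 * v $ 1) / 2" unfolding e by simp
qed (simp_all add: pq_def v5_simps)

text \<open>The adjugate of a line pair is, up to a factor, the square of its vertex. The middle
  coefficients therefore evaluate the two lines of one pair at the vertex of the other.\<close>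

lemma det_cubic_pq:
  assumes "ap u v = 0" "ap w x = 0"
  shows "coeff (det_cubic (pq u v) (pq w x)) 2 = - (br u v w * br u v x) / 16"
    "coeff (det_cubic (pq u v) (pq w x)) 1 = - (br w x u * br w x v) / 16"
    "hankel_det (pq u v) = 0"
proof -
  note e = det_cubic_entries[OF pq_entries[OF assms(1)] pq_entries[OF assms(2)]]
  show "coeff (det_cubic (pq u v) (pq w x)) 2 = - (br u v w * br u v x) / 16"
    unfolding e by (simp add: eval_nat_numeral) (simp add: br_def field_simps)
  show "coeff (det_cubic (pq u v) (pq w x)) 1 = - (br w x u * br w x v) / 16"
    unfolding e by (simp add: eval_nat_numeral) (simp add: br_def field_simps)
  have z: "pq u v $ 2 ^ 3 = pq u v $ 2 * pq u v $ 2 * pq u v $ 2" by (simp add: power3_eq_cube)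
  have "hankel_det (pq u v) = (u $ 1 * v $ 1) * (u $ 2 * v $ 2 / 4) * (u $ 3 * v $ 3)
     + 2 * ((u $ 1 * v $ 2 + u $ 2 * v $ 1) / 4) * ((u $ 2 * v $ 3 + u $ 3 * v $ 2) / 4) * ((u $ 1 * v $ 3 + u $ 3 * v $ 1) / 2)
     - ((u $ 1 * v $ 3 + u $ 3 * v $ 1) / 2) * (u $ 2 * v $ 2 / 4) * ((u $ 1 * v $ 3 + u $ 3 * v $ 1) / 2)
     - (u $ 1 * v $ 1) * ((u $ 2 * v $ 3 + u $ 3 * v $ 2) / 4) ^ 2
     - ((u $ 1 * v $ 2 + u $ 2 * v $ 1) / 4) ^ 2 * (u $ 3 * v $ 3)"
    unfolding hankel_det_def z pq_entries(1,2,5,6)[OF assms(1)] pq_entries(4)[OF assms(1), symmetric]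
      pq_entries(3)[OF assms(1), symmetric] by (simp only: mult_ac)
  then show "hankel_det (pq u v) = 0" by (simp add: power2_eq_square field_simps)
qed

section \<open>Singular ternary quadratic forms split into linear factors\<close>

lemma sqrt_product:
  fixes P R T :: complex
  assumes "P * T = R ^ 2"
  shows "\<exists>p q. p * p = P \<and> q * q = T \<and> p * q = R"
proof (cases "P = 0")
  case True
  then show ?thesis using assms by (intro exI[of _ 0] exI[of _ "csqrt T"]) (simp flip: power2_eq_square)
next
  case False
  define p where "p = csqrt P"
  have p: "p * p = P" by (simp add: p_def flip: power2_eq_square)
  then have "p \<noteq> 0" using False by auto
  moreover have "(R / p) * (R / p) = R ^ 2 / P" unfolding p[symmetric] by (simp add: power2_eq_square)
  then have "(R / p) * (R / p) = T" unfolding assms[symmetric] using False by simp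
  ultimately show ?thesis using p by (intro exI[of _ p] exI[of _ "R / p"]) simp
qed

text \<open>The ternary quadratic form with matrix rows (A, B, C), (B, D, E), (C, E, F) is a product
  of two linear forms.\<close>

definition splits :: "complex \<Rightarrow> complex \<Rightarrow> complex \<Rightarrow> complex \<Rightarrow> complex \<Rightarrow> complex \<Rightarrow> bool" where
  "splits A B C D E F \<longleftrightarrow> (\<exists>l1 l2 l3 m1 m2 m3. A = l1 * m1 \<and> 2 * B = l1 * m2 + l2 * m1 \<and> 2 * C = l1 * m3 + l3 * m1
     \<and> D = l2 * m2 \<and> 2 * E = l2 * m3 + l3 * m2 \<and> F = l3 * m3)"

text \<open>Completing the square: \<open>A q = (A x + B y + C z)\<^sup>2 - (p y + r z)\<^sup>2\<close>.\<close>

lemma splits_corner: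
  assumes "A \<noteq> 0" "A * D * F + 2 * B * C * E - A * E ^ 2 - B ^ 2 * F - C ^ 2 * D = 0"
  shows "splits A B C D E F"
proof -
  have "A * ((B ^ 2 - A * D) * (C ^ 2 - A * F) - (B * C - A * E) ^ 2) = 0"
    using assms(2) by algebra
  then have "(B ^ 2 - A * D) * (C ^ 2 - A * F) = (B * C - A * E) ^ 2"
    using assms(2) by algebra
  then obtain p r where p: "p * p = B ^ 2 - A * D" "r * r = C ^ 2 - A * F" "p * r = B * C - A * E"
    using sqrt_product by blast
  have "A * D = (B + p) * (B - p)" "A * F = (C + r) * (C - r)" "A * (2 * E) = (B + p) * (C - r) + (C + r) * (B - p)"
    using p by algebra+
  then have "D = (B + p) * ((B - p) / A)" "F = (C + r) * ((C - r) / A)" "2 * E = (B + p) * ((C - r) / A) + (C + r) * ((B - p) / A)"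
    using assms(1) by (simp_all add: eq_divide_eq mult.commute flip: add_divide_distrib)
  then show ?thesis unfolding splits_def using assms(1)
    by (intro exI[of _ A] exI[of _ "B + p"] exI[of _ "C + r"] exI[of _ 1] exI[of _ "(B - p) / A"] exI[of _ "(C - r) / A"]) simp
qed

text \<open>A nonzero diagonal entry can be moved to the corner by renaming the variables. With zero
  diagonal the determinant is 2 B C E, and a vanishing coefficient lets one variable factor
  out.\<close>

lemma degenerate_splits:
  assumes "A * D * F + 2 * B * C * E - A * E ^ 2 - B ^ 2 * F - C ^ 2 * D = 0"
  shows "splits A B C D E F"
proof -
  consider "A \<noteq> 0" | "D \<noteq> 0" | "F \<noteq> 0" | "A = 0" "D = 0" "F = 0" by blast
  then show ?thesis
  proof cases
    case 1
    then show ?thesis using splits_corner assms by blast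
  next
    case 2
    then have "splits D B E A C F" using assms by (intro splits_corner) algebra+
    then show ?thesis unfolding splits_def by (metis add.commute)
  next
    case 3
    then have "splits F E C D B A" using assms by (intro splits_corner) algebra+
    then show ?thesis unfolding splits_def by (metis add.commute)
  next
    case 4
    then have "B * C * E = 0" using assms by simp
    then consider "B = 0" | "C = 0" | "E = 0" by auto
    then show ?thesis
    proof cases
      case 1
      then show ?thesis unfolding splits_def using 4
        by (intro exI[of _ 0] exI[of _ 0] exI[of _ 1] exI[of _ "2 * C"] exI[of _ "2 * E"] exI[of _ 0]) simp
    next
      case 2
      then show ?thesis unfolding splits_def using 4
        by (intro exI[of _ 0] exI[of _ 1] exI[of _ 0] exI[of _ "2 * B"] exI[of _ 0] exI[of _ "2 * E"]) simp
    next
      case 3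
      then show ?thesis unfolding splits_def using 4
        by (intro exI[of _ 1] exI[of _ 0] exI[of _ 0] exI[of _ 0] exI[of _ "2 * B"] exI[of _ "2 * C"]) simp
    qed
  qed
qed

lemma degenerate_factor:
  assumes "hankel_det a = 0"
  shows "\<exists>u v. ap u v = 0 \<and> a = pq u v"
proof -
  have "a $ 0 * a $ 2 * a $ 4 + 2 * a $ 1 * a $ 2 * a $ 3 - a $ 0 * a $ 3 ^ 2 - a $ 1 ^ 2 * a $ 4 - a $ 2 ^ 2 * a $ 2 = 0"
    using assms unfolding hankel_det_def by algebra
  from degenerate_splits[OF this] obtain l1 l2 l3 m1 m2 m3 where
    e: "a $ 0 = l1 * m1" "2 * a $ 1 = l1 * m2 + l2 * m1" "2 * a $ 2 = l1 * m3 + l3 * m1" "a $ 2 = l2 * m2"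
      "2 * a $ 3 = l2 * m3 + l3 * m2" "a $ 4 = l3 * m3" unfolding splits_def by blast
  \<comment> \<open>The quartic is the quadratic form of \<open>q_matrix a\<close> at (t0^2, 2 t0
    t1, t1^2), whence the doubled middle entries. Comparing the two expressions for
    \<open>a $ 2\<close> gives apolarity.\<close>
  define u v :: "complex^3" where "u = vector [l1, 2 * l2, l3]" and "v = vector [m1, 2 * m2, m3]"
  have ap: "ap u v = 0" using e(3,4) by (simp add: u_def v_def ap_def)
  have "pq u v = a"
    unfolding vec_eq_iff forall_5 pq_entries(1,2,4,5,6)[OF ap]
    using e by (simp add: u_def v_def) algebra
  then show ?thesis using ap by blast
qed

section \<open>Triangles of lines in the pencil\<close>

definition same_jac :: "complex^3 \<Rightarrow> complex^3 \<Rightarrow> complex^3 \<Rightarrow> complex^3 \<Rightarrow> (complex^2 \<Rightarrow> complex) \<Rightarrow> bool" where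
  "same_jac u v w x J \<longleftrightarrow> (\<exists>k. k \<noteq> 0 \<and> quartic_jac (pq u v) (pq w x) = (\<lambda>t. k * J t))"

lemma same_jac_lincomb:
  assumes "same_jac u v w x J" "a * d - b * c \<noteq> 0"
    "quartic (pq u' v') = (\<lambda>t. a * quartic (pq u v) t + b * quartic (pq w x) t)"
    "quartic (pq w' x') = (\<lambda>t. c * quartic (pq u v) t + d * quartic (pq w x) t)"
  shows "same_jac u' v' w' x' J"
proof -
  obtain k where k: "k \<noteq> 0" "quartic_jac (pq u v) (pq w x) = (\<lambda>t. k * J t)"
    using assms(1) unfolding same_jac_def by blast
  have "quartic_jac (pq u' v') (pq w' x') = (\<lambda>t. ((a * d - b * c) * k) * J t)"
    unfolding assms(3,4) jacobian_form_lincomb[OF has_partials_quartic has_partials_quartic] k(2) by (simp add: mult.assoc)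
  then show ?thesis unfolding same_jac_def using k(1) assms(2) by (intro exI[of _ "(a * d - b * c) * k"]) simp
qed

text \<open>
  The four lines of the two degenerate conics are in general position and can be
  scaled to have sum \<open>0\<close>; then \<open>z\<^sub>1\<close>, \<open>z\<^sub>2 - z\<^sub>1\<close>, \<open>z\<^sub>3 - z\<^sub>2\<close>, \<open>-z\<^sub>3\<close> are these lines.
\<close>

lemma pencil_normal_form:
  assumes st: "stable_sextic J" and H: "rho (form_point J) \<notin> H_hyp"
    and J: "quartic_jac a b = J"
  shows "\<exists>z1 z2 z3. br z1 z2 z3 \<noteq> 0 \<and> ap z1 z3 = ap z1 z2 \<and> ap z2 z3 = ap z1 z2 \<and>
     same_jac z3 (z1 - z2) z1 (z2 - z3) J"
proof -
  obtain a' b' k where k: "k \<noteq> 0" "quartic_jac a' b' = (\<lambda>t. k * J t)"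
    "hankel_det a' = 0" "hankel_det b' = 0" using degenerate_basis[OF st H J] by blast
  obtain l m where a': "ap l m = 0" "a' = pq l m" using degenerate_factor[OF k(3)] by blast
  obtain l' m' where b': "ap l' m' = 0" "b' = pq l' m'" using degenerate_factor[OF k(4)] by blast
  have disc: "cubic_discriminant (det_cubic a' b') \<noteq> 0" by (rule discriminant_nonzero[OF st H k(1,2)])
  have "coeff (det_cubic a' b') 2 \<noteq> 0" "coeff (det_cubic a' b') 1 \<noteq> 0"
    using disc det_cubic_coeffs(1,2)[of a' b'] k(3,4) by (auto simp: cubic_discriminant_def Let_def)
  then have nz: "br l m l' \<noteq> 0" "br l m m' \<noteq> 0" "br l' m' l \<noteq> 0" "br l' m' m \<noteq> 0"
    unfolding a'(2) b'(2) det_cubic_pq[OF a'(1) b'(1)] by auto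
  \<comment> \<open>The signed 3 by 3 determinants are the coefficients of the linear relation
    between four vectors in three-space.\<close>
  define n1 n2 n3 n4 where n: "n1 = br l' m' m" "n2 = - br l' m' l" "n3 = br l m m'" "n4 = - br l m l'"
  have n0: "n1 \<noteq> 0" "n2 \<noteq> 0" "n3 \<noteq> 0" "n4 \<noteq> 0" using nz n by simp_all
  have s: "n1 *s l + n2 *s m + n3 *s l' + n4 *s m' = 0"
    unfolding vec_eq_iff forall_3 by (simp add: n br_def) algebra
  define z1 z2 z3 where z: "z1 = n3 *s l'" "z2 = n3 *s l' + n2 *s m" "z3 = - (n1 *s l)"
  have z12: "z1 - z2 = - (n2 *s m)" by (simp add: z)
  have "n3 *s l' + n2 *s m + n1 *s l + n4 *s m' = 0" using s by (simp only: add_ac)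
  then have z23: "z2 - z3 = - (n4 *s m')" by (simp add: z eq_neg_iff_add_eq_0 add_ac)
  have "br z1 z2 z3 = n1 * n2 * n3 * br l m l'" by (simp add: z br_def algebra_simps)
  then have "br z1 z2 z3 \<noteq> 0" using n0 nz by simp
  moreover have "ap z3 (z1 - z2) = 0" "ap z1 (z2 - z3) = 0"
    unfolding z12 z23 using a'(1) b'(1) by (simp_all add: z ap_linear)
  then have "ap z1 z3 = ap z1 z2" "ap z2 z3 = ap z1 z2" by (simp_all add: ap_linear ap_sym[of z3 z1] ap_sym[of z3 z2])
  moreover have "same_jac l m l' m' J" unfolding same_jac_def using k(1,2) a' b' by blast
  then have "same_jac z3 (z1 - z2) z1 (z2 - z3) J"
    unfolding z12 z23
    by (rule same_jac_lincomb[where a = "n1 * n2" and b = 0 and c = 0 and d = "- n3 * n4"])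
      (use n0 in \<open>auto simp: quartic_pq z Qv_linear algebra_simps\<close>)
  ultimately show ?thesis by blast
qed

text \<open>A Gram determinant; the factor 1/2 is the determinant of the matrix of
  \<open>ap\<close>.\<close>

lemma gram_det: "ap z1 z1 * ap z2 z2 * ap z3 z3 + 2 * ap z1 z2 * ap z2 z3 * ap z1 z3 - ap z1 z1 * ap z2 z3 ^ 2
    - ap z2 z2 * ap z1 z3 ^ 2 - ap z3 z3 * ap z1 z2 ^ 2 = br z1 z2 z3 ^ 2 / 2"
  by (simp add: ap_def br_def power2_eq_square field_simps)

lemma ap_nondegenerate:
  assumes "br z1 z2 z3 \<noteq> 0" "ap x z1 = 0" "ap x z2 = 0" "ap x z3 = 0"
  shows "x = 0"
proof -
  have e: "z1 $ 1 * x $ 3 + z1 $ 2 * (- x $ 2 / 2) + z1 $ 3 * x $ 1 = 0"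
    "z2 $ 1 * x $ 3 + z2 $ 2 * (- x $ 2 / 2) + z2 $ 3 * x $ 1 = 0"
    "z3 $ 1 * x $ 3 + z3 $ 2 * (- x $ 2 / 2) + z3 $ 3 * x $ 1 = 0"
    using assms(2-4) by (simp_all add: ap_def algebra_simps)
  show ?thesis using cofactor_column[OF e br_def] assms(1) by (simp add: vec_eq_iff forall_3)
qed

text \<open>
  When the triangle \<open>z\<^sub>1 z\<^sub>2 z\<^sub>3\<close> is self-polar, the configuration degenerates; the pencil below,
  which has a double base point, is then another preimage of the sextic.
\<close>

lemma self_polar_in_H:
  assumes st: "stable_sextic J" and H: "rho (form_point J) \<notin> H_hyp"
    and nz: "br z1 z2 z3 \<noteq> 0" and ap: "ap z1 z2 = 0" "ap z1 z3 = 0" "ap z2 z3 = 0"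
    and J: "same_jac z3 (z1 - z2) z1 (z2 - z3) J"
  shows False
proof -
  have "ap z1 z1 * ap z2 z2 * ap z3 z3 \<noteq> 0" using gram_det[of z1 z2 z3] nz ap by auto
  then have g: "ap z1 z1 \<noteq> 0" "ap z2 z2 \<noteq> 0" "ap z3 z3 \<noteq> 0" by auto
  define a1 a2 a3 where a: "a1 = 1 / ap z1 z1" "a2 = 1 / ap z2 z2" "a3 = 1 / ap z3 z3"
  \<comment> \<open>Chosen to have product 1 with each of the three lines, so that it is apolar to
    their differences.\<close>
  define L where "L = a1 *s z1 + a2 *s z2 + a3 *s z3"
  have ap1: "ap (z2 - z3) L = 0" using g by (simp add: L_def ap_linear ap ap_sym[of z2 z1] ap_sym[of z3 z1] ap_sym[of z3 z2] a)
  define \<kappa> where "\<kappa> = 2 * br z1 z2 z3"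
  \<comment> \<open>The vector of the Jacobian of two quadratics is apolar to both; in a self-polar
    triangle it is thus a multiple of the third side.\<close>
  define cr :: "complex^3 \<Rightarrow> complex^3 \<Rightarrow> complex^3" where
    "cr = (\<lambda>u v. vector [2 * (u $ 1 * v $ 2 - v $ 1 * u $ 2), 4 * (u $ 1 * v $ 3 - v $ 1 * u $ 3), 2 * (u $ 2 * v $ 3 - v $ 2 * u $ 3)])"
  have cr: "ap (cr u v) w = 2 * br u v w" for u v w by (simp add: cr_def ap_def br_def field_simps)
  have br0: "br u v u = 0" "br u v v = 0" "br z3 z1 z2 = br z1 z2 z3" "br z2 z3 z1 = br z1 z2 z3" for u v
    by (simp_all add: br_def algebra_simps)
  have P: "cr z2 z3 = (\<kappa> * a1) *s z1"
  proof -
    have "cr z2 z3 - (\<kappa> * a1) *s z1 = 0"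
      by (rule ap_nondegenerate[OF nz]) (use g in \<open>simp_all add: ap_linear cr br0 ap \<kappa>_def a\<close>)
    then show ?thesis by simp
  qed
  have Q: "cr z3 z1 = (\<kappa> * a2) *s z2"
  proof -
    have "cr z3 z1 - (\<kappa> * a2) *s z2 = 0"
      by (rule ap_nondegenerate[OF nz]) (use g in \<open>simp_all add: ap_linear cr br0 ap ap_sym[of z2 z1] \<kappa>_def a\<close>)
    then show ?thesis by simp
  qed
  have R: "cr z1 z2 = (\<kappa> * a3) *s z3"
  proof -
    have "cr z1 z2 - (\<kappa> * a3) *s z3 = 0"
      by (rule ap_nondegenerate[OF nz]) (use g in \<open>simp_all add: ap_linear cr br0 ap ap_sym[of z3 z1] ap_sym[of z3 z2] \<kappa>_def a\<close>)
    then show ?thesis by simp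
  qed
  have qj: "qd_jac (u $ 1) (u $ 2) (u $ 3) (v $ 1) (v $ 2) (v $ 3) t = Qv (cr u v) t" for u v t
    by (simp add: qd_jac_def Qv_def cr_def)
  define w1 w2 w3 where w: "w1 = Qv z1" "w2 = Qv z2" "w3 = Qv z3"
  \<comment> \<open>Euler's relation, with the Jacobians replaced by multiples of the sides, becomes
    the diagonal equation of the conic.\<close>
  have iso: "a1 * w1 t ^ 2 + a2 * w2 t ^ 2 + a3 * w3 t ^ 2 = 0" for t
  proof -
    have "\<kappa> * (a1 * w1 t ^ 2 + a2 * w2 t ^ 2 + a3 * w3 t ^ 2) = 0"
      using jacobian_triangle_pencil(2)[of w1 "z1 $ 1" "z1 $ 2" "z1 $ 3" w2 "z2 $ 1" "z2 $ 2" "z2 $ 3" w3 "z3 $ 1" "z3 $ 2" "z3 $ 3" t]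
      unfolding qj P Q R Qv_linear w[symmetric] by (simp add: w Qv_def power2_eq_square algebra_simps)
    then show ?thesis using nz by (simp add: \<kappa>_def)
  qed
  have old: "jacobian_form (\<lambda>t. (w1 t - w2 t) * w3 t) (\<lambda>t. (w1 t - w3 t) * w2 t) t
      = - 2 * \<kappa> * (a1 * w1 t ^ 3 + a2 * w2 t ^ 3 + a3 * w3 t ^ 3)" for t
    using jacobian_triangle_pencil(1)[of w1 "z1 $ 1" "z1 $ 2" "z1 $ 3" w2 "z2 $ 1" "z2 $ 2" "z2 $ 3" w3 "z3 $ 1" "z3 $ 2" "z3 $ 3" t]
    unfolding qj P Q R Qv_linear w[symmetric] by (simp add: w Qv_def power2_eq_square power3_eq_cube algebra_simps)
  \<comment> \<open>The third line pair of the pencil is the sum of the given two: z2 (z1 - z3) = z3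
    (z1 - z2) + z1 (z2 - z3).\<close>
  have "same_jac (z1 - z2) z3 (z1 - z3) z2 J"
    by (rule same_jac_lincomb[OF J, where a = 1 and b = 0 and c = 1 and d = 1])
      (auto simp: quartic_pq Qv_linear algebra_simps)
  then obtain k where k: "k \<noteq> 0" "jacobian_form (\<lambda>t. (w1 t - w2 t) * w3 t) (\<lambda>t. (w1 t - w3 t) * w2 t) = (\<lambda>t. k * J t)"
    unfolding same_jac_def quartic_pq Qv_linear w[symmetric] by blast
  have new: "jacobian_form (\<lambda>t. w2 t * w3 t) (\<lambda>t. (w2 t - w3 t) * (a1 * w1 t + a2 * w2 t + a3 * w3 t)) t
     = 2 * \<kappa> * a1 * (a1 * w1 t ^ 3 + a2 * w2 t ^ 3 + a3 * w3 t ^ 3)" for t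
  proof -
    note d = has_partial_qd
    define p where "p = (\<lambda>u :: complex^3. 2 * u $ 1 * t $ 1 + u $ 2 * t $ 2)"
    define q where "q = (\<lambda>u :: complex^3. u $ 2 * t $ 1 + 2 * u $ 3 * t $ 2)"
    have j: "Qv (cr u v) t = p u * q v - q u * p v" for u v
      by (simp add: cr_def Qv_def qd_def p_def q_def power2_eq_square algebra_simps)
    note dL1 = has_partial_add[OF has_partial_add[OF has_partial_scale[OF d(1)] has_partial_scale[OF d(1)]] has_partial_scale[OF d(1)]]
    note dL2 = has_partial_add[OF has_partial_add[OF has_partial_scale[OF d(2)] has_partial_scale[OF d(2)]] has_partial_scale[OF d(2)]]
    have "jacobian_form (\<lambda>t. w2 t * w3 t) (\<lambda>t. (w2 t - w3 t) * (a1 * w1 t + a2 * w2 t + a3 * w3 t)) t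
     = (p z2 * w3 t + w2 t * p z3) * ((q z2 - q z3) * (a1 * w1 t + a2 * w2 t + a3 * w3 t) + (w2 t - w3 t) * (a1 * q z1 + a2 * q z2 + a3 * q z3))
      - (q z2 * w3 t + w2 t * q z3) * ((p z2 - p z3) * (a1 * w1 t + a2 * w2 t + a3 * w3 t) + (w2 t - w3 t) * (a1 * p z1 + a2 * p z2 + a3 * p z3))"
      unfolding w Qv_def
      unfolding jacobian_form_partials[OF has_partial_mult[OF d(1) d(1)] has_partial_mult[OF d(2) d(2)]
         has_partial_mult[OF has_partial_diff[OF d(1) d(1)] dL1] has_partial_mult[OF has_partial_diff[OF d(2) d(2)] dL2]]
      unfolding p_def q_def ..
    also have "\<dots> = - Qv (cr z2 z3) t * (a1 * w1 t + a2 * w2 t + a3 * w3 t) * (w2 t + w3 t)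
       + (w2 t - w3 t) * (w2 t * (a1 * Qv (cr z3 z1) t - a2 * Qv (cr z2 z3) t) + w3 t * (a3 * Qv (cr z2 z3) t - a1 * Qv (cr z1 z2) t))"
      unfolding j by (simp add: algebra_simps)
    also have "\<dots> = \<kappa> * a1 * (- w1 t * (a1 * w1 t + a2 * w2 t + a3 * w3 t) * (w2 t + w3 t)
       + (w2 t - w3 t) * (w2 t * (a2 * w2 t - a2 * w1 t) + w3 t * (a3 * w1 t - a3 * w3 t)))"
      unfolding P Q R Qv_linear w[symmetric] by (simp add: algebra_simps)
    also have "\<dots> = 2 * \<kappa> * a1 * (a1 * w1 t ^ 3 + a2 * w2 t ^ 3 + a3 * w3 t ^ 3)
        - \<kappa> * a1 * (2 * w1 t + w2 t + w3 t) * (a1 * w1 t ^ 2 + a2 * w2 t ^ 2 + a3 * w3 t ^ 2)"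
      by algebra
    finally show ?thesis using iso[of t] by simp
  qed
  have "quartic_jac (pq z2 z3) (pq (z2 - z3) L) = (\<lambda>t. (- a1 * k) * J t)"
  proof
    fix t
    have "quartic_jac (pq z2 z3) (pq (z2 - z3) L) t
       = jacobian_form (\<lambda>t. w2 t * w3 t) (\<lambda>t. (w2 t - w3 t) * (a1 * w1 t + a2 * w2 t + a3 * w3 t)) t"
      unfolding quartic_pq L_def Qv_linear w ..
    also have "\<dots> = - a1 * (k * J t)"
      using fun_cong[OF k(2), of t] unfolding new old by algebra
    finally show "quartic_jac (pq z2 z3) (pq (z2 - z3) L) t = (- a1 * k) * J t" by simp
  qed
  moreover have "- a1 * k \<noteq> 0" using k(1) g by (simp add: a)
  ultimately have "cubic_discriminant (det_cubic (pq z2 z3) (pq (z2 - z3) L)) \<noteq> 0"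
    using discriminant_nonzero[OF st H] by blast
  \<comment> \<open>The line \<open>z2 - z3\<close> passes through the vertex of the pair
    \<open>z2\<close>, \<open>z3\<close>. So the two highest coefficients of the determinant cubic
    vanish, a double root at infinity.\<close>
  moreover have "br z2 z3 (z2 - z3) = 0" by (simp add: br_def algebra_simps)
  ultimately show False
    using det_cubic_pq[OF ap(3) ap1] det_cubic_pq(3)[OF ap1 ap(3)]
      det_cubic_coeffs(1,2)[of "pq z2 z3" "pq (z2 - z3) L"]
    by (simp add: cubic_discriminant_def Let_def)
qed

text \<open>The facts \<open>k0\<close>, \<open>k1\<close>, \<open>k2\<close>, \<open>k3\<close>
  exclude the four triangles with vertices among the base points from being self-polar. They make
  four of the five coefficients finite and nonzero; the remaining one is controlled by the Gram
  determinant.\<close>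

lemma desargues_preimage:
  assumes st: "stable_sextic J" and H: "rho (form_point J) \<notin> H_hyp"
    and J: "quartic_jac a b = J"
  shows "\<exists>\<alpha> k. nondeg \<alpha> \<and> k \<noteq> 0 \<and> jacobian_sextic (plane \<alpha>) (\<lambda>t. k * J t)"
proof -
  obtain z1 z2 z3 where nz: "br z1 z2 z3 \<noteq> 0" and z13: "ap z1 z3 = ap z1 z2" and z23: "ap z2 z3 = ap z1 z2"
    and SJ: "same_jac z3 (z1 - z2) z1 (z2 - z3) J" using pencil_normal_form[OF st H J] by blast
  define \<kappa> where "\<kappa> = ap z1 z2"
  have G: "ap z1 z2 = \<kappa>" "ap z2 z1 = \<kappa>" "ap z1 z3 = \<kappa>" "ap z3 z1 = \<kappa>" "ap z2 z3 = \<kappa>" "ap z3 z2 = \<kappa>"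
    using z13 z23 by (simp_all add: \<kappa>_def ap_sym[of z2 z1] ap_sym[of z3 z1] ap_sym[of z3 z2])
  have k0: "\<kappa> \<noteq> 0"
  proof
    assume "\<kappa> = 0"
    then show False using self_polar_in_H[OF st H nz _ _ _ SJ] G by simp
  qed
  have k1: "ap z1 z1 \<noteq> \<kappa>"
  proof
    assume e: "ap z1 z1 = \<kappa>"
    \<comment> \<open>The same pencil seen from the triangle \<open>z1\<close>,
      \<open>z1 - z2\<close>, \<open>z1 - z3\<close>, in which the fourth base point replaces a
      vertex. The next two facts treat the other triangles likewise.\<close>
    have "same_jac (z1 - z3) (z1 - (z1 - z2)) z1 ((z1 - z2) - (z1 - z3)) J"
      by (rule same_jac_lincomb[OF SJ, where a = 1 and b = 1 and c = 0 and d = "- 1"])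
        (auto simp: quartic_pq Qv_linear algebra_simps)
    moreover have "br z1 (z1 - z2) (z1 - z3) \<noteq> 0"
      using nz by (simp add: br_def algebra_simps)
    ultimately show False
      by (rule self_polar_in_H[OF st H _ _ _ _, rotated -1]) (simp_all add: ap_linear e G)
  qed
  have k2: "ap z2 z2 \<noteq> \<kappa>"
  proof
    assume e: "ap z2 z2 = \<kappa>"
    have "same_jac (z2 - z3) ((z2 - z1) - z2) (z2 - z1) (z2 - (z2 - z3)) J"
      by (rule same_jac_lincomb[OF SJ, where a = 0 and b = "- 1" and c = "- 1" and d = 0])
        (auto simp: quartic_pq Qv_linear algebra_simps)
    moreover have "br (z2 - z1) z2 (z2 - z3) \<noteq> 0"
      using nz by (simp add: br_def algebra_simps)
    ultimately show False
      by (rule self_polar_in_H[OF st H _ _ _ _, rotated -1]) (simp_all add: ap_linear e G)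
  qed
  have k3: "ap z3 z3 \<noteq> \<kappa>"
  proof
    assume e: "ap z3 z3 = \<kappa>"
    have "same_jac z3 ((z3 - z1) - (z3 - z2)) (z3 - z1) ((z3 - z2) - z3) J"
      by (rule same_jac_lincomb[OF SJ, where a = "- 1" and b = 0 and c = 1 and d = 1])
        (auto simp: quartic_pq Qv_linear algebra_simps)
    moreover have "br (z3 - z1) (z3 - z2) z3 \<noteq> 0"
      using nz by (simp add: br_def algebra_simps)
    ultimately show False
      by (rule self_polar_in_H[OF st H _ _ _ _, rotated -1]) (simp_all add: ap_linear e G)
  qed
  \<comment> \<open>Solves for the coefficients in the required Gram matrix; \<open>a4\<close> then
    makes all five sum to 0.\<close>
  define a1 a2 a3 a5 where a: "a1 = 1 / (ap z1 z1 - \<kappa>)" "a2 = 1 / (ap z2 z2 - \<kappa>)" "a3 = 1 / (ap z3 z3 - \<kappa>)" "a5 = 1 / \<kappa>"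
  define a4 where "a4 = - (a1 + a2 + a3 + a5)"
  have a0: "a1 \<noteq> 0" "a2 \<noteq> 0" "a3 \<noteq> 0" "a5 \<noteq> 0" using k0 k1 k2 k3 by (simp_all add: a)
  have g: "ap z1 z1 = 1 / a1 + \<kappa>" "ap z2 z2 = 1 / a2 + \<kappa>" "ap z3 z3 = 1 / a3 + \<kappa>" "\<kappa> = 1 / a5" by (simp_all add: a)
  have a4: "a4 \<noteq> 0"
  proof
    assume "a4 = 0"
    then have a5': "a5 = - (a1 + a2 + a3)" by (simp add: a4_def add_eq_0_iff algebra_simps)
    \<comment> \<open>In general this determinant is
      \<open>- a4 / (a1 * a2 * a3 * a5)\<close>.\<close>
    have "br z1 z2 z3 ^ 2 / 2 = (1 / a1 + \<kappa>) * (1 / a2 + \<kappa>) * (1 / a3 + \<kappa>) + 2 * \<kappa> ^ 3 - (1 / a1 + \<kappa>) * \<kappa> ^ 2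
        - (1 / a2 + \<kappa>) * \<kappa> ^ 2 - (1 / a3 + \<kappa>) * \<kappa> ^ 2"
      unfolding gram_det[of z1 z2 z3, symmetric] G g(1-3) by (simp add: power3_eq_cube power2_eq_square)
    also have "\<dots> = (a5 + a1 + a2 + a3) / (a1 * a2 * a3 * a5)"
      unfolding g(4) using a0 by (simp add: power3_eq_cube power2_eq_square field_simps)
    also have "\<dots> = 0" unfolding a5' by simp
    finally show False using nz by simp
  qed
  \<comment> \<open>Forced by the equation of the plane, in which the fifth coordinate is 0.\<close>
  define z4 where "z4 = (- 1 / a4) *s (a1 *s z1 + a2 *s z2 + a3 *s z3)"
  have z4l: "ap z4 v = (- 1 / a4) * (a1 * ap z1 v + a2 * ap z2 v + a3 * ap z3 v)" for v
    by (simp only: z4_def ap_linear)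
  have s: "a1 + a2 + a3 = - a4 - a5" by (simp add: a4_def)
  have z4: "ap z4 z1 = \<kappa>" "ap z4 z2 = \<kappa>" "ap z4 z3 = \<kappa>"
  proof -
    have t: "1 + \<kappa> * (a1 + a2 + a3) = - \<kappa> * a4" unfolding s g(4) using a0 by (simp add: field_simps)
    have "a1 * ap z1 z1 + a2 * ap z2 z1 + a3 * ap z3 z1 = 1 + \<kappa> * (a1 + a2 + a3)"
      "a1 * ap z1 z2 + a2 * ap z2 z2 + a3 * ap z3 z2 = 1 + \<kappa> * (a1 + a2 + a3)"
      "a1 * ap z1 z3 + a2 * ap z2 z3 + a3 * ap z3 z3 = 1 + \<kappa> * (a1 + a2 + a3)"
      unfolding G g(1-3) using a0 by (simp_all add: algebra_simps)
    then show "ap z4 z1 = \<kappa>" "ap z4 z2 = \<kappa>" "ap z4 z3 = \<kappa>" unfolding z4l t using a4 by simp_all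
  qed
  have z44: "ap z4 z4 = 1 / a4 + \<kappa>"
  proof -
    have "ap z4 z4 = (- 1 / a4) * (\<kappa> * (a1 + a2 + a3))"
      unfolding z4l[of z4] ap_sym[of z1 z4] ap_sym[of z2 z4] ap_sym[of z3 z4] z4 by (simp add: algebra_simps)
    also have "\<dots> = 1 / a4 + \<kappa>" unfolding s g(4) using a0 a4 by (simp add: field_simps)
    finally show ?thesis .
  qed
  define \<alpha> :: "complex^4" where "\<alpha> = vector [a1, a2, a3, a4]"
  have asum: "asum \<alpha> = - a5" by (simp add: \<alpha>_def asum_def vector_4 a4_def)
  have nd: "nondeg \<alpha>" unfolding nondeg_def asum forall_4 using a0 a4 by (simp add: \<alpha>_def vector_4)
  define A :: "complex^4" where "A = vector [z1 $ 1, z2 $ 1, z3 $ 1, z4 $ 1]"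
  define B :: "complex^4" where "B = vector [z1 $ 2, z2 $ 2, z3 $ 2, z4 $ 2]"
  define C :: "complex^4" where "C = vector [z1 $ 3, z2 $ 3, z3 $ 3, z4 $ 3]"
  have fr: "frame \<alpha> 1 A B C"
  proof -
    define zz where "zz = (\<lambda>i::4. if i = 1 then z1 else if i = 2 then z2 else if i = 3 then z3 else z4)"
    have e: "A $ i * C $ j + C $ i * A $ j - B $ i * B $ j / 2 = ap (zz i) (zz j)" for i j
    proof -
      have "\<forall>i. A $ i = zz i $ 1 \<and> B $ i = zz i $ 2 \<and> C $ i = zz i $ 3"
        unfolding forall_4 by (simp add: A_def B_def C_def zz_def vector_4)
      then show ?thesis by (simp add: ap_def)
    qed
    have "\<forall>i j. ap (zz i) (zz j) = 1 * ((if i = j then 1 / \<alpha> $ i else 0) - 1 / asum \<alpha>)"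
      unfolding asum forall_4
      by (simp add: zz_def G z4 z44 g(1-3) \<alpha>_def vector_4 ap_sym[of z1 z4] ap_sym[of z2 z4] ap_sym[of z3 z4]) (simp add: g(4))
    then show ?thesis unfolding frame_def e by simp
  qed
  \<comment> \<open>The pencil through the points p_4n has line pairs in the coordinates 1, 2, 3, 5
    only; the last being 0, it is the given pencil.\<close>
  have idx: "{4, 1, 2, 3, 5} = {1..5::nat}" by auto
  have zc: "zc (quadmap A B C t) 1 = Qv z1 t" "zc (quadmap A B C t) 2 = Qv z2 t" "zc (quadmap A B C t) 3 = Qv z3 t"
    "zc (quadmap A B C t) 5 = 0" for t
    by (simp_all only: zc_simps quadmap_nth) (simp_all add: A_def B_def C_def vector_4 Qv_def)
  have "same_jac (z1 - z2) z3 (z1 - z3) z2 J"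
    by (rule same_jac_lincomb[OF SJ, where a = 1 and b = 0 and c = 1 and d = 1])
      (auto simp: quartic_pq Qv_linear algebra_simps)
  then obtain k where k: "k \<noteq> 0" "quartic_jac (pq (z1 - z2) z3) (pq (z1 - z3) z2) = (\<lambda>t. k * J t)"
    unfolding same_jac_def by blast
  have "pencil_form 1 2 3 5 (quadmap A B C) = quartic (pq (z1 - z2) z3)"
    "pencil_form 1 3 2 5 (quadmap A B C) = quartic (pq (z1 - z3) z2)"
    unfolding pencil_form_def quartic_pq zc Qv_linear by simp_all
  then have "jacobian_sextic (plane \<alpha>) (\<lambda>t. k * J t)"
    using jacobian_sextic_exists[OF nd fr idx] k(2) by simp
  then show ?thesis using nd k(1) by blast
qed

theorem proposition5p2:
  shows "M6b - H_hyp \<subseteq> Phi ` M_D \<and> Phi ` M_D \<subseteq> M6b"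
proof
  show "Phi ` M_D \<subseteq> M6b" by (rule Phi_M_D_subset)
  show "M6b - H_hyp \<subseteq> Phi ` M_D"
  proof
    fix X assume X: "X \<in> M6b - H_hyp"
    then obtain f where f: "stable_sextic f" "X = rho (form_point f)"
      unfolding M6b_def quotient_def U_st_def rho_def by blast
    obtain g :: "complex^2^2" and c where g: "invertible g" "(\<lambda>t. f (g *v t)) = sextic c" "c 0 = 0" "c 6 = 0"
      "(c 1, c 2) \<noteq> (0, 0)" "(c 5, c 4) \<noteq> (0, 0)" using stable_normal_form[OF f(1)] by blast
    have st: "stable_sextic (sextic c)" using stable_sextic_subst[OF g(1) f(1)] g(2) by simp
    have XJ: "X = rho (form_point (sextic c))" using rho_subst[OF g(1), of f] unfolding g(2) f(2) by simp
    obtain a b where J: "quartic_jac a b = sextic c"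
      using jacobian_surjective[OF g(3-6)] by blast
    obtain \<alpha> k where a: "nondeg \<alpha>" "k \<noteq> 0" "jacobian_sextic (plane \<alpha>) (\<lambda>t. k * sextic c t)"
      using desargues_preimage[OF st _ J] X XJ by auto
    have "Phi (S5_rel `` {plane \<alpha>}) = X"
      unfolding Phi_eq(1)[OF a(1,3)] XJ form_point_scale[OF a(2)] ..
    moreover have "S5_rel `` {plane \<alpha>} \<in> M_D"
      unfolding M_D_def nondegenerate_planes_nondeg using a(1) by (intro quotientI) blast
    ultimately show "X \<in> Phi ` M_D" by blast
  qed
qed

end
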